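(* Let $\delta\in\mathbb Z^S$ be not a square in $\mathbb Q$. Then \[ L^S(s,\delta)=\Big(\frac{|\delta|'_{\infty,q}}{\pi}\Big)^{\frac12-s}\prod_{i=1}^r\frac{1-\epsilon_iq_i^{-s}}{1-\epsilon_iq_i^{s-1}}\,\frac{\Gamma((\iota+1-s)/2)}{\Gamma((\iota+s)/2)}\,L^S(1-s,\delta), \] where $|\delta|'_{\infty,q}=|\tau_\delta|$, $\epsilon_i=(\tau_\delta/q_i)\in\{0,\pm1\}$, and $\iota=0$ if $\delta>0$, $\iota=1$ if $\delta<0$.
   Context: $q_1,\dots,q_r$ distinct primes with $2$ among them, $S=\{\infty,q_1,\dots,q_r\}$, $\mathbb Z^S=\{\alpha\in\mathbb Q:v_\ell(\alpha)\ge0$ for all primes $\ell\notin S\}$, $\mathbb Z_{(S)}^{>0}$ the positive integers prime to all $q_i$; $(d/k)=\prod_{p\mid k}(d/p)^{v_p(k)}$ for $d\in\mathbb Z^S,k\in\mathbb Z_{(S)}^{>0}$. $L^S(s,\delta)=\sum_ff^{1-2s}\sum_{k\in\mathbb Z_{(S)}^{>0}}(\frac{\delta/f^2}{k})k^{-s}$ (analytically continued), $f$ over $\mathbb Z^{>0}_{(S)}$ with $\delta/f^2\in\mathbb Z^S$. Write $\delta=\sigma^2D$ with $D$ the fundamental discriminant of $\mathbb Q(\sqrt\delta)$, $\sigma_{(q)}=\prod_iq_i^{v_{q_i}(\sigma)}$, $\tau_\delta=\delta/\sigma_{(q)}^2$; $(\tau_\delta/q_i)$ is the Kronecker symbol.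 *)

theory Defs
  imports "HOL-Analysis.Analysis" "HOL-Number_Theory.Number_Theory" "HOL-Computational_Algebra.Squarefree"
begin

text \<open>The set S of finite places is given by a finite set Q of primes (the q_i).\<close>

definition inZS :: "nat set \<Rightarrow> rat \<Rightarrow> bool" where
  "inZS Q \<alpha> \<longleftrightarrow> (\<forall>l::nat. prime l \<and> l \<notin> Q \<longrightarrow> \<not> (int l dvd snd (quotient_of \<alpha>)))"

definition ZS_pos :: "nat set \<Rightarrow> nat set" where
  "ZS_pos Q = {k. 0 < k \<and> (\<forall>q\<in>Q. coprime k q)}"

text \<open>(d/p) for d = a/b in Z^S and p an (odd) prime outside S: the Legendre symbol of
  d viewed as a p-adic unit or non-unit; since b is prime to p, (a/b / p) = (a*b / p).\<close>
definition symb_p :: "rat \<Rightarrow> nat \<Rightarrow> int" where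
  "symb_p d p = (case quotient_of d of (a, b) \<Rightarrow> Legendre (a * b) (int p))"

definition symb :: "rat \<Rightarrow> nat \<Rightarrow> int" where
  "symb d k = (\<Prod>p\<in>prime_factors k. symb_p d p ^ multiplicity p k)"

definition f_set :: "nat set \<Rightarrow> rat \<Rightarrow> nat set" where
  "f_set Q \<delta> = {f \<in> ZS_pos Q. inZS Q (\<delta> / (of_nat f)^2)}"

text \<open>The defining Dirichlet series of L^S(s,delta) (meaningful for Re s > 1).\<close>
definition LS_series :: "nat set \<Rightarrow> rat \<Rightarrow> complex \<Rightarrow> complex" where
  "LS_series Q \<delta> s =
     (\<Sum>f\<in>f_set Q \<delta>. (of_nat f) powr (1 - 2 * s) *
        (\<Sum>\<^sub>\<infinity>k\<in>ZS_pos Q. of_int (symb (\<delta> / (of_nat f)^2) k) * (of_nat k) powr (- s)))"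

definition fund_disc :: "int \<Rightarrow> bool" where
  "fund_disc D \<longleftrightarrow> D \<noteq> 1 \<and>
     ((D mod 4 = 1 \<and> squarefree D) \<or>
      (4 dvd D \<and> squarefree (D div 4) \<and> ((D div 4) mod 4 = 2 \<or> (D div 4) mod 4 = 3)))"

text \<open>Fundamental discriminant of Q(sqrt delta), delta a non-square.\<close>
definition disc :: "rat \<Rightarrow> int" where
  "disc \<delta> = (THE D. fund_disc D \<and> (\<exists>\<sigma>::rat. \<delta> = \<sigma>^2 * of_int D))"

definition sigma :: "rat \<Rightarrow> rat" where
  "sigma \<delta> = (SOME \<sigma>. 0 < \<sigma> \<and> \<delta> = \<sigma>^2 * of_int (disc \<delta>))"

definition rval :: "nat \<Rightarrow> rat \<Rightarrow> int" where
  "rval p x = (case quotient_of x of (a, b) \<Rightarrow>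
      int (multiplicity (int p) a) - int (multiplicity (int p) b))"

definition sigma_q :: "nat set \<Rightarrow> rat \<Rightarrow> rat" where
  "sigma_q Q \<delta> = (\<Prod>q\<in>Q. (of_nat q) powi (rval q (sigma \<delta>)))"

definition tau :: "nat set \<Rightarrow> rat \<Rightarrow> rat" where
  "tau Q \<delta> = \<delta> / (sigma_q Q \<delta>)^2"

definition kronecker :: "int \<Rightarrow> nat \<Rightarrow> int" where
  "kronecker a p = (if p = 2 then
       (if even a then 0 else if a mod 8 = 1 \<or> a mod 8 = 7 then 1 else -1)
     else Legendre a (int p))"

definition eps :: "nat set \<Rightarrow> rat \<Rightarrow> nat \<Rightarrow> int" where
  "eps Q \<delta> q = kronecker \<lfloor>tau Q \<delta>\<rfloor> q"

definition iota :: "rat \<Rightarrow> nat" where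
  "iota \<delta> = (if 0 < \<delta> then 0 else 1)"

end

(*
  Write delta = (sigma_q F)^2 D with F a positive integer prime to Q. Removing Euler factors gives
    L^S(s, delta) = L(s, psi) prod_{q in Q} (1 - psi(q) q^-s) P(s),
    P(s) = sum_{f | F} f^(1-2s) prod_{p | F/f} (1 - psi(p) p^-s),
  where psi is the quadratic character of D. Multiplied out, P(s) runs over factorisations F = f d f'
  with d squarefree, and exchanging f and f' gives P(s) = F^(1-2s) P(1-s). For L(s, psi) the Gauss sum
  of psi equals sqrt D (the sign included), so Poisson summation makes the theta series of psi
  self-dual with root number 1, and its Mellin transform is an entire function symmetric under
  s -> 1-s.
*)
theory Submission
  imports Defs "HOL-Complex_Analysis.Complex_Analysis" "HOL-Probability.Probability"
begin

section \<open>Legendre symbols\<close>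

text \<open>As \<open>\<delta>\<close> is not a square, D is not 1 and its character vanishes at 0.
  The theta series then has no constant term: it decays exponentially at infinity and, by its
  functional equation, also at 0. The Mellin integral thus converges for every s with nothing split
  off, and the continuation is entire. The functional equation contains no root number, so the Gauss
  sum is needed with its sign, not only its modulus. For an odd prime p it comes from Gauss's
  q-binomial identity. It is carried to D by splitting D into prime discriminants and one of 1, -4,
  8, -8; each new prime p brings the sign (sgn / p) of the part already treated, which is exactly
  the sign by which principal square roots fail to multiply. Since 2 lies in Q, every prime outside
  Q is odd. There the symbol is a Legendre symbol, and D is not divisible by the square of such a
  prime; this is why f runs over the divisors of F. Poisson summation rests on the uniqueness of
  Fourier coefficients of continuous functions, obtained from Stone-Weierstrass on the unit
  circle.\<close>

lemma Legendre_cases: "Legendre a p = -1 \<or> Legendre a p = 0 \<or> Legendre a p = 1"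
  by (auto simp: Legendre_def)

lemma Legendre_cong:
  assumes "[a = b] (mod p)"
  shows "Legendre a p = Legendre b p"
proof -
  have "[y = a] (mod p) \<longleftrightarrow> [y = b] (mod p)" "[a = y] (mod p) \<longleftrightarrow> [b = y] (mod p)" for y
    using assms by (simp_all add: cong_def)
  then show ?thesis unfolding Legendre_def QuadRes_def by simp
qed

lemma Legendre_eq_0_iff: "Legendre a p = 0 \<longleftrightarrow> p dvd a"
  by (auto simp: Legendre_def cong_0_iff)

text \<open>Euler's criterion yields only congruences modulo p. Two signs differ by at most 2, so
  for p > 2 such congruences become equalities of Legendre symbols.\<close>

lemma cong_sign_imp_eq:
  fixes a b :: int
  assumes "[a = b] (mod p)" "\<bar>a\<bar> \<le> 1" "\<bar>b\<bar> \<le> 1" "p > 2"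
  shows "a = b"
proof -
  have "p dvd a - b" using assms(1) by (simp add: cong_iff_dvd_diff)
  moreover have "\<bar>a - b\<bar> < p" using assms by linarith
  ultimately show ?thesis using zdvd_imp_le[of p "\<bar>a - b\<bar>"] by fastforce
qed

lemma Legendre_mult:
  fixes p :: nat
  assumes "prime p" "p > 2"
  shows "Legendre (a * b) p = Legendre a p * Legendre b p"
proof (rule cong_sign_imp_eq[of _ _ p])
  have "[Legendre (a * b) p = (a * b) ^ ((p - 1) div 2)] (mod p)"
    using euler_criterion assms by auto
  also have "(a * b) ^ ((p - 1) div 2) = a ^ ((p - 1) div 2) * b ^ ((p - 1) div 2)"
    by (simp add: power_mult_distrib)
  also have "[\<dots> = Legendre a p * Legendre b p] (mod p)"
    using euler_criterion[OF assms] by (intro cong_mult) (auto simp: cong_sym)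
  finally show "[Legendre (a * b) p = Legendre a p * Legendre b p] (mod p)" .
  show "\<bar>Legendre (a * b) p\<bar> \<le> 1" using Legendre_cases[of "a*b" p] by auto
  show "\<bar>Legendre a p * Legendre b p\<bar> \<le> 1"
    using Legendre_cases[of a p] Legendre_cases[of b p] by auto
qed (use assms in auto)

lemma Legendre_minus_one:
  fixes p :: nat
  assumes "prime p" "p > 2"
  shows "Legendre (-1) p = (-1) ^ ((p - 1) div 2)"
proof (rule cong_sign_imp_eq[of _ _ p])
  show "[Legendre (-1) p = (-1) ^ ((p - 1) div 2)] (mod p)"
    using euler_criterion assms by auto
qed (use assms Legendre_cases[of "-1" p] in auto)

lemma Legendre_square:
  assumes "\<not> p dvd a" "prime p"
  shows "Legendre (a^2) p = 1"
proof -
  have "\<not> p dvd a^2" using assms prime_dvd_power by blast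
  moreover have "QuadRes p (a^2)" unfolding QuadRes_def by (rule exI[of _ a]) simp
  ultimately show ?thesis by (simp add: Legendre_def cong_0_iff)
qed

lemma Legendre_1: "prime p \<Longrightarrow> Legendre 1 p = 1"
  using Legendre_square[of p 1] not_prime_unit by (auto simp del: not_prime_unit)

lemma odd_prime_half:
  assumes "prime (p::nat)" "p > 2"
  shows "odd p" "even (p - 1)" "2 * ((p - 1) div 2) = p - 1"
  using prime_odd_nat[of p] assms by auto

text \<open>Gauss's lemma for the multiplier 2. With h = (p - 1) / 2 the products 2x for 1 <= x <= h
  are already reduced modulo p, and 2x exceeds h exactly when x > h div 2; the parity of h - h div 2
  depends only on p modulo 8.\<close>

lemma Legendre_two:
  fixes p :: nat
  assumes "prime p" "p > 2"
  shows "Legendre 2 p = (if p mod 8 = 1 \<or> p mod 8 = 7 then 1 else -1)"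
proof -
  have odd: "odd p" using assms prime_odd_nat by blast
  interpret GAUSS p 2
    by unfold_locales (use assms in \<open>auto simp: cong_0_iff dest: zdvd_imp_le\<close>)
  define h where "h = (int p - 1) div 2"
  have p: "int p = 2 * h + 1" using odd unfolding h_def by presburger
  have C: "C = (\<lambda>x. x * 2) ` {0<..h}"
  proof -
    have "(\<lambda>x. x mod int p) ` (\<lambda>x. x * 2) ` {0<..h} = (\<lambda>x. x * 2) ` {0<..h}"
      unfolding image_image by (rule image_cong) (auto simp: p)
    then show ?thesis unfolding C_def B_def A_def h_def .
  qed
  have "E = (\<lambda>x. x * 2) ` {h div 2<..h}"
    unfolding E_def C h_def[symmetric] using p assms(2) by auto
  then have "card E = card {h div 2<..h}"
    by (simp add: card_image inj_on_def)
  then have cE: "card E = nat (h - h div 2)" by simp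
  have "p mod 8 = 1 \<or> p mod 8 = 3 \<or> p mod 8 = 5 \<or> p mod 8 = 7"
    using odd by presburger
  then have "even (card E) \<longleftrightarrow> p mod 8 = 1 \<or> p mod 8 = 7"
  proof -
    have "h \<ge> 0" using p assms by simp
    then have "even (card E) \<longleftrightarrow> even (h - h div 2)" 
      unfolding cE by (simp add: even_nat_iff)
    also have "\<dots> \<longleftrightarrow> int p mod 8 = 1 \<or> int p mod 8 = 7" unfolding p by presburger
    also have "\<dots> \<longleftrightarrow> int (p mod 8) = 1 \<or> int (p mod 8) = 7" by (simp add: of_nat_mod)
    also have "\<dots> \<longleftrightarrow> p mod 8 = 1 \<or> p mod 8 = 7" by linarith
    finally show ?thesis .
  qed
  then show ?thesis unfolding gauss_lemma minus_one_power_iff by simp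
qed

text \<open>For an odd prime p this is the one of p and -p that is 1 modulo 4, the fundamental
  discriminant in which only p ramifies. Every fundamental discriminant is a product of distinct
  ones of these with one of 1, -4, 8, -8.\<close>

definition prime_disc :: "nat \<Rightarrow> int" where
  "prime_disc p = (-1) ^ ((p - 1) div 2) * int p"

lemma prime_disc_mod4:
  assumes "prime p" "p > 2"
  shows "prime_disc p = (if p mod 4 = 1 then int p else - int p)" "prime_disc p mod 4 = 1"
proof -
  have "odd p" using assms prime_odd_nat by blast
  then have "even ((p - 1) div 2) \<longleftrightarrow> p mod 4 = 1" "p mod 4 = 1 \<or> p mod 4 = 3" by presburger+
  then show *: "prime_disc p = (if p mod 4 = 1 then int p else - int p)"
    unfolding prime_disc_def by auto
  show "prime_disc p mod 4 = 1" using * \<open>p mod 4 = 1 \<or> p mod 4 = 3\<close> by (simp split: if_splits) presburger+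
qed

text \<open>Quadratic reciprocity in unsymmetric form: the sign inside \<open>prime_disc p\<close>
  absorbs (-1)^(((p-1)/2)((l-1)/2)). For l = 2 it is the second supplement, read off from
  \<open>prime_disc p\<close> modulo 8, and for l = p both sides vanish.\<close>

lemma Legendre_prime_disc:
  assumes p: "prime p" "p > 2" and l: "prime l"
  shows "Legendre (int l) (int p) = kronecker (prime_disc p) l"
proof (cases "l = 2")
  case True
  have odd: "odd p" using assms prime_odd_nat by blast
  then have "p mod 8 = 1 \<or> p mod 8 = 3 \<or> p mod 8 = 5 \<or> p mod 8 = 7" by presburger
  moreover have odd': "odd (prime_disc p)" using odd by (simp add: prime_disc_def)
  moreover have m: "int p mod 8 = int (p mod 8)" by (simp add: of_nat_mod)
  have "prime_disc p mod 8 = 1" if "p mod 8 = 1 \<or> p mod 8 = 7"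
  proof -
    have "p mod 4 = (p mod 8) mod 4" by (simp add: mod_mod_cancel)
    then show ?thesis using that m prime_disc_mod4(1)[OF p] by (auto simp: zmod_zminus1_eq_if)
  qed
  moreover have "prime_disc p mod 8 = 5" if "p mod 8 = 3 \<or> p mod 8 = 5"
  proof -
    have "p mod 4 = (p mod 8) mod 4" by (simp add: mod_mod_cancel)
    then show ?thesis using that m prime_disc_mod4(1)[OF p] by (auto simp: zmod_zminus1_eq_if)
  qed
  ultimately show ?thesis using Legendre_two[OF p] True unfolding kronecker_def by auto
next
  case False
  then have l2: "l > 2" using l prime_ge_2_nat[of l] by linarith
  show ?thesis
  proof (cases "p = l")
    case True
    then show ?thesis using False by (simp add: kronecker_def prime_disc_def Legendre_def cong_0_iff)
  next
    case neq: False
    let ?m = "(p - 1) div 2" and ?n = "(l - 1) div 2"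
    have "kronecker (prime_disc p) l = Legendre ((-1) ^ ?m * int p) l"
      using False by (simp add: kronecker_def prime_disc_def)
    also have "\<dots> = Legendre ((-1) ^ ?m) l * Legendre p l"
      by (simp add: Legendre_mult l l2)
    also have "Legendre ((-1) ^ ?m) l = (-1) ^ (?m * ?n)"
      using Legendre_minus_one[OF l l2] Legendre_1[of "int l"] l
      by (cases "even ?m") (auto simp: minus_one_power_iff)
    also have "(-1) ^ (?m * ?n) = Legendre p l * Legendre l p"
      using Quadratic_Reciprocity[OF p l l2 neq] by simp
    also have "Legendre p l * Legendre l p * Legendre p l = (Legendre p l)^2 * Legendre l p"
      by (simp add: power2_eq_square)
    also have "(Legendre p l)^2 = 1"
    proof -
      have "\<not> int l dvd int p" using neq l p(1) primes_dvd_imp_eq by auto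
      then have "Legendre p l \<noteq> 0" by (simp add: Legendre_eq_0_iff)
      then show ?thesis using Legendre_cases[of p l] by auto
    qed
    finally show ?thesis by simp
  qed
qed

section \<open>Additive characters\<close>

definition add_char :: "int \<Rightarrow> int \<Rightarrow> complex" where
  "add_char N a = cis (2 * pi * of_int a / of_int N)"

lemma add_char_add: "add_char N (a + b) = add_char N a * add_char N b"
  by (simp add: add_char_def cis_mult add_divide_distrib ring_distribs)

lemma add_char_0 [simp]: "add_char N 0 = 1"
  by (simp add: add_char_def)

lemma add_char_power: "add_char N a ^ k = add_char N (int k * a)"
proof -
  have "real k * (2 * pi * of_int a / of_int N) = 2 * pi * of_int (int k * a) / of_int N"
    by simp
  then show ?thesis unfolding add_char_def Complex.DeMoivre by (rule arg_cong)
qed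

lemma add_char_minus: "add_char N (-a) = cnj (add_char N a)"
  by (simp add: add_char_def cis_cnj)

lemma add_char_nonzero [simp]: "add_char N a \<noteq> 0"
  by (simp add: add_char_def)

lemma add_char_eq_1_iff:
  assumes "N > 0"
  shows "add_char N a = 1 \<longleftrightarrow> N dvd a"
proof -
  have "add_char N a = 1 \<longleftrightarrow> (\<exists>k. 2 * pi * of_int a / of_int N = of_int k * 2 * pi)"
    unfolding add_char_def cis_conv_exp exp_eq_1 by (simp add: mult_ac)
  also have "\<dots> \<longleftrightarrow> (\<exists>k. a = k * N)"
  proof (rule ex_cong1)
    fix k
    have "2 * pi * of_int a / of_int N = of_int k * 2 * pi \<longleftrightarrow> real_of_int a = of_int (k * N)"
      using assms by (auto simp: field_simps)
    then show "2 * pi * of_int a / of_int N = of_int k * 2 * pi \<longleftrightarrow> a = k * N"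
      using of_int_eq_iff by metis
  qed
  finally show ?thesis by (auto simp: dvd_def mult_ac)
qed

lemma add_char_cong:
  assumes "N > 0" "[a = b] (mod N)"
  shows "add_char N a = add_char N b"
proof -
  have "add_char N (a - b) = 1"
    using assms by (simp add: add_char_eq_1_iff cong_iff_dvd_diff)
  then show ?thesis using add_char_add[of N "a - b" b] by simp
qed

lemma sum_int_lessThan: "(\<Sum>a\<in>{0..<int n}. f a) = (\<Sum>k<n. f (int k))"
  by (rule sum.reindex_bij_witness[of _ int nat]) auto

lemma sum_add_char:
  assumes "N > 0"
  shows "(\<Sum>a\<in>{0..<N}. add_char N (a * n)) = (if N dvd n then of_int N else 0)"
proof -
  obtain k where k: "N = int k" "k > 0" using assms by (metis zero_less_imp_eq_int)
  have "(\<Sum>a\<in>{0..<N}. add_char N (a * n)) = (\<Sum>i<k. add_char N n ^ i)"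
    unfolding k sum_int_lessThan add_char_power ..
  also have "\<dots> = (if N dvd n then of_int N else 0)"
  proof (cases "N dvd n")
    case True
    then have "add_char N n = 1" by (simp add: add_char_eq_1_iff assms)
    then show ?thesis using True k by simp
  next
    case False
    then have "add_char N n \<noteq> 1" by (simp add: add_char_eq_1_iff assms)
    moreover have "add_char N n ^ k = 1" by (simp add: add_char_power add_char_eq_1_iff assms k)
    ultimately show ?thesis using False by (simp add: sum_gp_strict)
  qed
  finally show ?thesis .
qed

lemma periodic_cong:
  fixes f :: "int \<Rightarrow> 'a"
  assumes per: "\<And>a. f (a + N) = f a" and "[a = b] (mod N)"
  shows "f a = f b"
proof -
  have nat: "f (a + int k * N) = f a" for a k
  proof (induction k)
    case (Suc k)
    have "f (a + int (Suc k) * N) = f ((a + int k * N) + N)" by (simp add: algebra_simps)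
    then show ?case using per Suc by simp
  qed simp
  have int: "f (a + k * N) = f a" for a k
  proof (cases "k \<ge> 0")
    case True
    then show ?thesis using nat[of a "nat k"] by simp
  next
    case False
    then show ?thesis using nat[of "a + k * N" "nat (-k)"] by (simp add: algebra_simps)
  qed
  obtain k where "b = a + N * k" using assms(2) cong_iff_lin by blast
  then show ?thesis using int[of a k] by (simp add: mult.commute)
qed

text \<open>An affine map with unit slope permutes the residues. It is used with slope 1 to complete
  the square and with shift 0 to scale a Gauss sum.\<close>

lemma sum_periodic_affine:
  fixes f :: "int \<Rightarrow> 'a::comm_monoid_add"
  assumes per: "\<And>a b. [a = b] (mod N) \<Longrightarrow> f a = f b" and N: "N > 0" and c: "coprime c N"
  shows "(\<Sum>a\<in>{0..<N}. f (c * a + b)) = (\<Sum>a\<in>{0..<N}. f a)"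
proof -
  let ?g = "\<lambda>a. (c * a + b) mod N"
  have inj: "inj_on ?g {0..<N}"
  proof (rule inj_onI)
    fix x y assume xy: "x \<in> {0..<N}" "y \<in> {0..<N}" "?g x = ?g y"
    then have "[c * x = c * y] (mod N)" by (simp add: cong_def[symmetric] cong_add_rcancel)
    then have "[x = y] (mod N)" using c by (simp add: cong_mult_lcancel)
    then show "x = y" using xy by (simp add: cong_def)
  qed
  have "?g ` {0..<N} = {0..<N}"
    by (rule endo_inj_surj) (use inj N in auto)
  then have bij: "bij_betw ?g {0..<N} {0..<N}" using inj by (simp add: bij_betw_def)
  have "(\<Sum>a\<in>{0..<N}. f (c * a + b)) = (\<Sum>a\<in>{0..<N}. f (?g a))"
    by (intro sum.cong refl per) (simp add: cong_def)
  also have "\<dots> = (\<Sum>a\<in>{0..<N}. f a)" by (rule sum.reindex_bij_betw[OF bij])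
  finally show ?thesis .
qed

section \<open>The sign of the quadratic Gauss sum\<close>

text \<open>Gauss's evaluation: at a primitive $p$-th root of unity the alternating sum of the
  $q$-binomial coefficients of $p - 1$ becomes the Gauss sum up to completing the square, while
  for every $q$ it factors as a product of terms $1 - q^k$ over odd $k$, whose signs can be counted.\<close>

fun qbinom :: "'a::comm_ring_1 \<Rightarrow> nat \<Rightarrow> nat \<Rightarrow> 'a" where
  "qbinom q n 0 = 1"
| "qbinom q 0 (Suc k) = 0"
| "qbinom q (Suc n) (Suc k) = qbinom q n k + q ^ Suc k * qbinom q n (Suc k)"

lemma qbinom_eq_0: "n < k \<Longrightarrow> qbinom q n k = 0"
  by (induction q n k rule: qbinom.induct) auto

text \<open>The q-analogue of (k+1) C(n+1, k+1) = (n+1) C(n, k). It is free of division, so it still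
  speaks when q is a root of unity: if q^(n+1) = 1 the right side is 0, which evaluates the
  coefficients there.\<close>

lemma qbinom_absorb:
  "(1 - q ^ Suc k) * qbinom q (Suc n) (Suc k) = (1 - q ^ Suc n) * qbinom q n k"
proof (induction n arbitrary: k)
  case 0
  show ?case by (cases k) auto
next
  case (Suc n)
  \<comment> \<open>Writes the second summand of Pascal's rule, after the induction hypothesis, in
    terms of \<open>qbinom q (Suc n) k\<close> alone; its q^(k+1) part then cancels against the
    first summand.\<close>
  have A: "q * (q ^ k * qbinom q (Suc n) k - q ^ Suc n * qbinom q (Suc n) k)
      = q ^ Suc k * ((1 - q ^ Suc n) * qbinom q n k)"
  proof (cases k)
    case (Suc j)
    have "q ^ k * qbinom q (Suc n) k = qbinom q (Suc n) k - (1 - q ^ Suc n) * qbinom q n j"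
      using Suc.IH[of j] Suc by (simp add: algebra_simps)
    then have "q ^ k * qbinom q (Suc n) k - q ^ Suc n * qbinom q (Suc n) k
        = (1 - q ^ Suc n) * (qbinom q (Suc n) k - qbinom q n j)"
      by (simp add: algebra_simps)
    also have "qbinom q (Suc n) k - qbinom q n j = q ^ k * qbinom q n k"
      using Suc by simp
    finally show ?thesis by (simp add: mult_ac)
  qed (simp add: algebra_simps)
  have "(1 - q ^ Suc k) * qbinom q (Suc (Suc n)) (Suc k)
      = (1 - q ^ Suc k) * qbinom q (Suc n) k + q ^ Suc k * ((1 - q ^ Suc k) * qbinom q (Suc n) (Suc k))"
    unfolding qbinom.simps(3)[of q "Suc n" k] by (simp only: ring_distribs mult_ac)
  also have "(1 - q ^ Suc k) * qbinom q (Suc n) (Suc k) = (1 - q ^ Suc n) * qbinom q n k"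
    by (rule Suc.IH)
  also note A[symmetric]
  finally show ?case by (simp add: algebra_simps)
qed

text \<open>After one use of Pascal's rule the two sums combine into terms with factor 1 - q^(j+1),
  and absorption turns each into 1 - q^(m+1) times a coefficient of m. The index drops by two, so
  starting from an even index only odd exponents are collected.\<close>

lemma alternating_sum_qbinom_rec:
  "(\<Sum>j\<le>Suc (Suc m). (-1) ^ j * qbinom q (Suc (Suc m)) j)
     = (1 - q ^ Suc m) * (\<Sum>j\<le>m. (-1) ^ j * qbinom q m j)"
proof -
  have "(\<Sum>j\<le>Suc (Suc m). (-1) ^ j * qbinom q (Suc (Suc m)) j)
      = 1 + (\<Sum>j\<le>Suc m. (-1) ^ Suc j * (qbinom q (Suc m) j + q ^ Suc j * qbinom q (Suc m) (Suc j)))"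
    by (subst sum.atMost_Suc_shift) simp
  also have "\<dots> = 1 - (\<Sum>j\<le>Suc m. (-1) ^ j * qbinom q (Suc m) j)
      + (\<Sum>j\<le>Suc m. (-1) ^ Suc j * q ^ Suc j * qbinom q (Suc m) (Suc j))"
    by (simp only: ring_distribs sum.distrib mult.assoc) (simp add: sum_negf)
  also have "(\<Sum>j\<le>Suc m. (-1) ^ Suc j * q ^ Suc j * qbinom q (Suc m) (Suc j))
      = (\<Sum>j\<le>m. (-1) ^ Suc j * q ^ Suc j * qbinom q (Suc m) (Suc j))"
    by (simp add: qbinom_eq_0 del: qbinom.simps)
  also have "(\<Sum>j\<le>Suc m. (-1) ^ j * qbinom q (Suc m) j)
      = 1 + (\<Sum>j\<le>m. (-1) ^ Suc j * qbinom q (Suc m) (Suc j))"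
    by (subst sum.atMost_Suc_shift) simp
  also have "1 - (1 + (\<Sum>j\<le>m. (-1) ^ Suc j * qbinom q (Suc m) (Suc j)))
      + (\<Sum>j\<le>m. (-1) ^ Suc j * q ^ Suc j * qbinom q (Suc m) (Suc j))
      = (\<Sum>j\<le>m. (-1) ^ j * ((1 - q ^ Suc j) * qbinom q (Suc m) (Suc j)))"
    by (simp add: sum_subtractf[symmetric] sum_negf algebra_simps del: qbinom.simps)
  also have "\<dots> = (1 - q ^ Suc m) * (\<Sum>j\<le>m. (-1) ^ j * qbinom q m j)"
    unfolding qbinom_absorb sum_distrib_left by (simp add: mult_ac)
  finally show ?thesis .
qed

lemma alternating_sum_qbinom:
  "(\<Sum>j\<le>2 * m. (-1) ^ j * qbinom q (2 * m) j) = (\<Prod>i<m. 1 - q ^ (2 * i + 1))"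
proof (induction m)
  case (Suc m)
  then show ?case using alternating_sum_qbinom_rec[where m = "2 * m" and q = q] by (simp add: mult.commute)
qed simp

text \<open>As p is odd, q = \<open>add_char p (-2)\<close> has exact order p, so absorption makes
  the coefficients of p vanish strictly between 0 and p. Pascal's rule then gives each coefficient
  of p - 1 as -q^(-(k+1)) times the previous one. The choice of -2 makes the accumulated exponent
  k(k+1), a square up to completion.\<close>

lemma qbinom_root_of_unity:
  fixes p :: nat
  assumes p: "odd p" and k: "k < p"
  shows "qbinom (add_char p (-2)) (p - 1) k = (-1) ^ k * add_char p (int k * (int k + 1))"
  using k
proof (induction k)
  case (Suc k)
  let ?q = "add_char p (-2)"
  have q: "?q ^ Suc k = add_char p (- 2 * int (Suc k))" by (simp only: add_char_power mult.commute)
  have "\<not> int p dvd - 2 * int (Suc k)"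
  proof
    assume "int p dvd - 2 * int (Suc k)"
    then have "p dvd 2 * Suc k" by (metis dvd_minus_iff int_dvd_int_iff minus_mult_left of_nat_mult of_nat_numeral)
    moreover have "coprime p 2" using p by simp
    ultimately have "p dvd Suc k" using coprime_dvd_mult_right_iff by blast
    then show False using Suc.prems by (auto dest: dvd_imp_le)
  qed
  then have "1 - ?q ^ Suc k \<noteq> 0" unfolding q using Suc.prems by (simp add: add_char_eq_1_iff)
  moreover have "?q ^ p = 1" using Suc.prems by (simp add: add_char_power add_char_eq_1_iff)
  moreover have "Suc (p - 1) = p" using Suc.prems by simp
  ultimately have "qbinom ?q (Suc (p - 1)) (Suc k) = 0"
    using qbinom_absorb[of ?q k "p - 1"] by simp
  then have "?q ^ Suc k * qbinom ?q (p - 1) (Suc k) = - qbinom ?q (p - 1) k"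
    by (simp add: eq_neg_iff_add_eq_0 add.commute)
  also have "\<dots> = (-1) ^ Suc k * add_char p (int k * (int k + 1))" using Suc by simp
  finally have *: "add_char p (2 * int (Suc k)) * (?q ^ Suc k * qbinom ?q (p - 1) (Suc k))
      = (-1) ^ Suc k * (add_char p (2 * int (Suc k)) * add_char p (int k * (int k + 1)))" by simp
  have "add_char p (2 * int (Suc k)) * (?q ^ Suc k * qbinom ?q (p - 1) (Suc k)) = qbinom ?q (p - 1) (Suc k)"
    unfolding q mult.assoc[symmetric] add_char_add[symmetric] by simp
  with * show ?case unfolding add_char_add[symmetric] by (simp add: algebra_simps)
qed simp

text \<open>Modulo p = 2m + 1 one has j(j+1) = (j+m+1)^2 - (m+1)^2, because 2(m+1) = p + 1. On the
  product side each factor 1 - q^(2i+1) is a phase times a sine; the phases have total exponent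
  -m^2, which agrees with -(m+1)^2 modulo p, so they cancel.\<close>

lemma gauss_sum_eq_prod_sin:
  fixes p m :: nat
  assumes p: "p = 2 * m + 1"
  shows "(\<Sum>a\<in>{0..<int p}. add_char p (a^2)) = (\<Prod>i<m. 2 * \<i> * of_real (sin (2 * pi * (2 * real i + 1) / p)))"
proof -
  let ?q = "add_char p (-2)"
  have pos: "int p > 0" using p by simp
  have sq: "int p = 2 * int m + 1" using p by simp
  have "(\<Sum>j\<in>{0..<int p}. add_char p (j * (j + 1))) = (\<Sum>j\<le>2 * m. add_char p (int j * (int j + 1)))"
    unfolding sum_int_lessThan by (rule sum.cong) (auto simp: p)
  also have "\<dots> = (\<Sum>j\<le>2 * m. (-1) ^ j * qbinom ?q (2 * m) j)"
    by (rule sum.cong) (use qbinom_root_of_unity[of p] in \<open>auto simp: p simp flip: power_add mult_2\<close>)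
  also have "\<dots> = (\<Prod>i<m. 1 - ?q ^ (2 * i + 1))" by (rule alternating_sum_qbinom)
  also have "\<dots> = (\<Prod>i<m. add_char p (- (2 * int i + 1)) * (2 * \<i> * of_real (sin (2 * pi * (2 * real i + 1) / p))))"
  proof (rule prod.cong)
    fix i
    have "1 - ?q ^ (2 * i + 1) = 1 - add_char p (- 2 * (2 * int i + 1))"
      unfolding add_char_power by (simp add: algebra_simps)
    also have "\<dots> = add_char p (- (2 * int i + 1)) * (add_char p (2 * int i + 1) - add_char p (- (2 * int i + 1)))"
      unfolding right_diff_distrib add_char_add[symmetric] by (simp add: algebra_simps)
    also have "add_char p (2 * int i + 1) - add_char p (- (2 * int i + 1)) = 2 * \<i> * of_real (sin (2 * pi * (2 * real i + 1) / p))"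
      unfolding add_char_minus by (simp add: add_char_def complex_eq_iff add.commute)
    finally show "1 - ?q ^ (2 * i + 1) = add_char p (- (2 * int i + 1)) * (2 * \<i> * of_real (sin (2 * pi * (2 * real i + 1) / p)))" .
  qed simp
  also have "\<dots> = add_char p (- (int m ^ 2)) * (\<Prod>i<m. 2 * \<i> * of_real (sin (2 * pi * (2 * real i + 1) / p)))"
  proof -
    have "(\<Prod>i<n. add_char p (- (2 * int i + 1))) = add_char p (- (int n ^ 2))" for n
    proof (induction n)
      case (Suc n)
      have "- (int (Suc n) ^ 2) = - (int n ^ 2) + - (2 * int n + 1)" by (simp add: power2_eq_square algebra_simps)
      then show ?case using Suc by (simp only: prod.lessThan_Suc add_char_add)
    qed simp
    then show ?thesis by (simp only: prod.distrib)
  qed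
  finally have 1: "(\<Sum>j\<in>{0..<int p}. add_char p (j * (j + 1))) = \<dots>" .
  have "(\<Sum>j\<in>{0..<int p}. add_char p (j * (j + 1)))
      = (\<Sum>j\<in>{0..<int p}. add_char p (- ((int m + 1)^2)) * add_char p ((1 * j + (int m + 1))^2))"
  proof (rule sum.cong)
    fix j
    have "j * (j + 1) - (- ((int m + 1)^2) + (1 * j + (int m + 1))^2) = - (int p * j)"
      by (simp add: sq power2_eq_square algebra_simps)
    then have "[j * (j + 1) = - ((int m + 1)^2) + (1 * j + (int m + 1))^2] (mod int p)"
      unfolding cong_iff_dvd_diff by simp
    then show "add_char p (j * (j + 1)) = add_char p (- ((int m + 1)^2)) * add_char p ((1 * j + (int m + 1))^2)"
      unfolding add_char_add[symmetric] using add_char_cong pos by blast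
  qed simp
  also have "\<dots> = add_char p (- ((int m + 1)^2)) * (\<Sum>j\<in>{0..<int p}. add_char p ((1 * j + (int m + 1))^2))"
    by (simp add: sum_distrib_left)
  also have "(\<Sum>j\<in>{0..<int p}. add_char p ((1 * j + (int m + 1))^2)) = (\<Sum>j\<in>{0..<int p}. add_char p (j^2))"
    by (rule sum_periodic_affine[of p "\<lambda>a. add_char p (a^2)"])
       (use pos in \<open>auto intro!: add_char_cong cong_pow\<close>)
  finally have "add_char p (- ((int m + 1)^2)) * (\<Sum>j\<in>{0..<int p}. add_char p (j^2))
      = add_char p (- (int m ^ 2)) * (\<Prod>i<m. 2 * \<i> * of_real (sin (2 * pi * (2 * real i + 1) / p)))"
    using 1 by simp
  moreover have "add_char p (- ((int m + 1)^2)) = add_char p (- (int m ^ 2))"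
  proof (rule add_char_cong)
    have "- ((int m + 1)^2) - - (int m ^ 2) = int p * (-1)" by (simp add: sq power2_eq_square algebra_simps)
    then show "[- ((int m + 1)^2) = - (int m ^ 2)] (mod int p)" unfolding cong_iff_dvd_diff by (metis dvd_triv_left)
  qed (use pos in auto)
  ultimately show ?thesis by simp
qed

lemma imaginary_unit_power: "\<i> ^ m = (-1) ^ (m div 2) * (if even m then 1 else \<i>)"
proof -
  have "\<i> ^ m = \<i> ^ (2 * (m div 2) + m mod 2)" by simp
  also have "\<dots> = (-1) ^ (m div 2) * \<i> ^ (m mod 2)" unfolding power_add power_mult by simp
  finally show ?thesis by (simp add: odd_iff_mod_2_eq_one even_iff_mod_2_eq_zero)
qed

text \<open>Only the signs of the sines matter here: exactly m div 2 of them are negative, and that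
  sign cancels the (-1)^(m div 2) contained in \<open>\<i> ^ m\<close>. The length of the sum is
  determined separately.\<close>

lemma gauss_sum_direction:
  fixes p m :: nat
  assumes p: "p = 2 * m + 1"
  shows "\<exists>c>0. (\<Sum>a\<in>{0..<int p}. add_char p (a^2)) = of_real c * (if even m then 1 else \<i>)"
proof -
  let ?s = "\<lambda>i::nat. sin (2 * pi * (2 * real i + 1) / p)"
  \<comment> \<open>The number of indices i with 4i + 2 < p. Their angles lie between 0 and pi, the
    remaining ones between pi and 2 pi.\<close>
  let ?k = "(m + 1) div 2"
  have p0: "real p > 0" using p by simp
  have pos: "?s i > 0" if "i < ?k" for i
  proof -
    have "4 * i + 2 < p" using that p by linarith
    then have "real (4 * i + 2) < real p" by (simp only: of_nat_less_iff)
    then have "2 * (2 * real i + 1) < p" by simp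
    then have "pi * (2 * (2 * real i + 1)) < pi * p" by (intro mult_strict_left_mono) auto
    then have "2 * pi * (2 * real i + 1) / p < pi" using p0 by (simp add: field_simps)
    moreover have "2 * pi * (2 * real i + 1) / p > 0" using p by (intro divide_pos_pos) auto
    ultimately show ?thesis by (intro sin_gt_zero)
  qed
  have neg: "- ?s i > 0" if "i \<in> {?k..<m}" for i
  proof -
    have i: "p < 4 * i + 2" "2 * i + 1 < p" using that p by auto
    have "sin (2 * pi * (2 * real i + 1) / p) < 0"
    proof -
      have "real p < real (4 * i + 2)" using i(1) by (simp only: of_nat_less_iff)
      then have "real p < 2 * (2 * real i + 1)" by simp
      then have "pi * p < pi * (2 * (2 * real i + 1))" by (intro mult_strict_left_mono) auto
      then have "pi < 2 * pi * (2 * real i + 1) / p" using p0 by (simp add: field_simps)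
      have "real (2 * i + 1) < real p" using i(2) by (simp only: of_nat_less_iff)
      then have "2 * real i + 1 < p" by simp
      then have "pi * (2 * real i + 1) < pi * p" by (intro mult_strict_left_mono) auto
      then have "2 * pi * (2 * real i + 1) / p < 2 * pi" using p0 by (simp add: field_simps)
      with \<open>pi < 2 * pi * (2 * real i + 1) / p\<close> show ?thesis by (intro sin_lt_zero)
    qed
    then show ?thesis by simp
  qed
  have "(\<Prod>i<m. ?s i) = (\<Prod>i<?k. ?s i) * (\<Prod>i=?k..<m. ?s i)"
  proof -
    have *: "{..<m} = {..<?k} \<union> {?k..<m}" by (cases m) auto
    show ?thesis by (subst *, rule prod.union_disjoint) auto
  qed
  also have "(\<Prod>i=?k..<m. ?s i) = (\<Prod>i=?k..<m. - (- ?s i))" by simp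
  also have "\<dots> = (-1) ^ (m - ?k) * (\<Prod>i=?k..<m. - ?s i)" by (subst prod_uminus) simp
  also have "m - ?k = m div 2" by presburger
  finally have P: "(\<Prod>i<m. ?s i) = (-1) ^ (m div 2) * ((\<Prod>i<?k. ?s i) * (\<Prod>i=?k..<m. - ?s i))" by simp
  have c: "(\<Prod>i<?k. ?s i) * (\<Prod>i=?k..<m. - ?s i) > 0"
    by (intro mult_pos_pos prod_pos) (use pos neg in auto)
  have "(\<Sum>a\<in>{0..<int p}. add_char p (a^2)) = (\<Prod>i<m. 2 * \<i> * of_real (?s i))"
    by (rule gauss_sum_eq_prod_sin[OF p])
  also have "\<dots> = 2 ^ m * \<i> ^ m * of_real (\<Prod>i<m. ?s i)"
    by (simp add: prod.distrib power_mult_distrib)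
  also have "\<dots> = of_real (2 ^ m * ((\<Prod>i<?k. ?s i) * (\<Prod>i=?k..<m. - ?s i))) * (if even m then 1 else \<i>)"
  proof -
    have "(-1::complex) ^ (m div 2) * (-1) ^ (m div 2) = 1"
      by (simp flip: power_mult_distrib)
    then show ?thesis unfolding P imaginary_unit_power of_real_mult by simp
  qed
  finally show ?thesis using c by (intro exI[of _ "2 ^ m * ((\<Prod>i<?k. ?s i) * (\<Prod>i=?k..<m. - ?s i))"]) auto
qed

section \<open>From sums over squares to Gauss sums of the Legendre symbol\<close>

lemma card_sqrt_mod:
  fixes p :: nat
  assumes p: "prime p" "p > 2" and a: "a \<in> {0..<int p}"
  shows "int (card {x \<in> {0..<int p}. x^2 mod int p = a}) = 1 + Legendre a p"
proof -
  have pp: "prime (int p)" using p by simp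
  have iff: "x^2 mod int p = a \<longleftrightarrow> [x^2 = a] (mod int p)" for x using a by (simp add: cong_def)
  consider (z) "a = 0" | (n) "a \<noteq> 0" "\<not> QuadRes p a" | (r) "a \<noteq> 0" "QuadRes p a" by blast
  then show ?thesis
  proof cases
    case z
    have "x = 0" if "x \<in> {0..<int p}" "int p dvd x^2" for x
    proof -
      have "int p dvd x" using that(2) prime_dvd_power[OF pp] by blast
      then show ?thesis using that(1) by (auto dest: zdvd_imp_le)
    qed
    then have "{x \<in> {0..<int p}. x^2 mod int p = a} = {0}" using p z by (auto simp: iff cong_0_iff)
    then show ?thesis using z by (simp add: Legendre_def)
  next
    case n
    then have "{x \<in> {0..<int p}. x^2 mod int p = a} = {}" unfolding iff by (auto simp: QuadRes_def)
    moreover have "Legendre a p = -1" using n a by (auto simp: Legendre_def cong_0_iff dest: zdvd_imp_le)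
    ultimately show ?thesis by (simp only: card.empty)
  next
    case r
    then obtain y where y: "[y^2 = a] (mod int p)" by (auto simp: QuadRes_def)
    define x where "x = y mod int p"
    have "[x^2 = y^2] (mod int p)" by (intro cong_pow) (simp add: x_def)
    then have x: "[x^2 = a] (mod int p)" using y cong_trans by blast
    have ndvd: "\<not> int p dvd a" using r a by (auto dest: zdvd_imp_le)
    have x0: "x \<noteq> 0" using x ndvd by (auto simp: cong_iff_dvd_diff)
    then have xr: "x \<in> {0<..<int p}" using p unfolding x_def
      by (metis greaterThanLessThan_iff linorder_not_less of_nat_0_less_iff order_le_less pos_mod_bound pos_mod_sign prime_gt_0_nat)
    have "z = x \<or> z = p - x" if "z \<in> {0..<int p}" "[z^2 = a] (mod int p)" for z
    proof -
      have "[z^2 = x^2] (mod int p)" using that(2) x by (simp add: cong_def)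
      then have "int p dvd (z - x) * (z + x)"
        by (simp add: cong_iff_dvd_diff power2_eq_square algebra_simps)
      then consider "int p dvd z - x" | "int p dvd z + x" using pp prime_dvd_multD by blast
      then show ?thesis
      proof cases
        case 1
        then have "[z = x] (mod int p)" by (simp add: cong_iff_dvd_diff)
        then show ?thesis using that(1) xr by (simp add: cong_def)
      next
        case 2
        then obtain k where k: "z + x = int p * k" by blast
        have "0 < int p * k" "int p * k < int p * 2" unfolding k[symmetric] using that(1) xr by auto
        then have "k = 1" by (simp add: zero_less_mult_iff)
        then show ?thesis using k by simp
      qed
    qed
    moreover have "[(p - x)^2 = a] (mod int p)"
    proof -
      have "(int p - x)^2 - a = (x^2 - a) + int p * (int p - 2 * x)"
        by (simp add: power2_eq_square algebra_simps)
      moreover have "int p dvd (x^2 - a) + int p * (int p - 2 * x)"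
        using x unfolding cong_iff_dvd_diff by (rule dvd_add) simp
      ultimately show ?thesis unfolding cong_iff_dvd_diff by (simp only:)
    qed
    ultimately have "{x \<in> {0..<int p}. x^2 mod int p = a} = {x, p - x}" using x xr unfolding iff by auto
    moreover have "x \<noteq> p - x"
    proof
      assume "x = p - x"
      then have "int p = 2 * x" by simp
      then have "even p" by presburger
      then show False using odd_prime_half(1)[OF p] by simp
    qed
    moreover have "Legendre a p = 1" using r ndvd by (simp add: Legendre_def cong_0_iff)
    ultimately show ?thesis by simp
  qed
qed

text \<open>Grouping x by a = x^2 mod p counts each residue a with multiplicity 1 + (a/p).\<close>

lemma sum_over_squares_mod:
  fixes p :: nat and f :: "int \<Rightarrow> complex"
  assumes p: "prime p" "p > 2" and per: "\<And>a b. [a = b] (mod int p) \<Longrightarrow> f a = f b"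
  shows "(\<Sum>x\<in>{0..<int p}. f (x^2)) = (\<Sum>a\<in>{0..<int p}. f a) + (\<Sum>a\<in>{0..<int p}. of_int (Legendre a p) * f a)"
proof -
  have "(\<Sum>x\<in>{0..<int p}. f (x^2)) = (\<Sum>x\<in>{0..<int p}. f (x^2 mod int p))"
    by (intro sum.cong refl per) (simp add: cong_def)
  also have "\<dots> = (\<Sum>a\<in>{0..<int p}. \<Sum>x\<in>{x\<in>{0..<int p}. x^2 mod int p = a}. f (x^2 mod int p))"
    by (rule sum.group[symmetric]) (use p in auto)
  also have "\<dots> = (\<Sum>a\<in>{0..<int p}. of_int (1 + Legendre a p) * f a)"
  proof (rule sum.cong)
    fix a assume a: "a \<in> {0..<int p}"
    have "(\<Sum>x\<in>{x\<in>{0..<int p}. x^2 mod int p = a}. f (x^2 mod int p)) = (\<Sum>x\<in>{x\<in>{0..<int p}. x^2 mod int p = a}. f a)"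
      by (rule sum.cong) auto
    also have "\<dots> = of_int (int (card {x\<in>{0..<int p}. x^2 mod int p = a})) * f a" by simp
    finally show "(\<Sum>x\<in>{x\<in>{0..<int p}. x^2 mod int p = a}. f (x^2 mod int p)) = of_int (1 + Legendre a p) * f a"
      unfolding card_sqrt_mod[OF p a] .
  qed simp
  also have "\<dots> = (\<Sum>a\<in>{0..<int p}. f a) + (\<Sum>a\<in>{0..<int p}. of_int (Legendre a p) * f a)"
    by (simp add: ring_distribs sum.distrib)
  finally show ?thesis .
qed

text \<open>The direction 1 or \<open>\<i>\<close> of the Gauss sum is that of the principal square
  root of the prime discriminant, so \<open>csqrt\<close> records the sign for all discriminants
  uniformly.\<close>

lemma csqrt_prime_disc:
  assumes "prime p" "p > 2"
  shows "csqrt (of_int (prime_disc p)) = of_real (sqrt p) * (if even ((p - 1) div 2) then 1 else \<i>)"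
  unfolding prime_disc_def
  using csqrt_of_real_nonneg[of "complex_of_real p"] csqrt_of_real_nonpos[of "complex_of_real (- real p)"] by simp

text \<open>The direction is known, so |G|^2 = p settles G. The dependence on n follows from scaling
  by n when p does not divide n, and from the vanishing of the sum of all symbols otherwise.\<close>

lemma gauss_sum_Legendre:
  fixes p :: nat
  assumes p: "prime p" "p > 2"
  shows "(\<Sum>a\<in>{0..<int p}. of_int (Legendre a p) * add_char p (a * n)) = of_int (Legendre n p) * csqrt (of_int (prime_disc p))"
proof -
  define G where "G = (\<Sum>a\<in>{0..<int p}. of_int (Legendre a p) * add_char p a)"
  let ?T = "\<lambda>n. \<Sum>a\<in>{0..<int p}. of_int (Legendre a p) * add_char p (a * n)"
  have p0: "int p > 0" and p1: "\<not> int p dvd 1" using p by auto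
  have T: "?T n = of_int (Legendre n p) * G" for n
  proof (cases "int p dvd n")
    case True
    \<comment> \<open>The constant function 1 turns the counting of squares into the statement that
      the Legendre symbols sum to 0.\<close>
    have "(\<Sum>x\<in>{0..<int p}. (1::complex)) = (\<Sum>a\<in>{0..<int p}. 1) + (\<Sum>a\<in>{0..<int p}. of_int (Legendre a p) * 1)"
      by (rule sum_over_squares_mod[OF p, of "\<lambda>_. 1"]) simp
    then have "(\<Sum>a\<in>{0..<int p}. complex_of_int (Legendre a p)) = 0" by simp
    moreover have "add_char p (a * n) = 1" for a using True p0 by (simp add: add_char_eq_1_iff)
    moreover have "Legendre n p = 0" using True by (simp add: Legendre_eq_0_iff)
    ultimately show ?thesis by simp
  next
    case False
    then have cop: "coprime n (int p)" using p by (metis coprime_commute prime_imp_coprime prime_int_nat_transfer nat_int of_nat_0_le_iff)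
    have n2: "(Legendre n p)^2 = 1" using False Legendre_eq_0_iff[of n p] Legendre_cases[of n p] by auto
    have "G = (\<Sum>a\<in>{0..<int p}. of_int (Legendre (n * a + 0) p) * add_char p (n * a + 0))"
      unfolding G_def by (rule sum_periodic_affine[symmetric, OF _ p0 cop])
        (use p0 in \<open>auto intro!: arg_cong2[where f = "(*)"] add_char_cong dest: Legendre_cong\<close>)
    also have "\<dots> = of_int (Legendre n p) * ?T n"
      using Legendre_mult[OF p] by (simp add: sum_distrib_left mult_ac)
    finally have "of_int (Legendre n p) * G = of_int ((Legendre n p)^2) * ?T n" by (simp add: power2_eq_square)
    then show ?thesis unfolding n2 by simp
  qed
  \<comment> \<open>The symbol (a/p) times G is put back into the form of a twisted sum over b;
    summing over a first, orthogonality leaves only b = 1.\<close>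
  have "cnj G * G = (\<Sum>a\<in>{0..<int p}. add_char p (-a) * (of_int (Legendre a p) * G))"
    unfolding G_def cnj_sum sum_distrib_right add_char_minus by (simp add: mult_ac)
  also have "\<dots> = (\<Sum>a\<in>{0..<int p}. add_char p (-a) * ?T a)" by (simp only: T)
  also have "\<dots> = (\<Sum>b\<in>{0..<int p}. of_int (Legendre b p) * (\<Sum>a\<in>{0..<int p}. add_char p (a * (b - 1))))"
    unfolding sum_distrib_left by (subst sum.swap) (simp add: mult_ac add_char_add[symmetric] algebra_simps)
  also have "\<dots> = (\<Sum>b\<in>{0..<int p}. if b = 1 then of_int p else 0)"
  proof (rule sum.cong)
    fix b assume b: "b \<in> {0..<int p}"
    have "int p dvd b - 1 \<longleftrightarrow> b = 1"
    proof
      assume "int p dvd b - 1"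
      then have "[b = 1] (mod int p)" by (simp add: cong_iff_dvd_diff)
      then show "b = 1" using b p by (simp add: cong_def)
    qed simp
    then show "of_int (Legendre b p) * (\<Sum>a\<in>{0..<int p}. add_char p (a * (b - 1))) = (if b = 1 then of_int p else 0)"
      unfolding sum_add_char[OF p0] using Legendre_1[of "int p"] p by simp
  qed simp
  also have "\<dots> = of_nat p" using p by simp
  finally have norm: "cnj G * G = of_nat p" .
  \<comment> \<open>The unweighted part is a full sum of a nontrivial character and vanishes, so
    Gauss's quadratic exponential sum and the sum of Legendre symbols coincide.\<close>
  have "(\<Sum>a\<in>{0..<int p}. add_char p (a^2)) = (\<Sum>a\<in>{0..<int p}. add_char p a) + G"
    unfolding G_def by (rule sum_over_squares_mod[OF p]) (use p0 add_char_cong in blast)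
  also have "(\<Sum>a\<in>{0..<int p}. add_char p a) = 0" using sum_add_char[OF p0, of 1] p1 by simp
  finally have G: "(\<Sum>a\<in>{0..<int p}. add_char p (a^2)) = G" by simp
  define m where "m = (p - 1) div 2"
  have pm: "p = 2 * m + 1" using odd_prime_half[OF p] p by (simp add: m_def)
  obtain c where c: "c > 0" "G = of_real c * (if even m then 1 else \<i>)"
    using gauss_sum_direction[OF pm] G by auto
  have "cnj (if even m then 1 else \<i>) * (if even m then 1 else \<i>) = 1" by simp
  then have "cnj G * G = of_real c * of_real c" unfolding c(2) by (simp add: mult_ac)
  then have "complex_of_real (c^2) = of_real (real p)" using norm by (simp add: power2_eq_square)
  then have "c^2 = real p" by (simp only: of_real_eq_iff)
  then have "c = sqrt p" using c by (simp add: real_sqrt_unique)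
  then have "G = csqrt (of_int (prime_disc p))" using c(2) csqrt_prime_disc[OF p] by (simp add: m_def)
  then show ?thesis using T by simp
qed

section \<open>The quadratic character of a discriminant\<close>

definition disc_char :: "int \<Rightarrow> (int \<Rightarrow> int) \<Rightarrow> bool" where
  "disc_char D \<psi> \<longleftrightarrow> D \<noteq> 0 \<and> \<psi> 1 = 1 \<and> (\<forall>a b. \<psi> (a * b) = \<psi> a * \<psi> b) \<and>
     (\<forall>a. \<psi> (a + \<bar>D\<bar>) = \<psi> a) \<and>
     (\<forall>n. (\<Sum>a\<in>{0..<\<bar>D\<bar>}. of_int (\<psi> a) * add_char \<bar>D\<bar> (a * n)) = of_int (\<psi> n) * csqrt (of_int D)) \<and>
     (\<forall>l. prime l \<longrightarrow> \<psi> (int l) = kronecker D l)"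

lemma disc_charD:
  assumes "disc_char D \<psi>"
  shows "D \<noteq> 0" "\<psi> 1 = 1" "\<psi> (a * b) = \<psi> a * \<psi> b" "\<psi> (a + \<bar>D\<bar>) = \<psi> a"
    "(\<Sum>a\<in>{0..<\<bar>D\<bar>}. of_int (\<psi> a) * add_char \<bar>D\<bar> (a * n)) = of_int (\<psi> n) * csqrt (of_int D)"
    "prime l \<Longrightarrow> \<psi> (int l) = kronecker D l"
  using assms unfolding disc_char_def by auto

lemma disc_char_cong:
  assumes "disc_char D \<psi>" "[a = b] (mod \<bar>D\<bar>)"
  shows "\<psi> a = \<psi> b"
  by (rule periodic_cong[where f = \<psi> and N = "\<bar>D\<bar>"]) (use disc_charD(4)[OF assms(1)] assms(2) in auto)

lemma kronecker_mult:
  assumes l: "prime l" and D: "even D1 \<or> even D2 \<or> D1 mod 4 = 1 \<or> D2 mod 4 = 1"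
  shows "kronecker (D1 * D2) l = kronecker D1 l * kronecker D2 l"
proof (cases "l = 2")
  case True
  show ?thesis
  proof (cases "even D1 \<or> even D2")
    case True
    then show ?thesis using \<open>l = 2\<close> by (auto simp: kronecker_def)
  next
    case False
    have "D1 mod 8 = 1 \<or> D1 mod 8 = 3 \<or> D1 mod 8 = 5 \<or> D1 mod 8 = 7" using False by presburger
    moreover have "D2 mod 8 = 1 \<or> D2 mod 8 = 3 \<or> D2 mod 8 = 5 \<or> D2 mod 8 = 7" using False by presburger
    moreover have "D1 * D2 mod 8 = ((D1 mod 8) * (D2 mod 8)) mod 8" by (simp add: mod_mult_eq)
    ultimately show ?thesis using \<open>l = 2\<close> False unfolding kronecker_def
      by (elim disjE) (simp_all only: even_mult_iff, simp_all)
  qed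
next
  case False
  then have "l > 2" using l prime_ge_2_nat[of l] by linarith
  then show ?thesis using Legendre_mult[OF l] False by (simp add: kronecker_def)
qed

text \<open>Residues are parametrised as aN + bM, not by idempotents, because then the additive
  character of modulus MN splits directly into those of moduli M and N.\<close>

lemma sum_crt:
  fixes f :: "int \<Rightarrow> 'a::comm_monoid_add"
  assumes M: "M > 0" and N: "N > 0" and cop: "coprime M N"
    and per: "\<And>a b. [a = b] (mod (M * N)) \<Longrightarrow> f a = f b"
  shows "(\<Sum>c\<in>{0..<M * N}. f c) = (\<Sum>a\<in>{0..<M}. \<Sum>b\<in>{0..<N}. f (a * N + b * M))"
proof -
  let ?g = "\<lambda>(a, b). (a * N + b * M) mod (M * N)"
  have inj: "inj_on ?g ({0..<M} \<times> {0..<N})"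
  proof (rule inj_onI, clarify)
    fix a b a' b' assume *: "a \<in> {0..<M}" "a' \<in> {0..<M}" "b \<in> {0..<N}" "b' \<in> {0..<N}"
      "(a * N + b * M) mod (M * N) = (a' * N + b' * M) mod (M * N)"
    then have "M * N dvd (a * N + b * M) - (a' * N + b' * M)" by (simp add: mod_eq_dvd_iff)
    then obtain k where "(a * N + b * M) - (a' * N + b' * M) = M * N * k" by (elim dvdE)
    then have k: "(a - a') * N + (b - b') * M = M * N * k" by (simp add: algebra_simps)
    then have "(a - a') * N = M * (N * k - (b - b'))" "(b - b') * M = N * (M * k - (a - a'))"
      by (auto simp: algebra_simps)
    then have "M dvd (a - a') * N" "N dvd (b - b') * M" by simp_all
    then have "M dvd a - a'" "N dvd b - b'"
      using cop by (auto simp: coprime_dvd_mult_left_iff coprime_commute)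
    then have "[a = a'] (mod M)" "[b = b'] (mod N)" by (simp_all add: cong_iff_dvd_diff)
    then show "a = a' \<and> b = b'" using * by (simp add: cong_def)
  qed
  have "?g ` ({0..<M} \<times> {0..<N}) = {0..<M * N}"
  proof (rule card_subset_eq)
    show "?g ` ({0..<M} \<times> {0..<N}) \<subseteq> {0..<M * N}" using M N by auto
    show "card (?g ` ({0..<M} \<times> {0..<N})) = card {0..<M * N}"
      using M N by (subst card_image[OF inj]) (simp add: card_cartesian_product nat_mult_distrib)
  qed simp
  then have bij: "bij_betw ?g ({0..<M} \<times> {0..<N}) {0..<M * N}" using inj by (simp add: bij_betw_def)
  have "(\<Sum>c\<in>{0..<M * N}. f c) = (\<Sum>x\<in>{0..<M} \<times> {0..<N}. f (?g x))"
    by (rule sum.reindex_bij_betw[OF bij, symmetric])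
  also have "\<dots> = (\<Sum>(a, b)\<in>{0..<M} \<times> {0..<N}. f (a * N + b * M))"
    by (intro sum.cong refl) (auto intro!: per simp: cong_def)
  also have "\<dots> = (\<Sum>a\<in>{0..<M}. \<Sum>b\<in>{0..<N}. f (a * N + b * M))"
    by (rule sum.cartesian_product[symmetric])
  finally show ?thesis .
qed

lemma add_char_mult_cancel:
  assumes "c \<noteq> 0"
  shows "add_char (N * c) (a * c) = add_char N a"
  unfolding add_char_def by (rule arg_cong[where f = cis]) (use assms in simp)

text \<open>Two negative numbers have roots on the positive imaginary axis, whose product is
  negative. This sign is the one to be matched when Gauss sums of two discriminants are
  multiplied.\<close>

lemma csqrt_mult_real:
  fixes x y :: real
  assumes "x \<noteq> 0" "y \<noteq> 0"
  shows "csqrt x * csqrt y = (if x < 0 \<and> y < 0 then -1 else 1) * csqrt (of_real (x * y))"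
proof -
  have s: "csqrt (of_real z) = of_real (sqrt \<bar>z\<bar>) * (if z < 0 then \<i> else 1)" for z
    using csqrt_of_real_nonneg[of "of_real z"] csqrt_of_real_nonpos[of "of_real z"] by auto
  show ?thesis using assms unfolding s 
    by (auto simp: abs_mult real_sqrt_mult mult_less_0_iff)
qed

lemma prime_disc_sign: "prime_disc p < 0 \<longleftrightarrow> p > 0 \<and> odd ((p - 1) div 2)"
  by (auto simp: prime_disc_def minus_one_power_iff)

text \<open>The sign in the product formula is $\psi(p) (|D|/p) = (D|D|/p) = (\mathrm{sgn} D/p)$; quadratic
  reciprocity itself enters only through the character of the prime discriminant.\<close>

lemma disc_char_mult_prime:
  assumes \<psi>: "disc_char D \<psi>" and p: "prime p" "p > 2" and ndvd: "\<not> int p dvd D"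
  shows "disc_char (D * prime_disc p) (\<lambda>a. \<psi> a * Legendre a p)"
  unfolding disc_char_def
proof (intro conjI allI impI)
  have abs: "\<bar>D * prime_disc p\<bar> = \<bar>D\<bar> * int p"
    by (simp add: abs_mult prime_disc_def power_abs)
  have p0: "int p > 0" "int p \<noteq> 0" using p by auto
  have D0: "D \<noteq> 0" "\<bar>D\<bar> > 0" using disc_charD[OF \<psi>] by auto
  have cop: "coprime \<bar>D\<bar> (int p)"
    using ndvd p by (metis coprime_abs_left_iff coprime_commute prime_imp_coprime prime_nat_int_transfer)
  have pd0: "prime_disc p \<noteq> 0" using p by (simp add: prime_disc_def)
  show "D * prime_disc p \<noteq> 0" using D0 pd0 by simp
  show "\<psi> 1 * Legendre 1 p = 1" using disc_charD[OF \<psi>] Legendre_1 p by simp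
  show "\<psi> (a * b) * Legendre (a * b) p = \<psi> a * Legendre a p * (\<psi> b * Legendre b p)" for a b
    using disc_charD(3)[OF \<psi>] Legendre_mult[OF p] by simp
  have per: "\<psi> a * Legendre a p = \<psi> b * Legendre b p" if "[a = b] (mod (\<bar>D\<bar> * int p))" for a b
  proof -
    have "[a = b] (mod \<bar>D\<bar>)" "[a = b] (mod int p)" using that cong_dvd_modulus dvd_triv_left dvd_triv_right by blast+
    then show ?thesis using disc_char_cong[OF \<psi>] Legendre_cong by metis
  qed
  show "\<psi> (a + \<bar>D * prime_disc p\<bar>) * Legendre (a + \<bar>D * prime_disc p\<bar>) p = \<psi> a * Legendre a p" for a
    by (rule per) (simp add: abs cong_def)
  show "\<psi> (int l) * Legendre (int l) p = kronecker (D * prime_disc p) l" if l: "prime l" for l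
    using kronecker_mult[OF l, of D "prime_disc p"] prime_disc_mod4[OF p] disc_charD(6)[OF \<psi> l] Legendre_prime_disc[OF p l]
    by simp
  have recip: "\<psi> (int p) * Legendre \<bar>D\<bar> p = (if D < 0 \<and> prime_disc p < 0 then -1 else 1)"
  proof -
    have "\<psi> (int p) * Legendre \<bar>D\<bar> p = Legendre (D * \<bar>D\<bar>) p"
      using disc_charD(6)[OF \<psi> p(1)] p Legendre_mult[OF p] by (simp add: kronecker_def)
    also have "D * \<bar>D\<bar> = sgn D * D^2" using D0 by (cases "D < 0") (simp_all add: power2_eq_square)
    also have "Legendre (sgn D * D^2) p = Legendre (sgn D) p"
      using Legendre_square[OF ndvd] p by (simp add: Legendre_mult[OF p])
    also have "\<dots> = (if D < 0 \<and> prime_disc p < 0 then -1 else 1)"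
      using D0 p Legendre_1[of "int p"] Legendre_minus_one[OF p]
      by (auto simp: sgn_if prime_disc_sign minus_one_power_iff)
    finally show ?thesis .
  qed
  fix n
  let ?D = "D * prime_disc p"
  have "(\<Sum>a\<in>{0..<\<bar>?D\<bar>}. of_int (\<psi> a * Legendre a p) * add_char \<bar>?D\<bar> (a * n))
      = (\<Sum>a\<in>{0..<\<bar>D\<bar>}. \<Sum>b\<in>{0..<int p}. of_int (\<psi> (a * int p + b * \<bar>D\<bar>) * Legendre (a * int p + b * \<bar>D\<bar>) p) * add_char (\<bar>D\<bar> * int p) ((a * int p + b * \<bar>D\<bar>) * n))"
    unfolding abs
  proof (rule sum_crt[OF D0(2) p0(1) cop])
    fix a b assume ab: "[a = b] (mod \<bar>D\<bar> * int p)"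
    have "[a * n = b * n] (mod \<bar>D\<bar> * int p)" using ab by (rule cong_scalar_right)
    then have "add_char (\<bar>D\<bar> * int p) (a * n) = add_char (\<bar>D\<bar> * int p) (b * n)"
      using D0 p0 by (intro add_char_cong) auto
    then show "of_int (\<psi> a * Legendre a p) * add_char (\<bar>D\<bar> * int p) (a * n) = of_int (\<psi> b * Legendre b p) * add_char (\<bar>D\<bar> * int p) (b * n)"
      using per[OF ab] by simp
  qed
  also have "\<dots> = (\<Sum>a\<in>{0..<\<bar>D\<bar>}. \<Sum>b\<in>{0..<int p}. of_int (\<psi> (int p) * Legendre \<bar>D\<bar> p) *
      ((of_int (\<psi> a) * add_char \<bar>D\<bar> (a * n)) * (of_int (Legendre b p) * add_char p (b * n))))"
  proof (intro sum.cong refl)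
    fix a b
    have 1: "\<psi> (a * int p + b * \<bar>D\<bar>) = \<psi> a * \<psi> (int p)"
      using disc_char_cong[OF \<psi>, of "a * int p + b * \<bar>D\<bar>" "a * int p"] disc_charD(3)[OF \<psi>] by (simp add: cong_def)
    have 2: "Legendre (a * int p + b * \<bar>D\<bar>) p = Legendre b p * Legendre \<bar>D\<bar> p"
      using Legendre_cong[of "a * int p + b * \<bar>D\<bar>" "b * \<bar>D\<bar>" p] Legendre_mult[OF p] by (simp add: cong_def)
    have "(a * int p + b * \<bar>D\<bar>) * n = (a * n) * int p + (b * n) * \<bar>D\<bar>" by (simp add: algebra_simps)
    then have 3: "add_char (\<bar>D\<bar> * int p) ((a * int p + b * \<bar>D\<bar>) * n) = add_char \<bar>D\<bar> (a * n) * add_char p (b * n)"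
      using add_char_mult_cancel[OF p0(2), of "\<bar>D\<bar>" "a * n"] add_char_mult_cancel[of "\<bar>D\<bar>" "int p" "b * n"] D0
      by (simp only: add_char_add) (simp add: mult.commute)
    show "of_int (\<psi> (a * int p + b * \<bar>D\<bar>) * Legendre (a * int p + b * \<bar>D\<bar>) p) * add_char (\<bar>D\<bar> * int p) ((a * int p + b * \<bar>D\<bar>) * n)
      = of_int (\<psi> (int p) * Legendre \<bar>D\<bar> p) * ((of_int (\<psi> a) * add_char \<bar>D\<bar> (a * n)) * (of_int (Legendre b p) * add_char p (b * n)))"
      unfolding 1 2 3 by simp
  qed
  also have "\<dots> = of_int (\<psi> (int p) * Legendre \<bar>D\<bar> p) * ((\<Sum>a\<in>{0..<\<bar>D\<bar>}. of_int (\<psi> a) * add_char \<bar>D\<bar> (a * n)) * (\<Sum>b\<in>{0..<int p}. of_int (Legendre b p) * add_char p (b * n)))"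
    unfolding sum_product by (simp only: sum_distrib_left)
  also have "\<dots> = of_int (\<psi> (int p) * Legendre \<bar>D\<bar> p) * (csqrt (of_int D) * csqrt (of_int (prime_disc p))) * of_int (\<psi> n * Legendre n p)"
    unfolding disc_charD(5)[OF \<psi>] gauss_sum_Legendre[OF p] by simp
  \<comment> \<open>The same sign as in \<open>recip\<close>, so the two multiply to 1.\<close>
  also have "csqrt (of_int D) * csqrt (of_int (prime_disc p)) = of_int (if D < 0 \<and> prime_disc p < 0 then -1 else 1) * csqrt (of_int ?D)"
    using csqrt_mult_real[of "of_int D" "of_int (prime_disc p)"] D0 pd0 by simp
  finally show "(\<Sum>a\<in>{0..<\<bar>?D\<bar>}. of_int (\<psi> a * Legendre a p) * add_char \<bar>?D\<bar> (a * n)) = of_int (\<psi> n * Legendre n p) * csqrt (of_int ?D)"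
    unfolding recip by simp
qed

section \<open>The discriminants 1, -4, 8 and -8\<close>

lemma atLeastLessThan_int_4_8: "{0..<4::int} = {0, 1, 2, 3}" "{0..<8::int} = {0, 1, 2, 3, 4, 5, 6, 7}"
  by auto

text \<open>Reduces multiplicativity and the Gauss sums to finite tables over residues, which can be
  evaluated with the explicit fourth and eighth roots of unity.\<close>

lemma disc_charI_mod8:
  fixes f :: "int \<Rightarrow> int"
  assumes D: "\<bar>D\<bar> = N" "N = 4 \<or> N = 8"
    and f1: "f 1 = 1"
    and mult: "\<forall>r\<in>{0..<N}. \<forall>s\<in>{0..<N}. f ((r * s) mod N) = f r * f s"
    and gauss: "\<forall>r\<in>{0..<N}. (\<Sum>a\<in>{0..<N}. of_int (f a) * add_char N (a * r mod N)) = of_int (f r) * csqrt (of_int D)"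
    and kr: "\<And>l. prime l \<Longrightarrow> f (int l mod N) = kronecker D l"
  shows "disc_char D (\<lambda>a. f (a mod N))"
  unfolding disc_char_def
proof (intro conjI allI impI)
  have N: "N > 0" using D by auto
  show "D \<noteq> 0" "f (1 mod N) = 1" using D f1 by auto
  show "f (a * b mod N) = f (a mod N) * f (b mod N)" for a b
    using bspec[OF bspec[OF mult, of "a mod N"], of "b mod N"] N by (simp add: mod_mult_eq)
  show "f ((a + \<bar>D\<bar>) mod N) = f (a mod N)" for a using D by simp
  show "f (int l mod N) = kronecker D l" if "prime l" for l using kr that .
  fix n
  have "(\<Sum>a\<in>{0..<\<bar>D\<bar>}. of_int (f (a mod N)) * add_char \<bar>D\<bar> (a * n))
      = (\<Sum>a\<in>{0..<N}. of_int (f a) * add_char N (a * (n mod N) mod N))"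
    unfolding D(1)
  proof (intro sum.cong refl)
    fix a assume "a \<in> {0..<N}"
    moreover have "add_char N (a * n) = add_char N (a * (n mod N) mod N)"
      by (rule add_char_cong) (use N in \<open>auto simp: cong_def mod_mult_right_eq\<close>)
    ultimately show "of_int (f (a mod N)) * add_char N (a * n) = of_int (f a) * add_char N (a * (n mod N) mod N)"
      by simp
  qed
  also have "\<dots> = of_int (f (n mod N)) * csqrt (of_int D)" by (rule bspec[OF gauss]) (use N in auto)
  finally show "(\<Sum>a\<in>{0..<\<bar>D\<bar>}. of_int (f (a mod N)) * add_char \<bar>D\<bar> (a * n)) = of_int (f (n mod N)) * csqrt (of_int D)" .
qed

lemma add_char_4: "add_char 4 1 = \<i>" "add_char 4 2 = -1" "add_char 4 3 = -\<i>"
proof -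
  show 1: "add_char 4 1 = \<i>" by (simp add: add_char_def complex_eq_iff)
  show 2: "add_char 4 2 = -1" using add_char_add[of 4 1 1] 1 by simp
  show "add_char 4 3 = -\<i>" using add_char_add[of 4 2 1] 1 2 by simp
qed

lemma add_char_8:
  "add_char 8 1 = Complex (sqrt 2 / 2) (sqrt 2 / 2)" "add_char 8 2 = \<i>"
  "add_char 8 3 = Complex (- sqrt 2 / 2) (sqrt 2 / 2)" "add_char 8 4 = -1"
  "add_char 8 5 = Complex (- sqrt 2 / 2) (- sqrt 2 / 2)" "add_char 8 6 = -\<i>"
  "add_char 8 7 = Complex (sqrt 2 / 2) (- sqrt 2 / 2)"
proof -
  show 1: "add_char 8 1 = Complex (sqrt 2 / 2) (sqrt 2 / 2)"
    by (simp add: add_char_def complex_eq_iff cos_45 sin_45)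
  show 2: "add_char 8 2 = \<i>" by (simp add: add_char_def complex_eq_iff)
  have 3: "add_char 8 3 = \<i> * Complex (sqrt 2 / 2) (sqrt 2 / 2)"
    using add_char_add[of 8 2 1] 1 2 by simp
  then show "add_char 8 3 = Complex (- sqrt 2 / 2) (sqrt 2 / 2)" by (simp add: complex_eq_iff)
  show 4: "add_char 8 4 = -1" using add_char_add[of 8 2 2] 2 by simp
  show "add_char 8 5 = Complex (- sqrt 2 / 2) (- sqrt 2 / 2)"
    using add_char_add[of 8 4 1] 4 1 by (simp add: complex_eq_iff)
  show "add_char 8 6 = -\<i>" using add_char_add[of 8 4 2] 4 2 by simp
  show "add_char 8 7 = Complex (sqrt 2 / 2) (- sqrt 2 / 2)"
    using add_char_add[of 8 4 3] 4 3 by (simp add: complex_eq_iff)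
qed

lemma disc_char_1: "disc_char 1 (\<lambda>_. 1)"
proof -
  have "kronecker 1 l = 1" if "prime l" for l
    using Legendre_1[of "int l"] that by (simp add: kronecker_def)
  moreover have "{0..<1::int} = {0}" by auto
  ultimately show ?thesis by (simp add: disc_char_def)
qed

lemma even_half_pred_iff: "odd (l::nat) \<Longrightarrow> even ((l - 1) div 2) \<longleftrightarrow> l mod 4 = 1"
  by presburger

lemma kronecker_mod8:
  assumes l: "prime l"
  shows "kronecker (-4) l = (if l = 2 then 0 else if l mod 4 = 1 then 1 else -1)"
    and "kronecker 8 l = (if l = 2 then 0 else if l mod 8 = 1 \<or> l mod 8 = 7 then 1 else -1)"
    and "kronecker (-8) l = (if l = 2 then 0 else if l mod 8 = 1 \<or> l mod 8 = 3 then 1 else -1)"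
proof -
  have *: "kronecker (-4) l = (if l mod 4 = 1 then 1 else -1) \<and>
    kronecker 8 l = (if l mod 8 = 1 \<or> l mod 8 = 7 then 1 else -1) \<and>
    kronecker (-8) l = (if l mod 8 = 1 \<or> l mod 8 = 3 then 1 else -1)" if "l \<noteq> 2"
  proof -
    have l2: "l > 2" using l that prime_ge_2_nat[of l] by linarith
    note M = Legendre_mult[OF l l2]
    have odd: "odd l" using odd_prime_half[OF l l2] by simp
    have m1: "Legendre (-1) l = (if l mod 4 = 1 then 1 else -1)"
      unfolding Legendre_minus_one[OF l l2] minus_one_power_iff even_half_pred_iff[OF odd] ..
    have sq: "Legendre 2 l * Legendre 2 l = 1" using Legendre_two[OF l l2] by (simp split: if_splits)
    have 4: "Legendre (-4) l = Legendre (-1) l" using M[of "-2" 2] M[of "-1" 2] sq by (simp add: mult.assoc)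
    have 8: "Legendre 8 l = Legendre 2 l" using M[of 4 2] M[of 2 2] sq by simp
    have m8: "Legendre (-8) l = Legendre (-1) l * Legendre 2 l" using M[of "-1" 8] 8 by simp
    have "l mod 8 = 1 \<or> l mod 8 = 3 \<or> l mod 8 = 5 \<or> l mod 8 = 7" using odd by presburger
    moreover have "l mod 4 = (l mod 8) mod 4" by (simp add: mod_mod_cancel)
    ultimately show ?thesis using that m1 4 8 m8 Legendre_two[OF l l2]
      by (elim disjE) (simp_all add: kronecker_def)
  qed
  show "kronecker (-4) l = (if l = 2 then 0 else if l mod 4 = 1 then 1 else -1)"
    "kronecker 8 l = (if l = 2 then 0 else if l mod 8 = 1 \<or> l mod 8 = 7 then 1 else -1)"
    "kronecker (-8) l = (if l = 2 then 0 else if l mod 8 = 1 \<or> l mod 8 = 3 then 1 else -1)"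
    using * by (auto simp: kronecker_def)
qed

lemma prime_odd_mod8:
  assumes "prime (l::nat)" "l \<noteq> 2"
  shows "int l mod 4 \<in> {1, 3}" "int l mod 8 \<in> {1, 3, 5, 7}" "int l mod 4 = int (l mod 4)" "int l mod 8 = int (l mod 8)"
proof -
  have "odd l" using assms prime_odd_nat[of l] prime_ge_2_nat[of l] by linarith
  then have "odd (int l)" by simp
  then show "int l mod 4 \<in> {1, 3}" "int l mod 8 \<in> {1, 3, 5, 7}" by (simp; presburger)+
qed (simp_all add: of_nat_mod)

lemma disc_char_minus_4: "disc_char (-4) (\<lambda>a. (\<lambda>r. if r = 1 then 1 else if r = 3 then -1 else 0) (a mod 4))"
proof (rule disc_charI_mod8)
  have c: "csqrt (-4) = 2 * \<i>" using csqrt_of_real_nonpos[of "-4"] by simp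
  show "\<forall>r\<in>{0..<4}. (\<Sum>a\<in>{0..<4}. of_int (if a = 1 then 1 else if a = 3 then -1 else 0) * add_char 4 (a * r mod 4))
      = of_int (if r = 1 then 1 else if r = 3 then -1 else 0) * csqrt (of_int (-4))"
    unfolding atLeastLessThan_int_4_8 by (simp add: add_char_4 c)
  show "(if int l mod 4 = 1 then 1 else if int l mod 4 = 3 then -1 else 0) = kronecker (-4) l" if "prime l" for l
    using kronecker_mod8(1)[OF that] prime_odd_mod8[OF that] by (cases "l = 2") auto
qed (simp_all add: atLeastLessThan_int_4_8)

lemma csqrt_8: "csqrt 8 = of_real (2 * sqrt 2)" "csqrt (-8) = \<i> * of_real (2 * sqrt 2)"
proof -
  have "sqrt 8 = 2 * sqrt 2" using real_sqrt_mult[of 4 2] by simp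
  then show "csqrt 8 = of_real (2 * sqrt 2)" "csqrt (-8) = \<i> * of_real (2 * sqrt 2)"
    using csqrt_of_real_nonneg[of 8] csqrt_of_real_nonpos[of "-8"] by simp_all
qed

lemma disc_char_8: "disc_char 8 (\<lambda>a. (\<lambda>r. if r = 1 \<or> r = 7 then 1 else if r = 3 \<or> r = 5 then -1 else 0) (a mod 8))"
proof (rule disc_charI_mod8)
  show "\<forall>r\<in>{0..<8}. (\<Sum>a\<in>{0..<8}. of_int (if a = 1 \<or> a = 7 then 1 else if a = 3 \<or> a = 5 then -1 else 0) * add_char 8 (a * r mod 8))
      = of_int (if r = 1 \<or> r = 7 then 1 else if r = 3 \<or> r = 5 then -1 else 0) * csqrt (of_int 8)"
    unfolding atLeastLessThan_int_4_8 by (simp add: add_char_8 csqrt_8 complex_eq_iff)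
  show "(if int l mod 8 = 1 \<or> int l mod 8 = 7 then 1 else if int l mod 8 = 3 \<or> int l mod 8 = 5 then -1 else 0) = kronecker 8 l" if "prime l" for l
    using kronecker_mod8(2)[OF that] prime_odd_mod8[OF that] by (cases "l = 2") auto
qed (simp_all add: atLeastLessThan_int_4_8)

lemma disc_char_minus_8: "disc_char (-8) (\<lambda>a. (\<lambda>r. if r = 1 \<or> r = 3 then 1 else if r = 5 \<or> r = 7 then -1 else 0) (a mod 8))"
proof (rule disc_charI_mod8)
  show "\<forall>r\<in>{0..<8}. (\<Sum>a\<in>{0..<8}. of_int (if a = 1 \<or> a = 3 then 1 else if a = 5 \<or> a = 7 then -1 else 0) * add_char 8 (a * r mod 8))
      = of_int (if r = 1 \<or> r = 3 then 1 else if r = 5 \<or> r = 7 then -1 else 0) * csqrt (of_int (-8))"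
    unfolding atLeastLessThan_int_4_8 by (simp add: add_char_8 csqrt_8 complex_eq_iff)
  show "(if int l mod 8 = 1 \<or> int l mod 8 = 3 then 1 else if int l mod 8 = 5 \<or> int l mod 8 = 7 then -1 else 0) = kronecker (-8) l" if "prime l" for l
    using kronecker_mod8(3)[OF that] prime_odd_mod8[OF that] by (cases "l = 2") auto
qed (simp_all add: atLeastLessThan_int_4_8)

section \<open>Existence of the character of a fundamental discriminant\<close>

lemma squarefree_cofactor:
  fixes a b :: int
  assumes "squarefree (a * b)"
  shows "squarefree a" "prime p \<Longrightarrow> p dvd b \<Longrightarrow> \<not> p dvd a"
proof -
  show "squarefree a" using assms squarefree_mono[of a "a * b"] by simp
  show "\<not> p dvd a" if "prime p" "p dvd b"
  proof
    assume "p dvd a"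
    then have "p^2 dvd a * b" using that by (simp add: power2_eq_square mult_dvd_mono)
    then show False using assms that by (auto simp: squarefree_def)
  qed
qed

lemma abs_eq_1_if_no_prime_divisor:
  assumes "\<And>p::nat. prime p \<Longrightarrow> \<not> int p dvd x" "x \<noteq> 0"
  shows "\<bar>x\<bar> = 1"
proof (rule ccontr)
  assume "\<bar>x\<bar> \<noteq> 1"
  then obtain p where "prime p" "p dvd x" using prime_divisor_exists[of x] assms(2) by auto
  then show False using assms(1)[of "nat p"] prime_ge_0_int[of p] by simp
qed

text \<open>Induction on |D|: if an odd prime p divides D, dividing by \<open>prime_disc p\<close>
  leaves a smaller fundamental discriminant or 1 that is prime to p. Without odd prime factors D can
  only be 1, -4, 8 or -8.\<close>

lemma exists_disc_char:
  assumes "D = 1 \<or> fund_disc D"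
  shows "\<exists>\<psi>. disc_char D \<psi>"
  using assms
proof (induction "nat \<bar>D\<bar>" arbitrary: D rule: less_induct)
  case less
  have D0: "D \<noteq> 0" using less.prems by (auto simp: fund_disc_def)
  show ?case
  proof (cases "\<exists>p::nat. prime p \<and> p \<noteq> 2 \<and> int p dvd D")
    case True
    then obtain p :: nat where p: "prime p" "p \<noteq> 2" "int p dvd D" by blast
    then have p2: "p > 2" using prime_ge_2_nat[of p] by linarith
    have pp: "prime (int p)" "int p dvd prime_disc p" using p by (auto simp: prime_disc_def)
    have "prime_disc p dvd D" using p(3) by (simp add: prime_disc_def minus_one_power_iff)
    then obtain D' where D': "D = D' * prime_disc p" by (metis dvdE mult.commute)
    \<comment> \<open>A prime discriminant is 1 modulo 4, so removing it preserves the congruence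
      conditions in \<open>fund_disc\<close>.\<close>
    have m4: "x * prime_disc p mod 4 = x mod 4" for x
      using prime_disc_mod4(2)[OF p(1) p2] by (metis mod_mult_right_eq mult.right_neutral)
    have "(D' = 1 \<or> fund_disc D') \<and> \<not> int p dvd D'"
    proof (cases "D mod 4 = 1")
      case True
      then have "squarefree (D' * prime_disc p)" using less.prems D' by (auto simp: fund_disc_def)
      then show ?thesis using squarefree_cofactor[of D' "prime_disc p"] pp True m4[of D'] D' by (auto simp: fund_disc_def)
    next
      case False
      then have f: "4 dvd D" "squarefree (D div 4)" "(D div 4) mod 4 = 2 \<or> (D div 4) mod 4 = 3"
        using less.prems by (auto simp: fund_disc_def)
      have odd: "odd (prime_disc p)" using odd_prime_half[OF p(1) p2] by (simp add: prime_disc_def)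
      have "coprime 4 (prime_disc p)" using odd coprime_power_left_iff[of 2 2 "prime_disc p"] by simp
      then have "4 dvd D'" using f(1) D' by (simp add: coprime_dvd_mult_left_iff)
      then obtain E where E: "D' = 4 * E" by blast
      have DE: "D div 4 = E * prime_disc p" using D' E by simp
      then have sf: "squarefree E" "\<not> int p dvd E" using f(2) squarefree_cofactor[of E "prime_disc p"] pp by auto
      have "E mod 4 = 2 \<or> E mod 4 = 3" using f(3) m4[of E] DE by simp
      moreover have "\<not> int p dvd 4 * E"
      proof
        assume "int p dvd 4 * E"
        then have "int p dvd 2 ^ 2" using sf pp(1) by (auto simp: prime_dvd_mult_iff)
        then have "int p dvd 2" using pp(1) prime_dvd_power by blast
        then show False using p2 by (auto dest: zdvd_imp_le)
      qed
      ultimately show ?thesis using sf E by (auto simp: fund_disc_def)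
    qed
    then have D'1: "D' = 1 \<or> fund_disc D'" and ndvd: "\<not> int p dvd D'" by auto
    have "\<bar>D\<bar> = \<bar>D'\<bar> * int p" unfolding D' by (simp add: abs_mult prime_disc_def power_abs)
    moreover have "\<bar>D'\<bar> > 0" using D' D0 by simp
    ultimately have "nat \<bar>D'\<bar> < nat \<bar>D\<bar>" using p2 by simp
    from less.hyps[OF this D'1] obtain \<psi> where "disc_char D' \<psi>" by blast
    from disc_char_mult_prime[OF this p(1) p2 ndvd] show ?thesis unfolding D' by blast
  next
    case False
    have no: "\<not> int p dvd x" if "prime p" "x dvd D" "odd x" for x and p :: nat
      using False that by (metis dvd_trans of_nat_numeral)
    show ?thesis
    proof (cases "D mod 4 = 1")
      case True
      then have "odd D" by presburger
      then have "\<bar>D\<bar> = 1" by (intro abs_eq_1_if_no_prime_divisor[OF no]) (use D0 in simp_all)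
      then have "D = 1 \<or> D = -1" by linarith
      then have "D = 1" using True by auto
      then show ?thesis using disc_char_1 by blast
    next
      case nm: False
      then have f: "4 dvd D" "(D div 4) mod 4 = 2 \<or> (D div 4) mod 4 = 3"
        using less.prems by (auto simp: fund_disc_def)
      define E where "E = D div 4"
      have DE: "D = 4 * E" using f by (simp add: E_def)
      have E0: "E \<noteq> 0" using DE D0 by simp
      have "D = -4 \<or> D = 8 \<or> D = -8"
      proof (cases "even E")
        case True
        then obtain F where F: "E = 2 * F" by blast
        have "odd F" using f(2) unfolding E_def[symmetric] F by presburger
        then have "\<bar>F\<bar> = 1" by (intro abs_eq_1_if_no_prime_divisor[OF no]) (use E0 DE F in simp_all)
        then show ?thesis using DE F by auto
      next
        case False
        then have "\<bar>E\<bar> = 1" by (intro abs_eq_1_if_no_prime_divisor[OF no]) (use E0 DE in simp_all)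
        then have "E = 1 \<or> E = -1" by linarith
        then show ?thesis using f(2) DE unfolding E_def[symmetric] by auto
      qed
      then show ?thesis using disc_char_minus_4 disc_char_8 disc_char_minus_8 by blast
    qed
  qed
qed

section \<open>Arithmetic of the discriminant\<close>

lemma quotient_of_eq_imp:
  assumes "quotient_of x = (a, b)"
  shows "b > 0" "coprime a b" "x * of_int b = of_int a"
  using quotient_of_denom_pos[OF assms] quotient_of_coprime[OF assms] quotient_of_div[OF assms] by auto

lemma snd_quotient_of_dvd:
  assumes "x * of_int n = of_int m"
  shows "snd (quotient_of x) dvd n"
proof -
  obtain a b where ab: "quotient_of x = (a, b)" by fastforce
  note q = quotient_of_eq_imp[OF ab]
  have "of_int (a * n) = (of_int (m * b) :: rat)" using assms q(3) by (metis mult.commute mult.left_commute of_int_mult)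
  then have "a * n = m * b" by (simp only: of_int_eq_iff)
  then have "b dvd a * n" by simp
  then have "b dvd n" using q(2) by (simp add: coprime_dvd_mult_right_iff coprime_commute)
  then show ?thesis using ab by simp
qed

lemma fund_disc_nonzero: "fund_disc D \<Longrightarrow> D \<noteq> 0"
  by (auto simp: fund_disc_def)

text \<open>D or D/4 is squarefree and an odd square is prime to 4. Applied to primes outside Q,
  which are odd, this gives both the integrality of F and the range of f.\<close>

lemma fund_disc_odd_square_dvd:
  assumes D: "fund_disc D" and x: "odd x" "x^2 dvd D"
  shows "is_unit x"
proof (cases "D mod 4 = 1 \<and> squarefree D")
  case True
  then show ?thesis using x squarefreeD by blast
next
  case False
  then have f: "4 dvd D" "squarefree (D div 4)" using D by (auto simp: fund_disc_def)
  have "x^2 dvd 4 * (D div 4)" using x(2) f(1) by simp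
  moreover have "coprime (x^2) 4"
  proof -
    have "coprime x 2" using x(1) by simp
    then have "coprime (x^2) (2^2)" by (metis coprime_power_left_iff coprime_power_right_iff)
    then show ?thesis by simp
  qed
  ultimately have "x^2 dvd D div 4" by (simp add: coprime_dvd_mult_right_iff)
  then show ?thesis using f(2) squarefreeD by blast
qed

text \<open>After cancelling gcd x y, the square of each cofactor divides the squarefree number
  opposite to it, so both cofactors are units.\<close>

lemma squarefree_int_unique:
  fixes r1 r2 x y :: int
  assumes "squarefree r1" "squarefree r2" "r1 * x^2 = r2 * y^2" "x \<noteq> 0" "y \<noteq> 0"
  shows "r1 = r2"
proof -
  define g where "g = gcd x y"
  have g: "g \<noteq> 0" using assms(4) by (simp add: g_def)
  obtain u v where uv: "x = g * u" "y = g * v" "coprime u v"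
    using gcd_coprime_exists[of x y] assms(4) unfolding g_def by (metis gcd_eq_0_iff mult.commute)
  have eq: "r1 * u^2 = r2 * v^2" using assms(3) g unfolding uv by (simp add: power_mult_distrib)
  have cop: "coprime (u^2) (v^2)" using uv(3) by simp
  have "u^2 dvd r2 * v^2" "v^2 dvd r1 * u^2" using eq by (metis dvd_triv_right)+
  then have "u^2 dvd r2" "v^2 dvd r1" using cop by (simp_all add: coprime_dvd_mult_left_iff coprime_commute)
  then have "is_unit u" "is_unit v" using assms(1,2) squarefreeD by blast+
  then have "u^2 = 1" "v^2 = 1" by (auto simp: zdvd1_eq power2_eq_square abs_if split: if_splits)
  then show ?thesis using eq by simp
qed

text \<open>The factor m is determined by r modulo 4, so discriminants with the same squarefree
  kernel are equal.\<close>

lemma fund_disc_squarefree_kernel: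
  assumes "fund_disc D"
  obtains r m where "D = r * m^2" "squarefree r" "m \<noteq> 0" "(r mod 4 = 1 \<and> m = 1) \<or> (r mod 4 \<noteq> 1 \<and> m = 2)"
proof (cases "D mod 4 = 1 \<and> squarefree D")
  case True
  then show ?thesis using that[of D 1] by simp
next
  case False
  then have "4 dvd D" "squarefree (D div 4)" "(D div 4) mod 4 = 2 \<or> (D div 4) mod 4 = 3" using assms by (auto simp: fund_disc_def)
  then show ?thesis using that[of "D div 4" 2] by auto
qed

lemma fund_disc_unique:
  assumes "fund_disc D1" "fund_disc D2" "\<sigma>1^2 * of_int D1 = \<sigma>2^2 * of_int D2" "(\<sigma>1 :: rat) \<noteq> 0"
  shows "D1 = D2"
proof -
  obtain r1 m1 where 1: "D1 = r1 * m1^2" "squarefree r1" "m1 \<noteq> 0" "(r1 mod 4 = 1 \<and> m1 = 1) \<or> (r1 mod 4 \<noteq> 1 \<and> m1 = 2)"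
    using fund_disc_squarefree_kernel[OF assms(1)] .
  obtain r2 m2 where 2: "D2 = r2 * m2^2" "squarefree r2" "m2 \<noteq> 0" "(r2 mod 4 = 1 \<and> m2 = 1) \<or> (r2 mod 4 \<noteq> 1 \<and> m2 = 2)"
    using fund_disc_squarefree_kernel[OF assms(2)] .
  obtain a b where ab: "quotient_of \<sigma>1 = (a, b)" by fastforce
  obtain c d where cd: "quotient_of \<sigma>2 = (c, d)" by fastforce
  note q1 = quotient_of_eq_imp[OF ab] and q2 = quotient_of_eq_imp[OF cd]
  have s2: "\<sigma>2 \<noteq> 0" using assms fund_disc_nonzero by auto
  have "(\<sigma>1 * of_int b)^2 * of_int D1 * (of_int d)^2 = (\<sigma>2 * of_int d)^2 * of_int D2 * (of_int b)^2"
    using assms(3) by (simp add: power_mult_distrib)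
  then have "of_int (a^2 * D1 * d^2) = (of_int (c^2 * D2 * b^2) :: rat)" unfolding q1(3) q2(3) by simp
  then have "a^2 * D1 * d^2 = c^2 * D2 * b^2" by (simp only: of_int_eq_iff)
  then have "r1 * (a * d * m1)^2 = r2 * (c * b * m2)^2" unfolding 1(1) 2(1) by (simp add: power_mult_distrib mult_ac)
  moreover have "a \<noteq> 0" "c \<noteq> 0" using q1(3) q2(3) q1(1) q2(1) assms(4) s2 by auto
  ultimately have "r1 = r2" using 1 2 q1(1) q2(1) by (intro squarefree_int_unique[of r1 r2 "a * d * m1" "c * b * m2"]) auto
  then show ?thesis using 1 2 by auto
qed

lemma fund_disc_exists:
  assumes "\<not> (\<exists>x::rat. \<delta> = x^2)"
  shows "\<exists>D \<sigma>. fund_disc D \<and> \<sigma> > 0 \<and> \<delta> = \<sigma>^2 * of_int D"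
proof -
  obtain a b where ab: "quotient_of \<delta> = (a, b)" by fastforce
  note q = quotient_of_eq_imp[OF ab]
  have "\<delta> \<noteq> 0" using assms by (metis zero_power2)
  then have a0: "a \<noteq> 0" using q by auto
  \<comment> \<open>For a fraction a/b the square class is that of a b, since (a/b) b^2 = a
    b.\<close>
  define r m where "r = squarefree_part (a * b)" and "m = square_part (a * b)"
  have rm: "a * b = r * m^2" unfolding r_def m_def by (rule squarefree_decompose)
  have sf: "squarefree r" by (simp add: r_def)
  have m0: "m \<noteq> 0" using a0 q(1) by (simp add: m_def)
  define \<sigma> :: rat where "\<sigma> = of_int \<bar>m\<bar> / of_int b"
  have \<sigma>: "\<sigma> > 0" using m0 q(1) by (simp add: \<sigma>_def)
  have "\<delta> * (of_int b)^2 = of_int (a * b)" using q(3) by (simp add: power2_eq_square)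
  then have "\<delta> = of_int (r * m^2) / (of_int b)^2" using q(1) unfolding rm by (simp add: field_simps)
  also have "\<dots> = \<sigma>^2 * of_int r" by (simp add: \<sigma>_def power_divide mult.commute)
  finally have \<delta>: "\<delta> = \<sigma>^2 * of_int r" .
  have r1: "r \<noteq> 1" using assms \<delta> by auto
  show ?thesis
  proof (cases "r mod 4 = 1")
    case True
    then have "fund_disc r" using sf r1 by (simp add: fund_disc_def)
    then show ?thesis using \<sigma> \<delta> by blast
  next
    case False
    have "r mod 4 \<noteq> 0"
    proof
      assume "r mod 4 = 0"
      then have "2^2 dvd r" by (simp add: dvd_eq_mod_eq_0)
      then have "is_unit (2::int)" using sf squarefreeD by blast
      then show False by simp
    qed
    then have "r mod 4 = 2 \<or> r mod 4 = 3" using False by presburger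
    moreover have "4 * r \<noteq> 1" by presburger
    ultimately have "fund_disc (4 * r)" using sf by (simp add: fund_disc_def)
    moreover have "\<delta> = (\<sigma> / 2)^2 * of_int (4 * r)" using \<delta> by (simp add: power_divide)
    ultimately show ?thesis using \<sigma> by (metis half_gt_zero)
  qed
qed

lemma disc_sigma:
  assumes "\<not> (\<exists>x::rat. \<delta> = x^2)"
  shows "fund_disc (disc \<delta>)" "sigma \<delta> > 0" "\<delta> = (sigma \<delta>)^2 * of_int (disc \<delta>)"
proof -
  obtain D \<sigma> where D: "fund_disc D" "\<sigma> > 0" "\<delta> = \<sigma>^2 * of_int D" using fund_disc_exists[OF assms] by blast
  have "disc \<delta> = D" unfolding disc_def
  proof (rule the_equality)
    show "fund_disc D \<and> (\<exists>\<sigma>. \<delta> = \<sigma>^2 * of_int D)" using D by blast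
    fix D' assume "fund_disc D' \<and> (\<exists>\<sigma>. \<delta> = \<sigma>^2 * of_int D')"
    then obtain \<sigma>' where D': "fund_disc D'" "\<delta> = \<sigma>'^2 * of_int D'" by blast
    show "D' = D" using fund_disc_unique[OF D(1) D'(1), of \<sigma> \<sigma>'] D D' by simp
  qed
  then have "\<exists>\<sigma>. 0 < \<sigma> \<and> \<delta> = \<sigma>^2 * of_int (disc \<delta>)" using D by blast
  from someI_ex[OF this] show "sigma \<delta> > 0" "\<delta> = (sigma \<delta>)^2 * of_int (disc \<delta>)" unfolding sigma_def by auto
  show "fund_disc (disc \<delta>)" using \<open>disc \<delta> = D\<close> D by simp
qed

section \<open>Separating the primes in Q\<close>

definition S_part :: "nat set \<Rightarrow> nat \<Rightarrow> nat" where
  "S_part Q n = (\<Prod>q\<in>Q. q ^ multiplicity q n)"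

lemma S_part_decomposition:
  assumes Q: "finite Q" "\<forall>q\<in>Q. prime q" and n: "n > 0"
  obtains m where "n = S_part Q n * m" "m > 0" "\<forall>q\<in>Q. \<not> q dvd m"
    and "\<And>p. prime p \<Longrightarrow> p dvd S_part Q n \<Longrightarrow> p \<in> Q"
proof -
  have "S_part Q n dvd n" unfolding S_part_def
  proof (rule multiplicity_le_imp_dvd)
    show "(\<Prod>q\<in>Q. q ^ multiplicity q n) \<noteq> 0" using Q by (auto dest: prime_gt_0_nat)
    fix p :: nat assume p: "prime p"
    have "multiplicity p (\<Prod>q\<in>Q. q ^ multiplicity q n) = (if p \<in> Q then multiplicity p n else 0)"
      using multiplicity_prod_prime_powers[of Q p "\<lambda>q. multiplicity q n"] Q p by auto
    then show "multiplicity p (\<Prod>q\<in>Q. q ^ multiplicity q n) \<le> multiplicity p n" by simp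
  qed
  then obtain m where m: "n = S_part Q n * m" by blast
  have m0: "m > 0" and s0: "S_part Q n > 0" using m n by (auto intro: Nat.gr0I)
  have "\<not> q dvd m" if q: "q \<in> Q" for q
  proof
    assume "q dvd m"
    have pq: "prime q" using Q q by blast
    have "multiplicity q (S_part Q n) = multiplicity q n"
      unfolding S_part_def using multiplicity_prod_prime_powers[of Q q "\<lambda>q. multiplicity q n"] Q pq q by auto
    moreover have "multiplicity q n = multiplicity q (S_part Q n) + multiplicity q m"
      using pq m0 s0 by (subst m, intro prime_elem_multiplicity_mult_distrib) auto
    moreover have "multiplicity q m > 0" using \<open>q dvd m\<close> pq m0 by (simp add: prime_multiplicity_gt_zero_iff)
    ultimately show False by simp
  qed
  moreover have "p \<in> Q" if p: "prime p" "p dvd S_part Q n" for p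
  proof -
    obtain q where "q \<in> Q" "p dvd q ^ multiplicity q n"
      using p(2) unfolding S_part_def prime_dvd_prod_iff[OF Q(1) p(1)] by blast
    then show ?thesis using p(1) Q(2) prime_dvd_power primes_dvd_imp_eq by blast
  qed
  ultimately show ?thesis using that m m0 by blast
qed

text \<open>The $S$-adic decomposition: $\sigma_{(q)} = u/v$ is the part of $\sigma$ supported on $Q$,
  and $F = \sigma/\sigma_{(q)}$ is integral because a prime outside $Q$, being odd, divides $D$
  at most once.\<close>

lemma coprime_int_by_primes:
  fixes x y :: int
  assumes "\<And>l::nat. prime l \<Longrightarrow> int l dvd x \<Longrightarrow> int l dvd y \<Longrightarrow> False"
  shows "coprime x y"
proof (rule ccontr)
  assume n: "\<not> coprime x y"
  then have nu: "\<not> is_unit (gcd x y)" by (simp only: is_unit_gcd not_False_eq_True)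
  have "\<exists>l::nat. prime l \<and> int l dvd gcd x y"
  proof (cases "gcd x y = 0")
    case True
    then show ?thesis using two_is_prime_nat by (metis dvd_0_right)
  next
    case False
    then obtain p where p: "p dvd gcd x y" "prime p" using prime_divisor_exists nu by blast
    then have "prime (nat p)" "int (nat p) = p" using prime_ge_0_int[of p] by simp_all
    then show ?thesis using p by metis
  qed
  then show False using assms by auto
qed

lemma multiplicity_int_nat:
  assumes "prime (q::nat)" "n > 0"
  shows "multiplicity (int q) (int n) = multiplicity q n"
proof (rule multiplicity_eqI)
  have "q ^ multiplicity q n dvd n" by (rule multiplicity_dvd)
  then show "int q ^ multiplicity q n dvd int n" by (simp only: of_nat_power[symmetric] int_dvd_int_iff)
  have "\<not> q ^ Suc (multiplicity q n) dvd n"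
    using assms by (subst power_dvd_iff_le_multiplicity) auto
  then show "\<not> int q ^ Suc (multiplicity q n) dvd int n" by (simp only: of_nat_power[symmetric] int_dvd_int_iff not_False_eq_True)
qed

text \<open>The relation for \<open>\<delta>\<close> is cleared of its denominator so that each use
  can be transferred to the integers. Recording \<open>tau\<close> as the integer F^2 D makes the
  floor in \<open>eps\<close> exact.\<close>

locale S_decomposition =
  fixes Q :: "nat set" and \<delta> :: rat and u v F :: nat and D :: int
  assumes Q: "finite Q" "\<forall>q\<in>Q. prime q" "2 \<in> Q"
    and D: "fund_disc D"
    and pos: "u > 0" "v > 0" "F > 0"
    and u_primes: "\<And>p. prime p \<Longrightarrow> p dvd u \<Longrightarrow> p \<in> Q" and v_primes: "\<And>p. prime p \<Longrightarrow> p dvd v \<Longrightarrow> p \<in> Q"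
    and F_coprime: "\<forall>q\<in>Q. \<not> q dvd F"
    and \<delta>: "\<delta> * of_nat (v^2) = of_nat (u^2) * (of_nat (F^2) * of_int D)"
    and tau: "tau Q \<delta> = of_int (int (F^2) * D)"

lemma S_decomposition_exists:
  assumes Q: "finite Q" "\<forall>q\<in>Q. prime q" "2 \<in> Q" and in_S: "inZS Q \<delta>" and ns: "\<not> (\<exists>x::rat. \<delta> = x^2)"
  obtains u v F where "S_decomposition Q \<delta> u v F (disc \<delta>)"
proof -
  note ds = disc_sigma[OF ns]
  let ?D = "disc \<delta>"
  obtain a0 b0 where ab0: "quotient_of (sigma \<delta>) = (a0, b0)" by fastforce
  note q0 = quotient_of_eq_imp[OF ab0]
  have "of_int a0 > (0 :: rat)" using q0(1) ds(2) unfolding q0(3)[symmetric] by simp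
  then have "a0 > 0" by simp
  then obtain a b where ab: "a0 = int a" "b0 = int b" "a > 0" "b > 0"
    using q0(1) by (metis zero_less_imp_eq_int)
  have cop: "coprime a b" using q0(2) unfolding ab by simp
  have sab: "sigma \<delta> * of_nat b = of_nat a" using q0(3) unfolding ab by simp
  obtain a' where a': "a = S_part Q a * a'" "a' > 0" "\<forall>q\<in>Q. \<not> q dvd a'" "\<And>p. prime p \<Longrightarrow> p dvd S_part Q a \<Longrightarrow> p \<in> Q"
    using S_part_decomposition[OF Q(1,2) ab(3)] by metis
  obtain b' where b': "b = S_part Q b * b'" "b' > 0" "\<forall>q\<in>Q. \<not> q dvd b'" "\<And>p. prime p \<Longrightarrow> p dvd S_part Q b \<Longrightarrow> p \<in> Q"
    using S_part_decomposition[OF Q(1,2) ab(4)] by metis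
  have p0: "S_part Q a > 0" "S_part Q b > 0" using a'(1) b'(1) ab by (auto intro: Nat.gr0I)
  have "b' = 1"
  proof (rule ccontr)
    assume "b' \<noteq> 1"
    then obtain p where p: "prime p" "p dvd b'" using prime_factor_nat by blast
    have pQ: "p \<notin> Q" using p b'(3) by blast
    then have oddp: "odd p" using p(1) Q(3) by (metis primes_dvd_imp_eq two_is_prime_nat)
    have pb: "p dvd b" using p(2) b'(1) by (metis dvd_mult)
    then have pa: "\<not> p dvd a" using cop p(1) by (metis coprime_common_divisor not_prime_unit)
    obtain c d where cd: "quotient_of \<delta> = (c, d)" by fastforce
    note qd = quotient_of_eq_imp[OF cd]
    have pd: "\<not> int p dvd d" using in_S p(1) pQ cd by (auto simp: inZS_def)
    \<comment> \<open>With \<open>\<delta>\<close> = c/d this becomes c b^2 = a^2 D d in the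
      integers. The prime p divides b but neither a nor d, so p^2 would divide D.\<close>
    have "(\<delta> * of_int d) * (of_nat b)^2 = (sigma \<delta> * of_nat b)^2 * of_int ?D * of_int d"
      by (subst ds(3)) (simp add: power_mult_distrib)
    then have "of_int (c * (int b)^2) = (of_int ((int a)^2 * ?D * d) :: rat)" unfolding qd(3) sab by simp
    then have "c * (int b)^2 = (int a)^2 * ?D * d" by (simp only: of_int_eq_iff)
    moreover have "(int p)^2 dvd c * (int b)^2" using pb by (intro dvd_mult dvd_power_same) simp
    ultimately have "(int p)^2 dvd ((int a)^2 * d) * ?D" by (simp add: mult_ac)
    moreover have "coprime ((int p)^2) ((int a)^2 * d)"
    proof -
      have "coprime (int p) (int a)" "coprime (int p) d" using p(1) pa pd by (auto intro!: prime_imp_coprime)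
      then show ?thesis by simp
    qed
    ultimately have "(int p)^2 dvd ?D" by (simp add: coprime_dvd_mult_right_iff)
    then have "is_unit (int p)" using fund_disc_odd_square_dvd[OF ds(1), of "int p"] oddp by simp
    then show False using p(1) by auto
  qed
  then have bS: "b = S_part Q b" using b'(1) by simp
  have sq: "sigma_q Q \<delta> = of_nat (S_part Q a) / of_nat (S_part Q b)"
  proof -
    have "(of_nat q :: rat) powi (rval q (sigma \<delta>)) = of_nat (q ^ multiplicity q a) / of_nat (q ^ multiplicity q b)" if "q \<in> Q" for q
    proof -
      have "q > 0" using that Q(2) prime_gt_0_nat by blast
      have "rval q (sigma \<delta>) = int (multiplicity q a) - int (multiplicity q b)"
        using that Q(2) ab(3,4) by (simp add: rval_def ab0 ab(1,2) multiplicity_int_nat)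
      then show ?thesis using \<open>q > 0\<close> by (simp add: power_int_diff)
    qed
    then show ?thesis by (simp add: sigma_q_def S_part_def prod_dividef)
  qed
  have "\<delta> * of_nat (b^2) = (sigma \<delta> * of_nat b)^2 * of_int ?D"
    by (subst ds(3)) (simp add: power_mult_distrib)
  also have "\<dots> = of_nat ((S_part Q a)^2) * (of_nat (a'^2) * of_int ?D)"
    unfolding sab by (subst a'(1)) (simp add: power_mult_distrib)
  finally have \<delta>: "\<delta> * of_nat ((S_part Q b)^2) = of_nat ((S_part Q a)^2) * (of_nat (a'^2) * of_int ?D)"
    using bS by simp
  have "\<delta> / (sigma_q Q \<delta>)^2 = (\<delta> * of_nat ((S_part Q b)^2)) / of_nat ((S_part Q a)^2)"
    unfolding sq by (simp add: power_divide)
  also have "\<dots> = of_int (int (a'^2) * ?D)" unfolding \<delta> using p0 by simp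
  finally have tau: "tau Q \<delta> = of_int (int (a'^2) * ?D)" by (simp add: tau_def)
  have "S_decomposition Q \<delta> (S_part Q a) (S_part Q b) a' ?D"
    by (unfold_locales; fact Q ds(1) p0 a'(2,3,4) b'(4) \<delta> tau)
  then show ?thesis by (rule that)
qed

context S_decomposition
begin

lemma odd_outside:
  assumes "prime p" "p \<notin> Q"
  shows "odd p" "p > 2" "\<not> p dvd u" "\<not> p dvd v"
proof -
  have "p \<noteq> 2" using assms Q(3) by blast
  then show "p > 2" using prime_ge_2_nat[OF assms(1)] by linarith
  then show "odd p" using assms(1) prime_odd_nat by blast
  show "\<not> p dvd u" "\<not> p dvd v" using assms u_primes v_primes by blast+
qed

lemma ZS_pos_iff: "k \<in> ZS_pos Q \<longleftrightarrow> 0 < k \<and> (\<forall>q\<in>Q. \<not> q dvd k)"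
proof -
  have "coprime k q \<longleftrightarrow> \<not> q dvd k" if "q \<in> Q" for q
    using that Q(2) by (metis coprime_commute coprime_absorb_left not_prime_unit prime_imp_coprime)
  then show ?thesis by (auto simp: ZS_pos_def)
qed

lemma tau_int: "\<lfloor>tau Q \<delta>\<rfloor> = int (F^2) * D"
  unfolding tau by (rule floor_of_int)

lemma eq_div:
  assumes "f > 0"
  shows "\<delta> / (of_nat f)^2 * of_nat (v^2 * f^2) = of_nat (u^2) * (of_nat (F^2) * of_int D)"
  using \<delta> assms by simp

text \<open>An admissible f is prime to u and to the reduced denominator, so membership forces f^2
  to divide F^2 D. After cancelling gcd f F the square of the remaining odd cofactor divides D,
  hence the cofactor is 1.\<close>

lemma f_set_eq: "f_set Q \<delta> = {f. f dvd F}"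
proof (intro equalityI subsetI)
  fix f assume "f \<in> f_set Q \<delta>"
  then have f: "f > 0" "\<forall>q\<in>Q. \<not> q dvd f" "inZS Q (\<delta> / (of_nat f)^2)" by (auto simp: f_set_def ZS_pos_iff)
  obtain c d where cd: "quotient_of (\<delta> / (of_nat f)^2) = (c, d)" by fastforce
  note q = quotient_of_eq_imp[OF cd]
  have "\<delta> / (of_nat f)^2 * of_int d * of_nat (v^2 * f^2) = of_int d * (of_nat (u^2) * (of_nat (F^2) * of_int D))"
    using eq_div[OF f(1)] by (metis mult.assoc mult.commute)
  then have "of_int (c * int (v^2 * f^2)) = (of_int (d * (int (u^2) * (int (F^2) * D))) :: rat)"
    unfolding q(3) by simp
  then have e: "c * int (v^2 * f^2) = d * (int (u^2) * (int (F^2) * D))" by (simp only: of_int_eq_iff)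
  have "coprime (int f) d" "coprime (int f) (int u)"
    by (rule coprime_int_by_primes; use f(2,3) cd u_primes in \<open>auto simp: inZS_def\<close>)+
  then have "coprime ((int f)^2) (d * (int u)^2)" by simp
  moreover have "(int f)^2 dvd (d * (int u)^2) * ((int F)^2 * D)"
  proof -
    have "(d * (int u)^2) * ((int F)^2 * D) = (int f)^2 * (c * (int v)^2)" using e by (simp add: mult_ac)
    then show ?thesis by simp
  qed
  ultimately have dv: "(int f)^2 dvd (int F)^2 * D" by (simp add: coprime_dvd_mult_right_iff)
  define g where "g = gcd f F"
  have g: "g > 0" using f(1) by (simp add: g_def)
  obtain f' F' where fF: "f = f' * g" "F = F' * g" "coprime f' F'"
    using gcd_coprime_exists[of f F] f(1) unfolding g_def by auto
  have "(int g)^2 * (int f')^2 dvd (int g)^2 * ((int F')^2 * D)" using dv unfolding fF by (simp add: power_mult_distrib mult_ac)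
  then have "(int f')^2 dvd (int F')^2 * D" using g by simp
  moreover have "coprime ((int f')^2) ((int F')^2)" using fF(3) by simp
  ultimately have "(int f')^2 dvd D" by (simp add: coprime_dvd_mult_right_iff)
  moreover have "odd (int f')" using f(2) Q(3) fF(1) by auto
  ultimately have "is_unit (int f')" using fund_disc_odd_square_dvd[OF D] by blast
  then have "f' = 1" by simp
  then show "f \<in> {f. f dvd F}" using fF by simp
next
  fix f assume "f \<in> {f. f dvd F}"
  then obtain g where g: "F = f * g" by blast
  have f0: "f > 0" using g pos by (auto intro: Nat.gr0I)
  have e: "\<delta> / (of_nat f)^2 * of_int (int (v^2)) = of_int (int (u^2) * (int (g^2) * D))"
    using eq_div[OF f0] f0 unfolding g by (simp add: power_mult_distrib field_simps)
  have "inZS Q (\<delta> / (of_nat f)^2)" unfolding inZS_def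
  proof (intro allI impI)
    fix l :: nat assume l: "prime l \<and> l \<notin> Q"
    show "\<not> int l dvd snd (quotient_of (\<delta> / (of_nat f)^2))"
    proof
      assume "int l dvd snd (quotient_of (\<delta> / (of_nat f)^2))"
      then have "int l dvd int (v^2)" using snd_quotient_of_dvd[OF e] dvd_trans by blast
      then have "l dvd v^2" by (simp only: int_dvd_int_iff)
      then have "l dvd v" using l prime_dvd_power by blast
      then show False using l v_primes by blast
    qed
  qed
  moreover have "\<forall>q\<in>Q. \<not> q dvd f" using F_coprime g by auto
  ultimately show "f \<in> f_set Q \<delta>" using f0 by (simp add: f_set_def ZS_pos_iff)
qed

text \<open>With g = F/f the argument is (u/v)^2 g^2 D. At p outside Q the numbers u and v are
  units, so their squares drop out of the symbol, and g^2 contributes 1 or 0.\<close>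

lemma symb_p_eq:
  assumes g: "F = f * g" and p: "prime p" "p \<notin> Q"
  shows "symb_p (\<delta> / (of_nat f)^2) p = (if p dvd g then 0 else Legendre D (int p))"
proof -
  note odd = odd_outside[OF p]
  note M = Legendre_mult[OF p(1) odd(2)]
  have f0: "f > 0" using g pos by (auto intro: Nat.gr0I)
  obtain a b where ab: "quotient_of (\<delta> / (of_nat f)^2) = (a, b)" by fastforce
  note q = quotient_of_eq_imp[OF ab]
  have fs: "f \<in> f_set Q \<delta>" unfolding f_set_eq using g by simp
  then have pb: "\<not> int p dvd b" using p ab by (auto simp: f_set_def inZS_def)
  have e: "\<delta> / (of_nat f)^2 * of_nat (v^2) = of_nat (u^2) * (of_nat (g^2) * of_int D)"
    using eq_div[OF f0] f0 unfolding g by (simp add: power_mult_distrib field_simps)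
  have "(\<delta> / (of_nat f)^2 * of_int b) * of_int b * of_nat (v^2) = (of_int b)^2 * (of_nat (u^2) * (of_nat (g^2) * of_int D))"
    unfolding e[symmetric] by (simp only: power2_eq_square mult_ac)
  then have "of_int ((a * b) * (int v)^2) = (of_int (b^2 * ((int u)^2 * ((int g)^2 * D))) :: rat)"
    unfolding q(3) by simp
  then have eq: "(a * b) * (int v)^2 = b^2 * ((int u)^2 * ((int g)^2 * D))" by (simp only: of_int_eq_iff)
  have sq: "Legendre (x^2) p = 1" if "\<not> int p dvd x" for x using Legendre_square[OF that] p(1) by simp
  have "Legendre (a * b) p = Legendre ((a * b) * (int v)^2) p" using odd(4) by (simp add: M sq)
  also have "\<dots> = Legendre ((int g)^2) p * Legendre D p" unfolding eq using odd(3) pb by (simp add: M sq)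
  also have "Legendre ((int g)^2) p = (if p dvd g then 0 else 1)"
  proof (cases "p dvd g")
    case True
    then have "int p dvd (int g)^2" by (simp add: power2_eq_square)
    then show ?thesis using True by (simp add: Legendre_eq_0_iff)
  next
    case False
    then show ?thesis using sq[of "int g"] by simp
  qed
  finally show ?thesis by (simp add: symb_p_def ab)
qed

end

section \<open>Poisson summation\<close>

abbreviation wave :: "int \<Rightarrow> real \<Rightarrow> complex" where
  "wave n x \<equiv> cis (2 * pi * of_int n * x)"

text \<open>Functions all of whose Fourier coefficients vanish. The class is closed under
  multiplication by trigonometric polynomials, which is what the density argument requires.\<close>

definition fourier_null :: "(real \<Rightarrow> complex) \<Rightarrow> bool" where
  "fourier_null h \<longleftrightarrow> continuous_on UNIV h \<and> (\<forall>n::int. integral {0..1} (\<lambda>x. h x * wave n x) = 0)"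

lemma continuous_on_cis_linear [continuous_intros]:
  "continuous_on A (\<lambda>x::real. cis (c * x))"
  unfolding cis_conv_exp by (intro continuous_intros)

lemma fourier_null_lincomb:
  assumes "fourier_null f" "fourier_null g"
  shows "fourier_null (\<lambda>x. a * f x + b * g x)"
  unfolding fourier_null_def
proof (intro conjI allI)
  have c: "continuous_on UNIV f" "continuous_on UNIV g" using assms by (auto simp: fourier_null_def)
  then show "continuous_on UNIV (\<lambda>x. a * f x + b * g x)" by (intro continuous_intros)
  fix n :: int
  have i: "(\<lambda>x. h x * wave n x) integrable_on {0..1}" if "continuous_on UNIV h" for h
    by (intro integrable_continuous_real continuous_intros) (use that continuous_on_subset in blast)
  have "integral {0..1} (\<lambda>x. (a * f x + b * g x) * wave n x)
      = integral {0..1} (\<lambda>x. a * (f x * wave n x) + b * (g x * wave n x))"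
    by (simp add: algebra_simps)
  also have "\<dots> = a * integral {0..1} (\<lambda>x. f x * wave n x) + b * integral {0..1} (\<lambda>x. g x * wave n x)"
    using i[OF c(1)] i[OF c(2)] by (subst integral_add) (auto intro: integrable_on_mult_right)
  finally show "integral {0..1} (\<lambda>x. (a * f x + b * g x) * wave n x) = 0"
    using assms by (simp add: fourier_null_def)
qed

lemma fourier_null_shift:
  assumes "fourier_null f"
  shows "fourier_null (\<lambda>x. f x * wave k x)"
  unfolding fourier_null_def
proof (intro conjI allI)
  show "continuous_on UNIV (\<lambda>x. f x * wave k x)"
    using assms by (intro continuous_intros) (auto simp: fourier_null_def)
  fix n :: int
  have "(\<lambda>x. f x * wave k x * wave n x) = (\<lambda>x. f x * wave (k + n) x)"
    by (simp add: cis_mult mult.assoc ring_distribs)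
  then show "integral {0..1} (\<lambda>x. f x * wave k x * wave n x) = 0"
    using assms by (simp only: fourier_null_def)
qed

text \<open>On the circle a real-linear function is a combination of \<open>wave 1\<close> and
  \<open>wave (-1)\<close>, which only shift Fourier coefficients. Keeping h arbitrary in the
  induction lets a product be treated by two successive multiplications.\<close>

lemma fourier_null_real_polynomial:
  assumes "real_polynomial_function p" "fourier_null h"
  shows "fourier_null (\<lambda>x. h x * of_real (p (cis (2 * pi * x))))"
  using assms
proof (induction arbitrary: h rule: real_polynomial_function.induct)
  case (linear f)
  have f: "f z = Re z * f 1 + Im z * f \<i>" for z
  proof -
    note lin = bounded_linear.linear[OF linear.hyps]
    have "z = Re z *\<^sub>R 1 + Im z *\<^sub>R \<i>" by (simp add: complex_eq_iff)
    then have "f z = f (Re z *\<^sub>R 1 + Im z *\<^sub>R \<i>)" by (rule arg_cong)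
    also have "\<dots> = Re z * f 1 + Im z * f \<i>"
      by (simp only: linear_add[OF lin] linear_cmul[OF lin] real_scaleR_def)
    finally show ?thesis .
  qed
  have "h x * of_real (f (cis (2 * pi * x)))
      = (of_real (f 1) / 2 - \<i> * of_real (f \<i>) / 2) * (h x * wave 1 x)
        + (of_real (f 1) / 2 + \<i> * of_real (f \<i>) / 2) * (h x * wave (-1) x)" for x
  proof -
    let ?y = "2 * pi * x"
    have c: "complex_of_real (cos ?y) = (cis ?y + cis (- ?y)) / 2" by (simp add: complex_eq_iff)
    have s: "complex_of_real (sin ?y) = - (\<i> / 2) * (cis ?y - cis (- ?y))" by (simp add: complex_eq_iff)
    have "complex_of_real (f (cis ?y)) = of_real (cos ?y) * of_real (f 1) + of_real (sin ?y) * of_real (f \<i>)"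
      by (simp add: f[of "cis _"])
    then have e: "complex_of_real (f (cis ?y)) = (of_real (f 1) / 2 - \<i> * of_real (f \<i>) / 2) * cis ?y
        + (of_real (f 1) / 2 + \<i> * of_real (f \<i>) / 2) * cis (- ?y)"
      unfolding c s by (simp add: algebra_simps add_divide_distrib diff_divide_distrib)
    have "h x * of_real (f (cis ?y)) = (of_real (f 1) / 2 - \<i> * of_real (f \<i>) / 2) * (h x * cis ?y)
        + (of_real (f 1) / 2 + \<i> * of_real (f \<i>) / 2) * (h x * cis (- ?y))"
      unfolding e by (simp only: ring_distribs mult_ac)
    then show ?thesis by simp
  qed
  then show ?case using fourier_null_lincomb fourier_null_shift linear.prems by presburger
next
  case (const c)
  then show ?case using fourier_null_lincomb[of h h c 0] by (simp add: mult.commute)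
next
  case (add f g)
  then show ?case
    using fourier_null_lincomb[of "\<lambda>x. h x * of_real (f (cis (2 * pi * x)))" "\<lambda>x. h x * of_real (g (cis (2 * pi * x)))" 1 1]
    by (simp add: ring_distribs)
next
  case (mult f g)
  then show ?case using mult.IH(2)[OF mult.IH(1)[OF mult.prems]] by (simp add: mult_ac)
qed

lemma periodic_shift_int:
  fixes h :: "real \<Rightarrow> 'a"
  assumes per: "\<And>x. h (x + 1) = h x"
  shows "h (x + of_int k) = h x"
proof -
  have nat: "h (x + of_nat m) = h x" for x m
    by (induction m) (use per[of "x + of_nat _"] in \<open>auto simp: add_ac\<close>)
  show ?thesis
  proof (cases "k \<ge> 0")
    case True
    then show ?thesis using nat[of x "nat k"] by simp
  next
    case False
    then show ?thesis using nat[of "x + of_int k" "nat (-k)"] by simp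
  qed
qed

text \<open>A continuous periodic function descends to the unit circle: read it off the principal
  argument away from the negative axis, and off the argument of the antipode near it.\<close>

lemma continuous_on_circle_lift:
  fixes h :: "real \<Rightarrow> complex"
  assumes cont: "continuous_on UNIV h" and per: "\<And>x. h (x + 1) = h x"
  obtains H where "continuous_on (sphere 0 1) H" "\<And>x. H (cis (2 * pi * x)) = h x"
proof
  define H where "H = (\<lambda>z. h (Im (Ln z) / (2 * pi)))"
  have eq: "h x = h y" if "cis (2 * pi * x) = cis (2 * pi * y)" for x y
  proof -
    have "exp (\<i> * of_real (2 * pi * x)) = exp (\<i> * of_real (2 * pi * y))" using that by (simp add: cis_conv_exp)
    then obtain n :: int where "\<i> * of_real (2 * pi * x) = \<i> * of_real (2 * pi * y) + of_int (2 * n) * pi * \<i>"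
      unfolding exp_eq by blast
    then have "Im (\<i> * of_real (2 * pi * x)) = Im (\<i> * of_real (2 * pi * y) + of_int (2 * n) * pi * \<i>)" by (rule arg_cong)
    then have "2 * pi * x = 2 * pi * (y + of_int n)" by (simp add: algebra_simps)
    then have "x = y + of_int n" by simp
    then show ?thesis using periodic_shift_int[of h y n] per by simp
  qed
  have cisLn: "cis (Im (Ln z)) = z" if "norm z = 1" for z
  proof -
    have z0: "z \<noteq> 0" using that by auto
    have "\<i> * of_real (Im (Ln z)) = Ln z" using z0 that by (simp add: complex_eq_iff)
    then show ?thesis using exp_Ln[OF z0] by (simp add: cis_conv_exp)
  qed
  have H: "H (cis (2 * pi * x)) = h x" for x
    unfolding H_def by (rule eq) (simp add: cisLn)
  show "H (cis (2 * pi * x)) = h x" for x by (rule H)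
  have hc: "isCont h x" for x using cont by (simp add: continuous_on_eq_continuous_at)
  have H2: "H z = h (Im (Ln (-z)) / (2 * pi) + 1 / 2)" if "norm z = 1" for z
  proof -
    have "cis (2 * pi * (Im (Ln (-z)) / (2 * pi) + 1 / 2)) = cis (Im (Ln (-z)) + pi)" by (simp add: algebra_simps)
    also have "\<dots> = z" using cisLn[of "-z"] that by (simp flip: cis_mult)
    finally show ?thesis using H by metis
  qed
  show "continuous_on (sphere 0 1) H"
    unfolding continuous_on_eq_continuous_within
  proof
    fix z :: complex assume z: "z \<in> sphere 0 1"
    show "continuous (at z within sphere 0 1) H"
    proof (cases "z \<in> \<real>\<^sub>\<le>\<^sub>0")
      case False
      have "isCont (\<lambda>z. h (Im (Ln z) / (2 * pi))) z"
        by (rule isCont_o2[OF _ hc]) (intro continuous_intros, use False in auto)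
      then show ?thesis unfolding H_def by (rule continuous_at_imp_continuous_at_within)
    next
      case True
      have "z \<noteq> 0" using z by auto
      then have "-z \<notin> \<real>\<^sub>\<le>\<^sub>0" using True by (auto simp: complex_nonpos_Reals_iff complex_eq_iff)
      then have "isCont (\<lambda>z. h (Im (Ln (-z)) / (2 * pi) + 1 / 2)) z"
        by (intro isCont_o2[OF _ hc] continuous_intros) auto
      then have "continuous (at z within sphere 0 1) (\<lambda>z. h (Im (Ln (-z)) / (2 * pi) + 1 / 2))"
        by (rule continuous_at_imp_continuous_at_within)
      then show ?thesis
        by (rule continuous_transform_within[OF _ zero_less_one]) (use z H2 in auto)
    qed
  qed
qed

text \<open>Stone-Weierstrass approximates the conjugate of h on the circle by a polynomial g up to
  e. Since h g integrates to 0, the integral of |h|^2 is that of h (conj h - g), at most B e; so it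
  is 0 and h vanishes by continuity.\<close>

lemma fourier_null_imp_0:
  assumes null: "fourier_null h" and per: "\<And>x. h (x + 1) = h x"
  shows "h x = 0"
proof -
  have cont: "continuous_on UNIV h" using null by (simp add: fourier_null_def)
  then have cont': "continuous_on A h" for A using continuous_on_subset by blast
  obtain H where H: "continuous_on (sphere 0 1) H" "\<And>x. H (cis (2 * pi * x)) = h x"
    using continuous_on_circle_lift[OF cont per] by metis
  have poly: "fourier_null (\<lambda>x. h x * p (cis (2 * pi * x)))" if "polynomial_function p" for p :: "complex \<Rightarrow> complex"
  proof -
    have "real_polynomial_function (\<lambda>z. Re (p z))" "real_polynomial_function (\<lambda>z. Im (p z))"
      using that bounded_linear_Re bounded_linear_Im by (auto simp: polynomial_function_def o_def)
    then have "fourier_null (\<lambda>x. 1 * (h x * of_real (Re (p (cis (2 * pi * x))))) + \<i> * (h x * of_real (Im (p (cis (2 * pi * x))))))"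
      by (intro fourier_null_lincomb fourier_null_real_polynomial[OF _ null])
    moreover have "1 * (a * of_real (Re w)) + \<i> * (a * of_real (Im w)) = a * w" for a w :: complex
      by (simp add: complex_eq_iff)
    ultimately show ?thesis by (simp only:)
  qed
  obtain B where B: "B > 0" "\<And>x. x \<in> {0..1} \<Longrightarrow> norm (h x) \<le> B"
  proof -
    have "bounded (h ` {0..1})" by (intro compact_imp_bounded compact_continuous_image cont') auto
    then show ?thesis using that unfolding bounded_pos by auto
  qed
  have small: "norm (integral {0..1} (\<lambda>x. h x * cnj (h x))) \<le> B * e" if e: "e > 0" for e
  proof -
    obtain g where g: "polynomial_function g" "\<And>z. z \<in> sphere 0 1 \<Longrightarrow> norm (cnj (H z) - g z) < e"
      using Stone_Weierstrass_polynomial_function[of "sphere 0 1" "\<lambda>z. cnj (H z)" e] H(1) e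
      by (metis compact_sphere continuous_on_cnj)
    have gn: "fourier_null (\<lambda>x. h x * g (cis (2 * pi * x)))" by (rule poly[OF g(1)])
    have c1: "continuous_on {0..1} (\<lambda>x. h x * g (cis (2 * pi * x)))"
      using gn continuous_on_subset by (auto simp: fourier_null_def)
    have c2: "continuous_on {0..1} (\<lambda>x. h x * cnj (h x))" by (intro continuous_intros cont')
    have "integral {0..1} (\<lambda>x. h x * g (cis (2 * pi * x)) * wave 0 x) = 0"
      using gn unfolding fourier_null_def by blast
    then have "integral {0..1} (\<lambda>x. h x * g (cis (2 * pi * x))) = 0" by simp
    then have "integral {0..1} (\<lambda>x. h x * cnj (h x)) = integral {0..1} (\<lambda>x. h x * cnj (h x) - h x * g (cis (2 * pi * x)))"
      using c1 c2 by (subst integral_diff) (auto intro: integrable_continuous_real)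
    also have "norm \<dots> \<le> B * e * (1 - 0)"
    proof (rule integral_bound)
      fix x :: real assume x: "x \<in> {0..1}"
      have "norm (cnj (H (cis (2 * pi * x))) - g (cis (2 * pi * x))) \<le> e" by (intro less_imp_le g) simp
      then have "norm (h x) * norm (cnj (h x) - g (cis (2 * pi * x))) \<le> B * e"
        using B(2)[OF x] B(1) H(2) by (intro mult_mono) auto
      then show "norm (h x * cnj (h x) - h x * g (cis (2 * pi * x))) \<le> B * e"
        by (simp add: norm_mult[symmetric] right_diff_distrib)
    qed (use c1 c2 in \<open>auto intro!: continuous_intros\<close>)
    finally show ?thesis by simp
  qed
  have "integral {0..1} (\<lambda>x. h x * cnj (h x)) = 0"
  proof (rule ccontr)
    assume "integral {0..1} (\<lambda>x. h x * cnj (h x)) \<noteq> 0"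
    then have n: "norm (integral {0..1} (\<lambda>x. h x * cnj (h x))) > 0" by simp
    then show False using small[of "norm (integral {0..1} (\<lambda>x. h x * cnj (h x))) / (2 * B)"] B(1) by simp
  qed
  moreover have cn: "continuous_on {0..1} (\<lambda>x. (norm (h x))^2)" by (intro continuous_intros cont')
  then have "integral {0..1} (complex_of_real \<circ> (\<lambda>x. (norm (h x))^2)) = of_real (integral {0..1} (\<lambda>x. (norm (h x))^2))"
    by (intro integral_linear bounded_linear_of_real integrable_continuous_real)
  moreover have "(complex_of_real \<circ> (\<lambda>x. (norm (h x))^2)) = (\<lambda>x. h x * cnj (h x))"
    unfolding o_def complex_norm_square ..
  ultimately have "integral {0..1} (\<lambda>x. (norm (h x))^2) = 0" by simp
  with cn have "\<forall>x\<in>{0..1}. (norm (h x))^2 = 0"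
    by (subst integral_eq_0_iff[symmetric]) auto
  then have h0: "h x = 0" if "x \<in> {0..1}" for x using that by auto
  have "h x = h (frac x + of_int \<lfloor>x\<rfloor>)" by (simp add: frac_def)
  also have "\<dots> = h (frac x)" by (rule periodic_shift_int[of h, OF per])
  also have "\<dots> = 0" by (rule h0) (simp add: frac_lt_1 less_imp_le)
  finally show ?thesis .
qed

section \<open>Periodisation and the Poisson summation formula\<close>

lemma summable_on_int_inverse_square:
  "(\<lambda>n::int. C / (1 + (of_int n)^2 :: real)) summable_on UNIV"
proof -
  have *: "summable (\<lambda>n. norm (1 / (1 + (real n)^2)))"
  proof (rule summable_comparison_test')
    show "summable (\<lambda>n. 1 / (real n)^2)" using inverse_power_summable[of 2] by (simp add: inverse_eq_divide)
    show "norm (norm (1 / (1 + (real n)^2))) \<le> 1 / (real n)^2" if "n \<ge> 1" for n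
      using that by (auto intro!: divide_left_mono mult_pos_pos add_pos_nonneg)
  qed
  have 1: "(\<lambda>n. 1 / (1 + (real n)^2)) summable_on UNIV" by (rule norm_summable_imp_summable_on[OF *])
  have 2: "(\<lambda>n. 1 / (1 + (real (Suc n))^2)) summable_on UNIV"
    by (rule norm_summable_imp_summable_on) (use summable_ignore_initial_segment[OF *, of 1] in simp)
  have "(\<lambda>n::int. 1 / (1 + (of_int n)^2 :: real)) summable_on (range int \<union> range (\<lambda>n. - int (Suc n)))"
    by (rule summable_on_Un_disjoint)
       (use 1 2 in \<open>auto simp: summable_on_reindex inj_on_def o_def algebra_simps power2_eq_square\<close>)
  also have "range int \<union> range (\<lambda>n. - int (Suc n)) = UNIV"
  proof -
    have "x \<in> range int \<union> range (\<lambda>n. - int (Suc n))" for x by (cases x) auto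
    then show ?thesis by blast
  qed
  finally show ?thesis using summable_on_cmult_right[of "\<lambda>n::int. 1 / (1 + (of_int n)^2 :: real)" UNIV C] by simp
qed

text \<open>Links integrals over the line to symmetric intervals, which can be tiled by unit
  intervals, reflected, and differentiated under the integral sign.\<close>

lemma has_integral_UNIV_imp_symmetric_limit:
  fixes G :: "real \<Rightarrow> 'a::banach"
  assumes "(G has_integral I) UNIV"
  shows "(\<lambda>N. integral {- real N..real N} G) \<longlonglongrightarrow> I"
proof (rule LIMSEQ_I)
  fix e :: real assume "e > 0"
  then obtain B where B: "B > 0" "\<And>a b. ball 0 B \<subseteq> cbox a b \<Longrightarrow> norm (integral (cbox a b) G - I) < e"
    using assms unfolding has_integral_alt'[of G I UNIV] by auto
  show "\<exists>no. \<forall>n\<ge>no. norm (integral {- real n..real n} G - I) < e"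
  proof (intro exI allI impI)
    fix n assume "n \<ge> nat \<lceil>B\<rceil>"
    then have "B \<le> real n" by linarith
    then have "ball 0 B \<subseteq> cbox (- real n) (real n)" by (auto simp: dist_norm)
    from B(2)[OF this] show "norm (integral {- real n..real n} G - I) < e" by simp
  qed
qed

text \<open>The inequality 0 <= (n + 2x)^2 says n^2 <= 2 (n+x)^2 + 2 x^2. This gives a majorant
  uniform in bounded x for the Weierstrass test.\<close>

lemma inverse_square_shift_bound:
  fixes n x R :: real
  assumes "\<bar>x\<bar> \<le> R"
  shows "1 / (1 + (n + x)^2) \<le> (2 + 2 * R^2) / (1 + n^2)"
proof -
  have "x^2 \<le> R^2" using power_mono[OF assms, of 2] by simp
  moreover have "0 \<le> (n + 2 * x)^2" by simp
  ultimately have "n^2 \<le> 2 * (n + x)^2 + 2 * R^2" by (simp add: power2_eq_square algebra_simps)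
  moreover have "0 \<le> R^2 * (n + x)^2" by simp
  moreover have "(2 + 2 * R^2) * (1 + (n + x)^2) = 2 + 2 * R^2 + 2 * (n + x)^2 + 2 * (R^2 * (n + x)^2)"
    by (simp add: algebra_simps)
  ultimately have "1 + n^2 \<le> (2 + 2 * R^2) * (1 + (n + x)^2)"
    by linarith
  then show ?thesis by (simp add: divide_simps add_pos_nonneg)
qed

lemma uniform_limit_sum_shifts:
  fixes F :: "real \<Rightarrow> complex"
  assumes bound: "\<And>x. norm (F x) \<le> C / (1 + x^2)"
  shows "uniform_limit {-R..R} (\<lambda>X x. \<Sum>n\<in>X. F (of_int n + x)) (\<lambda>x. \<Sum>\<^sub>\<infinity>n::int. F (of_int n + x)) (finite_subsets_at_top UNIV)"
proof (rule Weierstrass_m_test_general)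
  show "(\<lambda>n::int. C * (2 + 2 * R^2) / (1 + (of_int n)^2)) summable_on UNIV"
    by (rule summable_on_int_inverse_square)
  have "0 \<le> C" using order_trans[OF norm_ge_zero bound[of 0]] by simp
  fix n :: int and x :: real assume "x \<in> {-R..R}"
  then have "\<bar>x\<bar> \<le> R" by auto
  from mult_left_mono[OF inverse_square_shift_bound[OF this, of "of_int n"] \<open>0 \<le> C\<close>]
  show "norm (F (of_int n + x)) \<le> C * (2 + 2 * R^2) / (1 + (of_int n)^2)"
    using bound[of "of_int n + x"] by simp
qed

lemma integral_cis_int: "integral {0..1} (\<lambda>x. wave k x) = (if k = 0 then 1 else 0)"
proof (cases "k = 0")
  case False
  let ?c = "\<i> * (2 * pi * of_int k)"
  have c: "?c \<noteq> 0" using False by simp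
  have "((\<lambda>x. wave k x) has_integral (wave k 1 / ?c - wave k 0 / ?c)) {0..1}"
  proof (rule fundamental_theorem_of_calculus)
    fix x :: real
    have "((\<lambda>x. exp (\<i> * of_real (2 * pi * of_int k * x)) / ?c) has_vector_derivative
        exp (\<i> * of_real (2 * pi * of_int k * x))) (at x within {0..1})"
      using c by (auto intro!: derivative_eq_intros has_vector_derivative_real_field simp: field_simps)
    then show "((\<lambda>x. wave k x / ?c) has_vector_derivative wave k x) (at x within {0..1})"
      unfolding cis_conv_exp .
  qed simp
  moreover have "wave k 1 = 1" using cis_multiple_2pi[of "of_int k"] by simp
  ultimately show ?thesis using False by (auto dest: integral_unique)
qed simp

lemma has_integral_cis_int: "((\<lambda>x. wave k x) has_integral (if k = 0 then 1 else 0)) {0..1}"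
proof -
  have "(\<lambda>x. wave k x) integrable_on {0..1}"
    by (intro integrable_continuous_real continuous_intros)
  from integrable_integral[OF this] show ?thesis by (simp only: integral_cis_int)
qed

text \<open>The periodisation f of F and the Fourier series g with coefficients G are continuous,
  1-periodic and have the same Fourier coefficients, so f - g is null. Decay is assumed on both
  sides so that both series converge uniformly and can be integrated term by term.\<close>

lemma poisson_summation:
  fixes F :: "real \<Rightarrow> complex" and G :: "int \<Rightarrow> complex"
  assumes cont: "continuous_on UNIV F"
    and bound: "\<And>x. norm (F x) \<le> C / (1 + x^2)"
    and ft: "\<And>n::int. ((\<lambda>x. F x * cis (- (2 * pi * of_int n * x))) has_integral G n) UNIV"
    and bound': "\<And>n. norm (G n) \<le> C' / (1 + (of_int n)^2)"
  shows "\<exists>S. ((\<lambda>n::int. F (of_int n + a)) has_sum S) UNIV \<and> ((\<lambda>n. G n * wave n a) has_sum S) UNIV"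
proof -
  define f where "f = (\<lambda>x. \<Sum>\<^sub>\<infinity>n::int. F (of_int n + x))"
  define g where "g = (\<lambda>x. \<Sum>\<^sub>\<infinity>n::int. G n * wave n x)"
  note ul_f = uniform_limit_sum_shifts[OF bound, folded f_def]
  have ul_g: "uniform_limit UNIV (\<lambda>X x. \<Sum>n\<in>X. G n * wave n x) g (finite_subsets_at_top UNIV)"
    unfolding g_def
    by (rule Weierstrass_m_test_general[OF _ summable_on_int_inverse_square[of C']]) (use bound' in \<open>simp add: norm_mult\<close>)
  have contF: "continuous_on A (\<lambda>x. F (c + x))" for A c
    by (rule continuous_on_compose2[OF cont]) (auto intro!: continuous_intros)
  have cf: "continuous_on {-R..R} f" for R
    by (rule uniform_limit_theorem[OF _ ul_f]) (auto intro!: always_eventually continuous_intros contF)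
  have cf': "continuous_on UNIV f"
  proof -
    have "isCont f x" for x
    proof (rule continuous_on_interior[OF cf[of "\<bar>x\<bar> + 1"]])
      show "x \<in> interior {- (\<bar>x\<bar> + 1)..\<bar>x\<bar> + 1}" by (simp add: abs_real_def)
    qed
    then show ?thesis by (simp add: continuous_on_eq_continuous_at)
  qed
  have cg: "continuous_on UNIV g"
    by (rule uniform_limit_theorem[OF _ ul_g]) (auto intro!: always_eventually continuous_intros)
  have per_f: "f (x + 1) = f x" for x
  proof -
    have bij: "bij_betw (\<lambda>n::int. n + 1) UNIV UNIV" by (rule bij_betwI[of _ _ _ "\<lambda>n. n - 1"]) auto
    have "f (x + 1) = (\<Sum>\<^sub>\<infinity>n::int. F (of_int (n + 1) + x))" by (simp add: f_def add_ac)
    also have "\<dots> = f x" unfolding f_def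
      by (rule infsum_reindex_bij_betw[OF bij, of "\<lambda>n. F (of_int n + x)"])
    finally show ?thesis .
  qed
  have per_g: "g (x + 1) = g x" for x
  proof -
    have "wave n (x + 1) = wave n x" for n :: int
    proof -
      have "wave n (x + 1) = wave n x * cis (2 * pi * of_int n)"
        unfolding cis_mult by (simp add: ring_distribs)
      also have "cis (2 * pi * of_int n) = 1" by (rule cis_multiple_2pi) simp
      finally show ?thesis by simp
    qed
    then show ?thesis by (simp add: g_def)
  qed
  \<comment> \<open>Termwise integration replaces one period of f by the integral of F over the
    line. The transform uses the opposite sign in the exponent, hence the argument -m.\<close>
  have coef_f: "((\<lambda>x. f x * wave m x) has_integral G (-m)) {0..1}" for m
  proof -
    have "uniform_limit {0..1} (\<lambda>X x. \<Sum>n\<in>X. F (of_int n + x)) f (finite_subsets_at_top UNIV)"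
      using ul_f[of 1] by (rule uniform_limit_on_subset) auto
    then have "uniform_limit {0..1} (\<lambda>X x. (\<Sum>n\<in>X. F (of_int n + x)) * wave m x) (\<lambda>x. f x * wave m x) (finite_subsets_at_top UNIV)"
    proof (rule uniform_lim_mult[OF _ uniform_limit_const])
      show "bounded (f ` {0..1})" by (intro compact_imp_bounded compact_continuous_image continuous_on_subset[OF cf']) auto
      show "bounded ((\<lambda>x. wave m x) ` {0..1::real})" by (rule boundedI[of _ 1]) auto
    qed
    then obtain I J where IJ: "\<And>X. ((\<lambda>x. (\<Sum>n\<in>X. F (of_int n + x)) * wave m x) has_integral I X) {0..1}"
       "((\<lambda>x. f x * wave m x) has_integral J) {0..1}" "(I \<longlongrightarrow> J) (finite_subsets_at_top UNIV)"
      by (rule uniform_limit_integral) (auto intro!: continuous_intros contF)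
    have int: "(\<lambda>x. F x * wave m x) integrable_on {u..v}" for u v
      by (intro integrable_continuous_real continuous_intros continuous_on_subset[OF cont]) auto
    have piece: "((\<lambda>x. F (of_int n + x) * wave m x) has_integral integral {of_int n..of_int n + 1} (\<lambda>x. F x * wave m x)) {0..1}" for n
    proof -
      have "((\<lambda>x. F x * wave m x) has_integral integral {of_int n..of_int n + 1} (\<lambda>x. F x * wave m x)) (cbox (of_int n) (of_int n + 1))"
        using int by (simp add: integrable_integral)
      from has_integral_affinity[OF this, of 1 "of_int n"]
      have "((\<lambda>x. F (x + of_int n) * wave m (x + of_int n)) has_integral integral {of_int n..of_int n + 1} (\<lambda>x. F x * wave m x)) {0..1}"
        by (simp add: image_affinity_cbox)
      moreover have "wave m (x + of_int n) = wave m x" for x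
      proof -
        have "wave m (x + of_int n) = wave m x * cis (2 * pi * of_int (m * n))"
          unfolding cis_mult by (simp add: ring_distribs mult.assoc)
        also have "cis (2 * pi * of_int (m * n)) = 1" by (rule cis_multiple_2pi) simp
        finally show ?thesis by simp
      qed
      ultimately show ?thesis by (simp add: add.commute)
    qed
    have I: "I X = (\<Sum>n\<in>X. integral {of_int n..of_int n + 1} (\<lambda>x. F x * wave m x))" if "finite X" for X
    proof (rule has_integral_unique[OF IJ(1)])
      show "((\<lambda>x. (\<Sum>n\<in>X. F (of_int n + x)) * wave m x) has_integral (\<Sum>n\<in>X. integral {of_int n..of_int n + 1} (\<lambda>x. F x * wave m x))) {0..1}"
        unfolding sum_distrib_right by (rule has_integral_sum[OF that piece])
    qed
    \<comment> \<open>The range is half-open because the intervals [n, n+1] with -N <= n < N tile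
      [-N, N] exactly.\<close>
    have "filterlim (\<lambda>N. {- int N..<int N}) (finite_subsets_at_top UNIV) sequentially"
      unfolding filterlim_finite_subsets_at_top
    proof (intro allI impI)
      fix X :: "int set" assume X: "finite X \<and> X \<subseteq> UNIV"
      define M where "M = Max (insert 0 (abs ` X))"
      have M: "\<bar>x\<bar> \<le> M" if "x \<in> X" for x unfolding M_def using X that by (intro Max_ge) auto
      show "\<forall>\<^sub>F N in sequentially. finite {- int N..<int N} \<and> X \<subseteq> {- int N..<int N} \<and> {- int N..<int N} \<subseteq> UNIV"
        using eventually_gt_at_top[of "nat M"] by eventually_elim (use M in \<open>fastforce\<close>)
    qed
    then have L1: "(\<lambda>N. I {- int N..<int N}) \<longlonglongrightarrow> J" using IJ(3) filterlim_compose by blast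
    have IN: "I {- int N..<int N} = integral {- real N..real N} (\<lambda>x. F x * wave m x)" for N
    proof -
      have "(\<Sum>n\<in>{- int N..<int N}. integral {of_int n..of_int n + 1} (\<lambda>x. F x * wave m x))
        = integral {- real N..real N} (\<lambda>x. F x * wave m x)"
      proof (induction N)
        case (Suc N)
        let ?H = "\<lambda>x. F x * wave m x"
        have "{- int (Suc N)..<int (Suc N)} = insert (- int N - 1) (insert (int N) {- int N..<int N})" by auto
        then have "(\<Sum>n\<in>{- int (Suc N)..<int (Suc N)}. integral {of_int n..of_int n + 1} ?H)
          = integral {- real N - 1..- real N} ?H + (integral {real N..real N + 1} ?H + (\<Sum>n\<in>{- int N..<int N}. integral {of_int n..of_int n + 1} ?H))"
          by simp
        also note Suc.IH
        also have "integral {real N..real N + 1} ?H + integral {- real N..real N} ?H = integral {- real N..real N + 1} ?H"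
          using Henstock_Kurzweil_Integration.integral_combine[OF _ _ int, of "- real N" "real N" "real N + 1"] by (simp add: add.commute)
        also have "integral {- real N - 1..- real N} ?H + integral {- real N..real N + 1} ?H = integral {- real N - 1..real N + 1} ?H"
          using Henstock_Kurzweil_Integration.integral_combine[OF _ _ int, of "- real N - 1" "- real N" "real N + 1"] by simp
        finally have *: "(\<Sum>n\<in>{- int (Suc N)..<int (Suc N)}. integral {of_int n..of_int n + 1} ?H) = integral {- real N - 1..real N + 1} ?H" .
        have e: "- (real N + 1) = - real N - 1" "real (Suc N) = real N + 1" by simp_all
        show ?case unfolding e(2) e(1) by (rule *)
      qed simp
      then show ?thesis using I[of "{- int N..<int N}"] by simp
    qed
    have "((\<lambda>x. F x * wave m x) has_integral G (-m)) UNIV" using ft[of "-m"] by simp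
    from has_integral_UNIV_imp_symmetric_limit[OF this]
    have "J = G (-m)" using L1 unfolding IN by (rule LIMSEQ_unique[symmetric])
    then show ?thesis using IJ(2) by simp
  qed
  have coef_g: "((\<lambda>x. g x * wave m x) has_integral G (-m)) {0..1}" for m
  proof -
    have "uniform_limit {0..1} (\<lambda>X x. \<Sum>n\<in>X. G n * wave n x) g (finite_subsets_at_top UNIV)"
      using ul_g by (rule uniform_limit_on_subset) auto
    then have "uniform_limit {0..1} (\<lambda>X x. (\<Sum>n\<in>X. G n * wave n x) * wave m x) (\<lambda>x. g x * wave m x) (finite_subsets_at_top UNIV)"
    proof (rule uniform_lim_mult[OF _ uniform_limit_const])
      show "bounded (g ` {0..1})" by (intro compact_imp_bounded compact_continuous_image continuous_on_subset[OF cg]) auto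
      show "bounded ((\<lambda>x. wave m x) ` {0..1::real})" by (rule boundedI[of _ 1]) auto
    qed
    then obtain I J where IJ: "\<And>X. ((\<lambda>x. (\<Sum>n\<in>X. G n * wave n x) * wave m x) has_integral I X) {0..1}"
       "((\<lambda>x. g x * wave m x) has_integral J) {0..1}" "(I \<longlongrightarrow> J) (finite_subsets_at_top UNIV)"
      by (rule uniform_limit_integral) (auto intro!: continuous_intros)
    have piece: "((\<lambda>x. G n * wave n x * wave m x) has_integral (if n = -m then G n else 0)) {0..1}" for n
    proof -
      have 1: "G n * wave (n + m) x = G n * wave n x * wave m x" for x
        unfolding mult.assoc[of "G n"] cis_mult by (simp add: ring_distribs)
      have 2: "G n * (if n + m = 0 then 1 else 0) = (if n = - m then G n else 0)"
        by (simp add: eq_neg_iff_add_eq_0)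
      from has_integral_mult_right[OF has_integral_cis_int[of "n + m"], of "G n"] show ?thesis
        unfolding 1 2 .
    qed
    have I: "I X = (\<Sum>n\<in>X. if n = -m then G n else 0)" if "finite X" for X
    proof (rule has_integral_unique[OF IJ(1)])
      show "((\<lambda>x. (\<Sum>n\<in>X. G n * wave n x) * wave m x) has_integral (\<Sum>n\<in>X. if n = -m then G n else 0)) {0..1}"
        unfolding sum_distrib_right by (rule has_integral_sum[OF that piece])
    qed
    have "\<forall>\<^sub>F X in finite_subsets_at_top UNIV. I X = G (-m)"
      unfolding eventually_finite_subsets_at_top by (rule exI[of _ "{-m}"]) (auto simp: I)
    then have "(I \<longlongrightarrow> G (-m)) (finite_subsets_at_top UNIV)" by (rule tendsto_eventually)
    then have "J = G (-m)" by (rule tendsto_unique[OF finite_subsets_at_top_neq_bot IJ(3)])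
    then show ?thesis using IJ(2) by simp
  qed
  have "fourier_null (\<lambda>x. f x - g x)"
    unfolding fourier_null_def
  proof (intro conjI allI)
    show "continuous_on UNIV (\<lambda>x. f x - g x)" by (intro continuous_intros cf' cg)
    show "integral {0..1} (\<lambda>x. (f x - g x) * wave n x) = 0" for n :: int
      using has_integral_diff[OF coef_f[of n] coef_g[of n]] by (simp add: left_diff_distrib integral_unique)
  qed
  then have "f a - g a = 0" by (rule fourier_null_imp_0) (simp add: per_f per_g)
  moreover have "((\<lambda>n::int. F (of_int n + a)) has_sum f a) UNIV"
    using tendsto_uniform_limitI[OF ul_f[of "\<bar>a\<bar>"], of a] by (simp add: has_sum_def abs_if)
  moreover have "((\<lambda>n. G n * wave n a) has_sum g a) UNIV"
    using tendsto_uniform_limitI[OF ul_g, of a] by (simp add: has_sum_def)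
  ultimately show ?thesis by auto
qed

section \<open>Theta functions\<close>

text \<open>The known characteristic function of the standard normal distribution, rescaled.\<close>

lemma gaussian_fourier_integral:
  assumes t: "t > 0"
  shows "((\<lambda>x. of_real (exp (- pi * t * x^2)) * cis (- (2 * pi * of_int n * x))) has_integral
          of_real (exp (- pi * (of_int n)^2 / t) / sqrt t)) UNIV"
proof -
  \<comment> \<open>Chosen so that (c x)^2 / 2 = pi t x^2; then u is fixed by u c x = -2 pi n
    x.\<close>
  define c where "c = sqrt (2 * pi * t)"
  have c: "c > 0" "c^2 = 2 * pi * t" using t by (auto simp: c_def)
  define u where "u = - (2 * pi * of_int n / c)"
  define f where "f = (\<lambda>x::real. complex_of_real (std_normal_density x) * iexp (u * x))"
  have "integrable std_normal_distribution (\<lambda>x. iexp (u * x))"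
    by (rule prob_space.integrable_iexp) (auto simp: prob_space_normal_density)
  then have int: "integrable lborel f"
    unfolding f_def by (subst (asm) integrable_density) (auto simp: scaleR_conv_of_real)
  have "exp (- (u^2) / 2) = (CLINT x|std_normal_distribution. iexp (u * x))"
    using char_std_normal_distribution unfolding char_def by metis
  also have "\<dots> = integral\<^sup>L lborel f"
    unfolding f_def by (subst integral_density) (auto simp: scaleR_conv_of_real)
  finally have val: "integral\<^sup>L lborel f = of_real (exp (- (u^2) / 2))" by simp
  have int': "integrable lborel (\<lambda>x. f (0 + c * x))"
    using int c by (subst lborel_integrable_real_affine_iff) auto
  have "integral\<^sup>L lborel f = \<bar>c\<bar> *\<^sub>R integral\<^sup>L lborel (\<lambda>x. f (0 + c * x))"
    by (rule lborel_integral_real_affine) (use c in auto)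
  then have "integral\<^sup>L lborel (\<lambda>x. f (0 + c * x)) = of_real (exp (- (u^2) / 2) / c)"
    using val c by (simp add: scaleR_conv_of_real field_simps)
  with has_integral_integral_lborel[OF int']
  have "((\<lambda>x. f (0 + c * x)) has_integral of_real (exp (- (u^2) / 2) / c)) UNIV" by simp
  from has_integral_mult_right[OF this, of "of_real (sqrt (2 * pi))"]
  have "((\<lambda>x. of_real (sqrt (2 * pi)) * f (0 + c * x)) has_integral of_real (sqrt (2 * pi) * (exp (- (u^2) / 2) / c))) UNIV"
    by simp
  moreover have "of_real (sqrt (2 * pi)) * f (0 + c * x) = of_real (exp (- pi * t * x^2)) * cis (- (2 * pi * of_int n * x))" for x
  proof -
    have 1: "sqrt (2 * pi) * std_normal_density (c * x) = exp (- pi * t * x^2)"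
      using c(2) by (simp add: std_normal_density_def power_mult_distrib)
    have 2: "u * (c * x) = - (2 * pi * of_int n * x)" using c by (simp add: u_def)
    have "of_real (sqrt (2 * pi)) * f (0 + c * x) = of_real (sqrt (2 * pi) * std_normal_density (c * x)) * cis (u * (c * x))"
      by (simp add: f_def cis_conv_exp)
    then show ?thesis unfolding 1 2 .
  qed
  moreover have "sqrt (2 * pi) * (exp (- (u^2) / 2) / c) = exp (- pi * (of_int n)^2 / t) / sqrt t"
  proof -
    have "u^2 / 2 = pi * (of_int n)^2 / t"
      using t c(2) by (simp add: u_def power_divide power_mult_distrib) (simp add: power2_eq_square)
    moreover have "c = sqrt (2 * pi) * sqrt t" by (simp add: c_def real_sqrt_mult)
    ultimately show ?thesis by simp
  qed
  ultimately show ?thesis by (simp only:)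
qed

lemma bounded_above_half_line:
  fixes g :: "real \<Rightarrow> real"
  assumes cont: "continuous_on {0..} g" and lim: "(g \<longlongrightarrow> 0) at_top"
  obtains C where "\<And>x. x \<ge> 0 \<Longrightarrow> g x \<le> C"
proof -
  have "\<forall>\<^sub>F x in at_top. g x < 1" using lim by (rule order_tendstoD) simp
  then obtain X where X: "\<And>x. x \<ge> X \<Longrightarrow> g x < 1" by (auto simp: eventually_at_top_linorder)
  have "compact (g ` {0..\<bar>X\<bar>})"
    by (intro compact_continuous_image continuous_on_subset[OF cont]) auto
  then obtain B where B: "\<And>x. x \<in> {0..\<bar>X\<bar>} \<Longrightarrow> norm (g x) \<le> B"
    using compact_imp_bounded bounded_iff by (metis imageI)
  have "g y \<le> max 1 B" if "y \<ge> 0" for y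
  proof (cases "y \<le> \<bar>X\<bar>")
    case True
    then have "\<bar>g y\<bar> \<le> B" using B[of y] that by simp
    then show ?thesis by linarith
  next
    case False
    then show ?thesis using X[of y] by linarith
  qed
  then show ?thesis using that by blast
qed

lemma power_exp_bound:
  fixes c :: real
  assumes "c > 0"
  obtains C where "\<And>x. \<bar>x\<bar> ^ k * exp (- c * x^2) \<le> C / (1 + x^2)"
proof -
  define g where "g = (\<lambda>x::real. x ^ k * exp (- c * x^2) * (1 + x^2))"
  have "(g \<longlongrightarrow> 0) at_top" unfolding g_def using assms by real_asymp
  then obtain C where C: "\<And>y. y \<ge> 0 \<Longrightarrow> g y \<le> C"
    by (rule bounded_above_half_line[rotated]) (auto simp: g_def intro!: continuous_intros)
  have "\<bar>x\<bar> ^ k * exp (- c * x^2) \<le> C / (1 + x^2)" for x :: real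
    using C[of "\<bar>x\<bar>"] by (simp add: g_def pos_le_divide_eq add_pos_nonneg)
  then show ?thesis using that by blast
qed

lemma has_integral_derivative_UNIV:
  fixes \<phi> \<phi>' :: "real \<Rightarrow> complex"
  assumes d: "\<And>x. (\<phi> has_vector_derivative \<phi>' x) (at x)"
    and lim: "(\<phi> \<longlongrightarrow> 0) at_top" "(\<phi> \<longlongrightarrow> 0) at_bot"
  shows "(\<phi>' has_integral 0) UNIV"
  unfolding has_integral_alt'[of \<phi>' 0 UNIV]
proof (intro conjI allI impI)
  have ftc: "(\<phi>' has_integral (\<phi> b - \<phi> a)) {a..b}" if "a \<le> b" for a b :: real
    using that d by (intro fundamental_theorem_of_calculus) (auto intro: has_vector_derivative_at_within)
  show "(\<lambda>x. if x \<in> UNIV then \<phi>' x else 0) integrable_on cbox a b" for a b :: real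
    using ftc[of a b] by (cases "a \<le> b") auto
  fix e :: real assume e: "e > 0"
  obtain A where A: "\<And>x. x \<ge> A \<Longrightarrow> norm (\<phi> x) < e / 2"
    using tendstoD[OF lim(1), of "e / 2"] e by (auto simp: eventually_at_top_linorder)
  obtain B where B: "\<And>x. x \<le> B \<Longrightarrow> norm (\<phi> x) < e / 2"
    using tendstoD[OF lim(2), of "e / 2"] e by (auto simp: eventually_at_bot_linorder)
  define R where "R = max (max \<bar>A\<bar> \<bar>B\<bar>) 1 + 1"
  show "\<exists>B>0. \<forall>a b. ball 0 B \<subseteq> cbox a b \<longrightarrow> norm (integral (cbox a b) (\<lambda>x. if x \<in> UNIV then \<phi>' x else 0) - 0) < e"
  proof (intro exI[of _ R] conjI allI impI)
    show "R > 0" by (simp add: R_def)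
    fix a b :: real assume sub: "ball 0 R \<subseteq> cbox a b"
    have "R - 1 \<in> ball 0 R" "- (R - 1) \<in> ball 0 R" by (auto simp: R_def dist_norm)
    then have ab: "a \<le> - (R - 1)" "R - 1 \<le> b" using sub by auto
    have R1: "\<bar>A\<bar> \<le> R - 1" "\<bar>B\<bar> \<le> R - 1" "1 \<le> R - 1" by (simp_all add: R_def)
    have "norm (\<phi> b) < e / 2" by (rule A) (use ab R1 in linarith)
    moreover have "norm (\<phi> a) < e / 2" by (rule B) (use ab R1 in linarith)
    moreover have "a \<le> b" using ab R1 by linarith
    ultimately have "norm (\<phi> b - \<phi> a) < e" using norm_triangle_ineq4[of "\<phi> b" "\<phi> a"] by linarith
    then show "norm (integral (cbox a b) (\<lambda>x. if x \<in> UNIV then \<phi>' x else 0) - 0) < e"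
      using integral_unique[OF ftc[OF \<open>a \<le> b\<close>]] by simp
  qed
qed

text \<open>The derivative of exp(-pi t x^2 - 2 pi \<i> n x) integrates to 0 over the line. It is -2
  pi t times the wanted integrand minus 2 pi \<i> n times the Gaussian one, so the first moment is a
  multiple of the Gaussian transform.\<close>

lemma gaussian_moment_fourier_integral:
  assumes t: "t > 0"
  shows "((\<lambda>x. of_real (x * exp (- pi * t * x^2)) * cis (- (2 * pi * of_int n * x))) has_integral
          - \<i> * of_int n / of_real t * of_real (exp (- pi * (of_int n)^2 / t) / sqrt t)) UNIV"
proof -
  let ?\<phi> = "\<lambda>x. exp (of_real (- pi * t * x^2) - \<i> * of_real (2 * pi * of_int n * x))"
  have \<phi>: "?\<phi> x = of_real (exp (- pi * t * x^2)) * cis (- (2 * pi * of_int n * x))" for x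
  proof -
    have "of_real (- pi * t * x^2) - \<i> * of_real (2 * pi * of_int n * x)
        = of_real (- pi * t * x^2) + \<i> * of_real (- (2 * pi * of_int n * x))" by simp
    then show ?thesis by (simp only: exp_add exp_of_real cis_conv_exp)
  qed
  let ?\<phi>' = "\<lambda>x. (of_real (- 2 * pi * t * x) - \<i> * of_real (2 * pi * of_int n)) * ?\<phi> x"
  have nrm: "norm (?\<phi> x) = exp (- pi * t * x^2)" for x by (simp add: norm_exp_eq_Re)
  have "(?\<phi>' has_integral 0) UNIV"
  proof (rule has_integral_derivative_UNIV)
    show "(?\<phi> has_vector_derivative ?\<phi>' x) (at x)" for x
    proof -
      have "((\<lambda>x. of_real (- pi * t * x^2) - \<i> * of_real (2 * pi * of_int n * x)) has_vector_derivative
          (of_real (- 2 * pi * t * x) - \<i> * of_real (2 * pi * of_int n))) (at x)"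
        by (auto intro!: derivative_eq_intros has_vector_derivative_of_real has_vector_derivative_real_field simp: has_real_derivative_iff_has_vector_derivative[symmetric])
      from field_vector_diff_chain_at[OF this DERIV_exp]
      show ?thesis by (simp add: o_def mult.commute)
    qed
    have "((\<lambda>x. exp (- pi * t * x^2)) \<longlongrightarrow> 0) at_top" using t by real_asymp
    then show "(?\<phi> \<longlongrightarrow> 0) at_top" unfolding nrm[symmetric] by (rule tendsto_norm_zero_cancel)
    have "((\<lambda>x. exp (- pi * t * x^2)) \<longlongrightarrow> 0) at_bot" using t by real_asymp
    then show "(?\<phi> \<longlongrightarrow> 0) at_bot" unfolding nrm[symmetric] by (rule tendsto_norm_zero_cancel)
  qed
  moreover have "(?\<phi> has_integral of_real (exp (- pi * (of_int n)^2 / t) / sqrt t)) UNIV"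
    unfolding \<phi> by (rule gaussian_fourier_integral[OF t])
  note has_integral_mult_right[OF this, of "\<i> * of_real (2 * pi * of_int n)"]
  ultimately have "((\<lambda>x. ?\<phi>' x + \<i> * of_real (2 * pi * of_int n) * ?\<phi> x) has_integral
      (0 + \<i> * of_real (2 * pi * of_int n) * of_real (exp (- pi * (of_int n)^2 / t) / sqrt t))) UNIV"
    by (rule has_integral_add)
  from has_integral_mult_right[OF this, of "- 1 / of_real (2 * pi * t)"]
  show ?thesis
  proof (rule has_integral_eq_rhs[OF has_integral_eq, rotated])
    show "- 1 / of_real (2 * pi * t) * (?\<phi>' x + \<i> * of_real (2 * pi * of_int n) * ?\<phi> x) = of_real (x * exp (- pi * t * x^2)) * cis (- (2 * pi * of_int n * x))" for x
      unfolding \<phi> using t by (simp add: field_simps)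
    show "- \<i> * of_int n / of_real t * of_real (exp (- pi * (of_int n)^2 / t) / sqrt t) = - 1 / of_real (2 * pi * t) * (0 + \<i> * of_real (2 * pi * of_int n) * of_real (exp (- pi * (of_int n)^2 / t) / sqrt t))"
      using t by (simp add: field_simps)
  qed
qed

lemma theta_poisson:
  assumes t: "t > 0" and i: "i \<le> Suc 0"
  shows "\<exists>S. ((\<lambda>n::int. complex_of_real ((of_int n + a) ^ i * exp (- pi * t * (of_int n + a)^2))) has_sum S) UNIV \<and>
             ((\<lambda>n::int. (- \<i> * of_int n / of_real t) ^ i * of_real (exp (- pi * (of_int n)^2 / t) / sqrt t) * cis (2 * pi * of_int n * a)) has_sum S) UNIV"
proof -
  obtain C where C: "\<And>x. \<bar>x\<bar> ^ i * exp (- (pi * t) * x^2) \<le> C / (1 + x^2)"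
    using power_exp_bound[of "pi * t" i] t by auto
  obtain C' where C': "\<And>x. \<bar>x\<bar> ^ i * exp (- (pi / t) * x^2) \<le> C' / (1 + x^2)"
    using power_exp_bound[of "pi / t" i] t by auto
  show ?thesis
  proof (rule poisson_summation[where C = C and C' = "C' * (1 / (t ^ i * sqrt t))"])
    show "continuous_on UNIV (\<lambda>x. complex_of_real (x ^ i * exp (- pi * t * x^2)))" by (intro continuous_intros)
    show "norm (complex_of_real (x ^ i * exp (- pi * t * x^2))) \<le> C / (1 + x^2)" for x
      using C[of x] by (simp only: norm_of_real abs_mult power_abs abs_exp_cancel) (simp add: mult.assoc)
    show "norm ((- \<i> * of_int n / of_real t) ^ i * of_real (exp (- pi * (of_int n)^2 / t) / sqrt t)) \<le> C' * (1 / (t ^ i * sqrt t)) / (1 + (of_int n)^2)" for n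
    proof -
      have "norm ((- \<i> * of_int n / of_real t) ^ i * of_real (exp (- pi * (of_int n)^2 / t) / sqrt t)) = (\<bar>of_int n\<bar> ^ i * exp (- (pi / t) * (of_int n)^2)) * (1 / (t ^ i * sqrt t))"
        using t by (simp add: norm_mult norm_power norm_divide power_divide)
      also have "\<dots> \<le> C' / (1 + (of_int n)^2) * (1 / (t ^ i * sqrt t))"
        by (rule mult_right_mono[OF C']) (use t in auto)
      also have "\<dots> = C' * (1 / (t ^ i * sqrt t)) / (1 + (of_int n)^2)" by (simp add: mult.commute)
      finally show ?thesis .
    qed
    show "((\<lambda>x. complex_of_real (x ^ i * exp (- pi * t * x^2)) * cis (- (2 * pi * of_int n * x))) has_integral (- \<i> * of_int n / of_real t) ^ i * of_real (exp (- pi * (of_int n)^2 / t) / sqrt t)) UNIV" for n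
    proof (cases "i = 0")
      case True
      then show ?thesis using gaussian_fourier_integral[OF t, of n] by (simp only: power_0 mult_1 of_real_1)
    next
      case False
      then have "i = 1" using i by simp
      then show ?thesis using gaussian_moment_fourier_integral[OF t, of n] by (simp only: power_one_right)
    qed
  qed
qed

lemma has_sum_finite_sum:
  fixes f :: "'a \<Rightarrow> 'b \<Rightarrow> complex"
  assumes "finite A" "\<And>a. a \<in> A \<Longrightarrow> (f a has_sum s a) X"
  shows "((\<lambda>x. \<Sum>a\<in>A. f a x) has_sum (\<Sum>a\<in>A. s a)) X"
  using assms by (induction A rule: finite_induct) (auto intro!: has_sum_add)

text \<open>The exponent i is the parity of c: for an odd c the weight n^i keeps the terms at n and
  -n from cancelling. In \<open>gauss\<close> the constant \<open>\<i> ^ i\<close> times the root of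
  N means root number 1, and \<open>zero\<close> removes the constant term of the theta
  series.\<close>

locale theta_char =
  fixes c :: "int \<Rightarrow> complex" and N :: int and i :: nat
  assumes N: "N > 0" and i: "i \<le> Suc 0"
    and norm_le: "\<And>n. norm (c n) \<le> 1" and zero: "c 0 = 0"
    and parity: "\<And>n. c (-n) = (-1) ^ i * c n"
    and periodic: "\<And>a m. c (m * N + a) = c a"
    and gauss: "\<And>n. (\<Sum>a\<in>{0..<N}. c a * cis (2 * pi * of_int (a * n) / of_int N)) = c n * (\<i> ^ i * of_real (sqrt (of_int N)))"
begin

text \<open>Dividing the exponent by N normalises the inversion to t -> 1/t; otherwise it would be t
  -> 1/(N^2 t).\<close>

definition theta_term :: "real \<Rightarrow> int \<Rightarrow> complex" where
  "theta_term t n = c n * of_real (of_int n ^ i * exp (- pi * t * (of_int n)^2 / of_int N))"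

text \<open>The sum is split into residue classes n = mN + a, and Poisson summation with shift a/N
  and parameter tN is applied to each. On the dual side the sum over a is the Gauss sum of c at n,
  which restores c n.\<close>

lemma theta_term_poisson:
  assumes t: "t > 0"
  shows "\<exists>S. (theta_term t has_sum S) UNIV \<and> (theta_term (1 / t) has_sum (of_real (t ^ i * sqrt t) * S)) UNIV"
proof -
  define r where "r = real_of_int N"
  have r: "r > 0" using N by (simp add: r_def)
  have T: "t * r > 0" using t r by simp
  define A where "A = (\<lambda>(a::int) (n::int). complex_of_real ((of_int n + of_int a / r) ^ i * exp (- pi * (t * r) * (of_int n + of_int a / r)^2)))"
  define B where "B = (\<lambda>(a::int) (n::int). (- \<i> * of_int n / of_real (t * r)) ^ i * of_real (exp (- pi * (of_int n)^2 / (t * r)) / sqrt (t * r)) * cis (2 * pi * of_int n * (of_int a / r)))"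
  have "\<forall>a. \<exists>S. (A a has_sum S) UNIV \<and> (B a has_sum S) UNIV"
    using theta_poisson[OF T i] unfolding A_def B_def by blast
  then obtain S where S: "\<And>a. (A a has_sum S a) UNIV" "\<And>a. (B a has_sum S a) UNIV" by metis
  define Z where "Z = (\<Sum>a\<in>{0..<N}. c a * S a)"
  have 1: "(theta_term t has_sum (of_real (r ^ i) * Z)) UNIV"
  proof -
    have cls: "((\<lambda>n. if n mod N = a then theta_term t n else 0) has_sum (of_real (r ^ i) * (c a * S a))) UNIV" if a: "a \<in> {0..<N}" for a
    proof -
      have inj: "inj_on (\<lambda>m. m * N + a) UNIV" using N by (auto simp: inj_on_def)
      have "theta_term t (m * N + a) = of_real (r ^ i) * (c a * A a m)" for m
      proof -
        have e: "of_int (m * N + a) = r * (of_int m + of_int a / r)" using r by (simp add: r_def field_simps)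
        show ?thesis unfolding theta_term_def periodic e A_def r_def[symmetric]
          using r by (simp add: power_mult_distrib power2_eq_square)
      qed
      then have "((\<lambda>m. theta_term t (m * N + a)) has_sum (of_real (r ^ i) * (c a * S a))) UNIV"
        by (simp only:) (intro has_sum_cmult_right S)
      then have "(theta_term t has_sum (of_real (r ^ i) * (c a * S a))) (range (\<lambda>m. m * N + a))"
        by (subst has_sum_reindex[OF inj]) (simp add: o_def)
      also have "range (\<lambda>m. m * N + a) = {n. n mod N = a}"
      proof safe
        show "(m * N + a) mod N = a" for m using a by simp
        show "n \<in> range (\<lambda>m. m * N + n mod N)" for n by (rule image_eqI[of _ _ "n div N"]) auto
      qed
      finally show ?thesis
        by (rule has_sum_cong_neutral[THEN iffD1, rotated -1]) auto
    qed
    have "((\<lambda>n. \<Sum>a\<in>{0..<N}. if n mod N = a then theta_term t n else 0) has_sum (\<Sum>a\<in>{0..<N}. of_real (r ^ i) * (c a * S a))) UNIV"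
      by (rule has_sum_finite_sum) (use cls in auto)
    moreover have "(\<Sum>a\<in>{0..<N}. if n mod N = a then theta_term t n else 0) = theta_term t n" for n
      using N by simp
    ultimately show ?thesis by (simp add: Z_def sum_distrib_left)
  qed
  have "((\<lambda>n. \<Sum>a\<in>{0..<N}. c a * B a n) has_sum Z) UNIV"
    unfolding Z_def by (intro has_sum_finite_sum has_sum_cmult_right S) auto
  then have "((\<lambda>n. of_real ((t * r) ^ i * sqrt t) * (\<Sum>a\<in>{0..<N}. c a * B a n)) has_sum (of_real ((t * r) ^ i * sqrt t) * Z)) UNIV"
    by (rule has_sum_cmult_right)
  moreover have "of_real ((t * r) ^ i * sqrt t) * (\<Sum>a\<in>{0..<N}. c a * B a n) = theta_term (1 / t) n" for n
  proof -
    let ?E = "exp (- pi * (of_int n)^2 / (t * r))"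
    have "(\<Sum>a\<in>{0..<N}. c a * B a n) = (- \<i> * of_int n / of_real (t * r)) ^ i * of_real (?E / sqrt (t * r)) * (\<Sum>a\<in>{0..<N}. c a * cis (2 * pi * of_int (a * n) / of_int N))"
      unfolding sum_distrib_left by (rule sum.cong) (auto simp: B_def r_def mult_ac)
    also have "\<dots> = (- \<i> * of_int n / of_real (t * r)) ^ i * of_real (?E / sqrt (t * r)) * (c n * (\<i> ^ i * of_real (sqrt r)))"
      unfolding gauss r_def ..
    also have "\<dots> = ((- \<i> * of_int n / of_real (t * r)) ^ i * \<i> ^ i) * c n * of_real (?E / sqrt (t * r) * sqrt r)"
      by (simp only: of_real_mult mult_ac)
    \<comment> \<open>The power of -\<open>\<i>\<close> from the Fourier transform meets the power
      of \<open>\<i>\<close> from the Gauss sum and they cancel; this is where root number 1 is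
      used.\<close>
    also have "(- \<i> * of_int n / of_real (t * r)) ^ i * \<i> ^ i = of_real (of_int n ^ i / (t * r) ^ i)"
    proof -
      have "\<i> * x * \<i> = - x" for x :: complex by (simp add: complex_eq_iff)
      then have "(- \<i> * x / y) * \<i> = x / y" for x y :: complex
        by (metis minus_divide_left minus_mult_left minus_minus times_divide_eq_left)
      then show ?thesis unfolding power_mult_distrib[symmetric] by (simp add: power_divide)
    qed
    also have "?E / sqrt (t * r) * sqrt r = ?E / sqrt t"
      using t r by (simp add: real_sqrt_mult)
    finally have e: "(\<Sum>a\<in>{0..<N}. c a * B a n) = of_real (of_int n ^ i / (t * r) ^ i) * c n * of_real (?E / sqrt t)" .
    have E: "?E = exp (- pi * (1 / t) * (of_int n)^2 / r)" using t r by (simp add: field_simps)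
    have "(t * r) ^ i * sqrt t * (of_int n ^ i / (t * r) ^ i * (?E / sqrt t)) = of_int n ^ i * ?E"
      using t r by simp
    then have E': "complex_of_real ((t * r) ^ i * sqrt t) * (of_real (of_int n ^ i / (t * r) ^ i) * of_real (?E / sqrt t)) = of_real (of_int n ^ i * ?E)"
      unfolding of_real_mult[symmetric] by (rule arg_cong)
    have "X * (Y * k * W) = k * (X * (Y * W))" for X Y k W :: complex by (simp only: mult_ac)
    then have "of_real ((t * r) ^ i * sqrt t) * (of_real (of_int n ^ i / (t * r) ^ i) * c n * of_real (?E / sqrt t)) = c n * of_real (of_int n ^ i * ?E)"
      by (simp only: E')
    then show ?thesis unfolding e theta_term_def E r_def[symmetric] .
  qed
  ultimately have 2: "(theta_term (1 / t) has_sum (of_real ((t * r) ^ i * sqrt t) * Z)) UNIV" by simp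
  have "of_real ((t * r) ^ i * sqrt t) * Z = of_real (t ^ i * sqrt t) * (of_real (r ^ i) * Z)"
    by (simp add: power_mult_distrib)
  with 1 2 show ?thesis by metis
qed

lemma theta_term_minus: "theta_term t (- n) = theta_term t n"
proof -
  have "(-1::complex) ^ i * (-1) ^ i = 1" by (simp flip: power_mult_distrib)
  then show ?thesis
    by (simp add: theta_term_def parity power_minus[of "of_int n" i] power_minus[of "complex_of_int n" i])
qed

text \<open>Half of the sum over all integers, since the terms are even and the one at 0 vanishes.
  Positive indices match the Dirichlet series.\<close>

definition theta :: "real \<Rightarrow> complex" where
  "theta t = (\<Sum>n. theta_term t (int (Suc n)))"

lemma has_sum_theta_term:
  assumes S: "(theta_term t has_sum S) UNIV"
  shows "S = 2 * theta t" "summable (\<lambda>n. theta_term t (int (Suc n)))"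
proof -
  have inj: "inj (\<lambda>n. int (Suc n))" "inj (\<lambda>n. - int (Suc n))" by (auto simp: inj_def)
  have "theta_term t summable_on range (\<lambda>n. int (Suc n))"
    by (rule summable_on_subset_banach[OF has_sum_imp_summable[OF S]]) simp
  then obtain T where T: "(theta_term t has_sum T) (range (\<lambda>n. int (Suc n)))" unfolding summable_on_def by blast
  then have T1: "((\<lambda>n. theta_term t (int (Suc n))) has_sum T) UNIV"
    by (subst (asm) has_sum_reindex[OF inj(1)]) (simp add: o_def)
  then have "((\<lambda>n. theta_term t (- int (Suc n))) has_sum T) UNIV" unfolding theta_term_minus .
  then have T2: "(theta_term t has_sum T) (range (\<lambda>n. - int (Suc n)))"
    by (subst has_sum_reindex[OF inj(2)]) (simp add: o_def)
  have T0: "(theta_term t has_sum 0) {0}" by (rule has_sum_finiteI) (simp_all add: theta_term_def zero)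
  have "(theta_term t has_sum (T + T)) (range (\<lambda>n. int (Suc n)) \<union> range (\<lambda>n. - int (Suc n)))"
    by (rule has_sum_Un_disjoint[OF T T2]) auto
  then have "(theta_term t has_sum (T + T + 0)) (range (\<lambda>n. int (Suc n)) \<union> range (\<lambda>n. - int (Suc n)) \<union> {0})"
    by (rule has_sum_Un_disjoint[OF _ T0]) auto
  also have "range (\<lambda>n. int (Suc n)) \<union> range (\<lambda>n. - int (Suc n)) \<union> {0} = UNIV"
  proof -
    have "x \<in> range (\<lambda>n. int (Suc n)) \<union> range (\<lambda>n. - int (Suc n)) \<union> {0}" for x
    proof -
      consider "x > 0" | "x = 0" | "x < 0" by linarith
      then show ?thesis
      proof cases
        case 1
        then have "x = int (Suc (nat x - 1))" by simp
        then show ?thesis by blast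
      next
        case 3
        then have "x = - int (Suc (nat (- x) - 1))" by simp
        then show ?thesis by blast
      qed simp
    qed
    then show ?thesis by blast
  qed
  finally have "S = T + T + 0" using S has_sum_unique by blast
  moreover have "(\<lambda>n. theta_term t (int (Suc n))) sums T" by (rule has_sum_imp_sums[OF T1])
  ultimately show "S = 2 * theta t" "summable (\<lambda>n. theta_term t (int (Suc n)))"
    by (auto simp: theta_def sums_iff)
qed

lemma theta_functional_equation:
  assumes "t > 0"
  shows "theta (1 / t) = of_real (t ^ i * sqrt t) * theta t"
proof -
  obtain S where S: "(theta_term t has_sum S) UNIV" "(theta_term (1 / t) has_sum (of_real (t ^ i * sqrt t) * S)) UNIV"
    using theta_term_poisson[OF assms] by blast
  show ?thesis using has_sum_theta_term(1)[OF S(1)] has_sum_theta_term(1)[OF S(2)] by (simp add: mult.assoc)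
qed

lemma norm_theta_term_le: "norm (theta_term t n) \<le> \<bar>of_int n\<bar> ^ i * exp (- pi * t * (of_int n)^2 / of_int N)"
  unfolding theta_term_def norm_mult norm_of_real abs_mult power_abs
  using mult_right_mono[OF norm_le[of n], of "\<bar>of_int n\<bar> ^ i * exp (- pi * t * (of_int n)^2 / of_int N)"] by simp

lemma norm_theta_term_Suc_le:
  "norm (theta_term t (int (Suc n))) \<le> real (Suc n) ^ i * exp (- pi * t * (real (Suc n))^2 / of_int N)"
  using norm_theta_term_le[of t "int (Suc n)"] by (simp only: of_int_of_nat_eq abs_of_nat)

lemma summable_theta_bound:
  assumes "t > 0"
  shows "summable (\<lambda>n. real (Suc n) ^ i * exp (- pi * t * (real (Suc n))^2 / of_int N))"
proof -
  have "pi * t / of_int N > 0" using assms N by simp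
  then obtain C where C: "\<And>x. \<bar>x\<bar> ^ i * exp (- (pi * t / of_int N) * x^2) \<le> C / (1 + x^2)"
    using power_exp_bound[of _ i] by blast
  show ?thesis
  proof (rule summable_comparison_test')
    have "summable (\<lambda>n. 1 / (real (Suc n))^2)"
      using inverse_power_summable[of 2] by (subst summable_Suc_iff) (simp add: inverse_eq_divide)
    then show "summable (\<lambda>n. C * (1 / (real (Suc n))^2))" by (rule summable_mult)
    fix n :: nat
    have "0 \<le> C" using order_trans[OF _ C[of 0]] by simp
    then have "C / (1 + (real (Suc n))^2) \<le> C / (real (Suc n))^2" by (intro divide_left_mono) (auto intro!: mult_pos_pos add_pos_pos)
    then show "norm (real (Suc n) ^ i * exp (- pi * t * (real (Suc n))^2 / of_int N)) \<le> C * (1 / (real (Suc n))^2)"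
      using C[of "real (Suc n)"] by simp
  qed
qed

lemma continuous_on_theta: "continuous_on {0<..} theta"
proof -
  have "continuous_on {a<..} theta" if a: "a > 0" for a
  proof -
    have ul: "uniform_limit {a<..} (\<lambda>m t. \<Sum>n<m. theta_term t (int (Suc n))) theta sequentially"
      unfolding theta_def
    proof (rule Weierstrass_m_test[OF _ summable_theta_bound[OF a]])
      fix n and t :: real assume "t \<in> {a<..}"
      then have "- pi * t * (real (Suc n))^2 / of_int N \<le> - pi * a * (real (Suc n))^2 / of_int N"
        using N by (intro divide_right_mono mult_right_mono) auto
      then have "real (Suc n) ^ i * exp (- pi * t * (real (Suc n))^2 / of_int N) \<le> real (Suc n) ^ i * exp (- pi * a * (real (Suc n))^2 / of_int N)"
        by (intro mult_left_mono) (auto simp del: of_nat_Suc)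
      then show "norm (theta_term t (int (Suc n))) \<le> real (Suc n) ^ i * exp (- pi * a * (real (Suc n))^2 / of_int N)"
        by (rule order_trans[OF norm_theta_term_Suc_le])
    qed
    show ?thesis
      by (rule uniform_limit_theorem[OF _ ul]) (use N in \<open>auto intro!: always_eventually continuous_intros simp: theta_term_def\<close>)
  qed
  then have "isCont theta t" if "t > 0" for t
    using that continuous_on_interior[of "{t / 2<..}" theta t] by (simp add: interior_open)
  then show ?thesis by (intro continuous_at_imp_continuous_on) auto
qed

text \<open>For t >= 1 and m >= 1 one has t m^2 >= m^2/2 + t/2. The first half keeps the series
  convergent with a constant independent of t, the second gives the decay.\<close>

lemma norm_theta_le:
  obtains C where "C > 0" "\<And>t. t \<ge> 1 \<Longrightarrow> norm (theta t) \<le> C * exp (- (pi / (2 * of_int N)) * t)"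
proof -
  define b where "b = (\<lambda>n. real (Suc n) ^ i * exp (- pi * (1 / 2) * (real (Suc n))^2 / of_int N))"
  have sb: "summable b" unfolding b_def by (rule summable_theta_bound) simp
  have b0: "b n > 0" for n by (simp add: b_def)
  have "norm (theta t) \<le> suminf b * exp (- (pi / (2 * of_int N)) * t)" if t: "t \<ge> 1" for t
  proof -
    have le: "norm (theta_term t (int (Suc n))) \<le> b n * exp (- (pi / (2 * of_int N)) * t)" for n
    proof -
      let ?m = "real (Suc n)"
      have "?m^2 \<ge> 1" by simp
      then have "(t - 1) * (?m^2 - 1) \<ge> 0" using t by (intro mult_nonneg_nonneg) auto
      moreover have "t * ?m^2 \<ge> 1" using t \<open>?m^2 \<ge> 1\<close> mult_mono[of 1 t 1 "?m^2"] by simp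
      ultimately have "t * ?m^2 \<ge> (1 / 2) * ?m^2 + t / 2" by (simp add: algebra_simps del: of_nat_Suc)
      then have "pi / of_int N * (t * ?m^2) \<ge> pi / of_int N * ((1 / 2) * ?m^2 + t / 2)"
        using N by (intro mult_left_mono) auto
      then have "- pi * t * ?m^2 / of_int N \<le> - pi * (1 / 2) * ?m^2 / of_int N + - (pi / (2 * of_int N)) * t"
      proof -
        have "- pi * t * ?m^2 / of_int N = - (pi / of_int N * (t * ?m^2))" by simp
        moreover have "- pi * (1 / 2) * ?m^2 / of_int N + - (pi / (2 * of_int N)) * t = - (pi / of_int N * ((1 / 2) * ?m^2 + t / 2))"
          using N by (simp add: field_simps del: of_nat_Suc)
        ultimately show ?thesis using \<open>pi / of_int N * (t * ?m^2) \<ge> pi / of_int N * ((1 / 2) * ?m^2 + t / 2)\<close> by linarith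
      qed
      then have "exp (- pi * t * ?m^2 / of_int N) \<le> exp (- pi * (1 / 2) * ?m^2 / of_int N) * exp (- (pi / (2 * of_int N)) * t)"
        unfolding exp_add[symmetric] by simp
      then have "?m ^ i * exp (- pi * t * ?m^2 / of_int N) \<le> ?m ^ i * (exp (- pi * (1 / 2) * ?m^2 / of_int N) * exp (- (pi / (2 * of_int N)) * t))"
        by (intro mult_left_mono) auto
      from order_trans[OF norm_theta_term_Suc_le this] show ?thesis unfolding b_def by (simp only: mult.assoc)
    qed
    have sb': "summable (\<lambda>n. b n * exp (- (pi / (2 * of_int N)) * t))" by (rule summable_mult2[OF sb])
    have sn: "summable (\<lambda>n. norm (theta_term t (int (Suc n))))"
      by (rule summable_comparison_test'[OF sb']) (use le in auto)
    have "norm (theta t) \<le> (\<Sum>n. norm (theta_term t (int (Suc n))))" unfolding theta_def by (rule summable_norm[OF sn])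
    also have "\<dots> \<le> (\<Sum>n. b n * exp (- (pi / (2 * of_int N)) * t))" by (rule suminf_le[OF le sn sb'])
    also have "\<dots> = suminf b * exp (- (pi / (2 * of_int N)) * t)" by (rule suminf_mult2[OF sb, symmetric])
    finally show ?thesis .
  qed
  moreover have "suminf b > 0" by (rule suminf_pos[OF sb b0])
  ultimately show ?thesis using that by blast
qed

end

section \<open>The Mellin transform of the theta function\<close>

lemma integrable_gaussian: "(\<lambda>x. C * exp (- pi * x^2)) integrable_on (UNIV :: real set)"
proof -
  have "((\<lambda>x. Re (of_real (exp (- pi * 1 * x^2)) * cis (- (2 * pi * of_int 0 * x)))) has_integral Re (of_real (exp (- pi * (of_int 0)^2 / 1) / sqrt 1))) UNIV"
    using has_integral_linear[OF gaussian_fourier_integral[OF zero_less_one, of 0] bounded_linear_Re] by (simp add: o_def)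
  then have "(\<lambda>x::real. exp (- pi * x^2)) integrable_on UNIV" by (auto simp: integrable_on_def)
  then show ?thesis by (rule integrable_on_mult_right)
qed

lemma norm_exp_integrand_le:
  fixes \<phi> :: "real \<Rightarrow> complex"
  assumes "norm w \<le> R"
  shows "norm (\<phi> u * exp (of_real u * w)) \<le> norm (\<phi> u) * exp (R * \<bar>u\<bar>)"
proof -
  have "\<bar>Re w\<bar> \<le> R" using assms abs_Re_le_cmod[of w] by linarith
  then have "\<bar>u\<bar> * \<bar>Re w\<bar> \<le> \<bar>u\<bar> * R" by (intro mult_left_mono) auto
  then have "u * Re w \<le> R * \<bar>u\<bar>" using abs_ge_self[of "u * Re w"] by (simp add: abs_mult mult.commute)
  then show ?thesis by (simp add: norm_mult norm_exp_eq_Re mult_left_mono)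
qed

lemma exp_integrand_integrable:
  fixes \<phi> :: "real \<Rightarrow> complex"
  assumes cont: "continuous_on UNIV \<phi>"
    and bound: "\<And>R. \<exists>C. \<forall>u. norm (\<phi> u) * exp (R * \<bar>u\<bar>) \<le> C * exp (- pi * u^2)"
  shows "(\<lambda>u. \<phi> u * exp (of_real u * w)) integrable_on UNIV"
proof -
  obtain C where C: "\<And>u. norm (\<phi> u) * exp (norm w * \<bar>u\<bar>) \<le> C * exp (- pi * u^2)" using bound by blast
  show ?thesis
  proof (rule integrable_on_all_intervals_integrable_bound[OF _ _ integrable_gaussian])
    have "(\<lambda>u. \<phi> u * exp (of_real u * w)) integrable_on cbox a b" for a b :: real
      by (intro integrable_continuous continuous_intros continuous_on_subset[OF cont]) auto
    then show "(\<lambda>u. if u \<in> UNIV then \<phi> u * exp (of_real u * w) else 0) integrable_on cbox a b" for a b :: real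
      by simp
    show "norm (\<phi> u * exp (of_real u * w)) \<le> C * exp (- pi * u^2)" for u
      by (rule order_trans[OF norm_exp_integrand_le[OF order_refl] C])
  qed
qed

text \<open>Truncated integrals are holomorphic by the Leibniz rule. Around w0 the hypothesis with R
  = |w0| + 1 supplies one Gaussian majorant on the closed unit disc, so the truncations converge
  uniformly there.\<close>

lemma holomorphic_exp_integral:
  fixes \<phi> :: "real \<Rightarrow> complex"
  assumes cont: "continuous_on UNIV \<phi>"
    and bound: "\<And>R. \<exists>C. \<forall>u. norm (\<phi> u) * exp (R * \<bar>u\<bar>) \<le> C * exp (- pi * u^2)"
  shows "(\<lambda>w. integral UNIV (\<lambda>u. \<phi> u * exp (of_real u * w))) holomorphic_on UNIV" (is "?g holomorphic_on _")
proof (rule holomorphic_uniform_sequence)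
  let ?F = "\<lambda>w u. \<phi> u * exp (of_real u * w)"
  show "(\<lambda>w. integral {- real n..real n} (?F w)) holomorphic_on UNIV" for n
    unfolding interval_cbox
  proof (rule leibniz_rule_holomorphic[where fx = "\<lambda>w u. \<phi> u * (of_real u * exp (of_real u * w))"])
    show "((\<lambda>w. ?F w u) has_field_derivative \<phi> u * (of_real u * exp (of_real u * w))) (at w within UNIV)" for w u
      by (auto intro!: derivative_eq_intros)
    show "?F w integrable_on cbox (- real n) (real n)" for w
      by (intro integrable_continuous continuous_intros continuous_on_subset[OF cont]) auto
    show "continuous_on (UNIV \<times> cbox (- real n) (real n)) (\<lambda>(w, u). \<phi> u * (of_real u * exp (of_real u * w)))"
      unfolding split_beta by (intro continuous_intros continuous_on_compose2[OF cont]) auto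
  qed auto
  fix w0 :: complex
  define R where "R = norm w0 + 1"
  obtain C where C: "\<And>u. norm (\<phi> u) * exp (R * \<bar>u\<bar>) \<le> C * exp (- pi * u^2)" using bound by blast
  define M where "M = (\<lambda>u::real. C * exp (- pi * u^2))"
  have M: "M integrable_on UNIV" unfolding M_def by (rule integrable_gaussian)
  have le: "norm (?F w u) \<le> M u" if "w \<in> cball w0 1" for w u
  proof -
    have "norm w \<le> R" using that norm_triangle_ineq2[of w w0] by (simp add: R_def dist_norm norm_minus_commute)
    from order_trans[OF norm_exp_integrand_le[OF this] C] show ?thesis unfolding M_def .
  qed
  note intF = exp_integrand_integrable[OF cont bound]
  have intI: "f integrable_on {- real n..real n}" if "f integrable_on UNIV" for n and f :: "real \<Rightarrow> 'c::banach"
    using integrable_on_subcbox[OF that, of "- real n" "real n"] by simp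
  have tail: "integral UNIV f - integral {- real n..real n} f = integral UNIV (\<lambda>u. if u \<in> {- real n..real n} then 0 else f u)"
    and tail': "(\<lambda>u. if u \<in> {- real n..real n} then 0 else f u) integrable_on UNIV"
    if f: "f integrable_on UNIV" for n and f :: "real \<Rightarrow> 'c::banach"
  proof -
    have r: "(\<lambda>u. if u \<in> {- real n..real n} then f u else 0) integrable_on UNIV"
      unfolding integrable_restrict_UNIV by (rule intI[OF f])
    have e: "(\<lambda>u. if u \<in> {- real n..real n} then 0 else f u) = (\<lambda>u. f u - (if u \<in> {- real n..real n} then f u else 0))"
      by auto
    show "(\<lambda>u. if u \<in> {- real n..real n} then 0 else f u) integrable_on UNIV"
      unfolding e by (rule integrable_diff[OF f r])
    show "integral UNIV f - integral {- real n..real n} f = integral UNIV (\<lambda>u. if u \<in> {- real n..real n} then 0 else f u)"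
      unfolding e integral_diff[OF f r] integral_restrict_UNIV ..
  qed
  have "uniform_limit (cball w0 1) (\<lambda>n w. integral {- real n..real n} (?F w)) ?g sequentially"
  proof (rule uniform_limitI)
    fix e :: real assume e: "e > 0"
    have "(\<lambda>n. integral {- real n..real n} M) \<longlonglongrightarrow> integral UNIV M"
      by (rule has_integral_UNIV_imp_symmetric_limit[OF integrable_integral[OF M]])
    then have "\<forall>\<^sub>F n in sequentially. dist (integral {- real n..real n} M) (integral UNIV M) < e" using e by (rule tendstoD)
    then show "\<forall>\<^sub>F n in sequentially. \<forall>w\<in>cball w0 1. dist (integral {- real n..real n} (?F w)) (?g w) < e"
    proof eventually_elim
      case (elim n)
      show ?case
      proof
        fix w assume w: "w \<in> cball w0 1"
        have "norm (integral UNIV (\<lambda>u. if u \<in> {- real n..real n} then 0 else ?F w u)) \<le> integral UNIV (\<lambda>u. if u \<in> {- real n..real n} then 0 else M u)"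
          by (rule integral_norm_bound_integral[OF tail'[OF intF] tail'[OF M]]) (use le[OF w] in auto)
        then have "norm (?g w - integral {- real n..real n} (?F w)) \<le> integral UNIV M - integral {- real n..real n} M"
          unfolding tail[OF intF] tail[OF M] .
        then show "dist (integral {- real n..real n} (?F w)) (?g w) < e"
          using elim by (simp add: dist_norm norm_minus_commute abs_real_def split: if_splits)
      qed
    qed
  qed
  then show "\<exists>d>0. cball w0 d \<subseteq> UNIV \<and> uniform_limit (cball w0 d) (\<lambda>n w. integral {- real n..real n} (?F w)) ?g sequentially"
    by (intro exI[of _ 1]) auto
qed auto

lemma powr_of_real_eq_exp:
  assumes "x > 0"
  shows "complex_of_real x powr w = exp (w * of_real (ln x))"
  using assms by (simp add: powr_def Ln_of_real)

text \<open>Euler's integral under the substitution t = a e^u. It is stated for the Lebesgue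
  integral because the theta series is later integrated term by term in that form.\<close>

lemma Gamma_integral_exp:
  assumes a: "a > 0" and z: "Re z > 0"
  defines "f \<equiv> \<lambda>u. complex_of_real (exp (- a * exp u)) * exp (of_real u * z)"
  shows "integrable lborel f" "integral\<^sup>L lborel f = Gamma z * of_real a powr (- z)"
proof -
  define h where "h = (\<lambda>t. complex_of_real t powr (z - 1) / of_real (exp t))"
  have img: "(\<lambda>u. a * exp u) ` UNIV = {0<..}"
  proof safe
    fix x :: real assume "x > 0"
    then have "x = a * exp (ln (x / a))" using a by simp
    then show "x \<in> range (\<lambda>u. a * exp u)" by blast
  qed (use a in auto)
  have "(\<lambda>u. \<bar>a * exp u\<bar> *\<^sub>R h (a * exp u)) absolutely_integrable_on UNIV \<and>
        integral UNIV (\<lambda>u. \<bar>a * exp u\<bar> *\<^sub>R h (a * exp u)) = Gamma z"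
  proof (subst has_absolute_integral_change_of_variables_real)
    show "((\<lambda>u. a * exp u) has_field_derivative a * exp u) (at u within UNIV)" for u
      by (auto intro!: derivative_eq_intros)
    show "inj_on (\<lambda>u. a * exp u) UNIV" using a by (auto simp: inj_on_def)
    show "h absolutely_integrable_on range (\<lambda>u. a * exp u) \<and> integral (range (\<lambda>u. a * exp u)) h = Gamma z"
      unfolding img h_def using absolutely_integrable_Gamma_integral'[OF z] Gamma_integral_complex'[OF z]
      by (auto intro: integral_unique)
  qed simp
  moreover have "\<bar>a * exp u\<bar> *\<^sub>R h (a * exp u) = of_real a powr z * f u" for u
  proof -
    have pos: "a * exp u > 0" using a by simp
    have L: "complex_of_real (ln (a * exp u)) = of_real (ln a) + of_real u" using a by (simp add: ln_mult)
    have "complex_of_real (a * exp u) = exp (of_real (ln (a * exp u)))" using pos by (simp only: exp_of_real exp_ln)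
    then have "complex_of_real (a * exp u) * of_real (a * exp u) powr (z - 1) = exp (of_real (ln (a * exp u)) * z)"
      unfolding powr_of_real_eq_exp[OF pos] by (simp add: exp_add[symmetric] algebra_simps)
    also have "\<dots> = of_real a powr z * exp (of_real u * z)"
      unfolding powr_of_real_eq_exp[OF a] L by (simp add: exp_add[symmetric] algebra_simps)
    finally have e: "complex_of_real (a * exp u) * of_real (a * exp u) powr (z - 1) = of_real a powr z * exp (of_real u * z)" .
    have "\<bar>a * exp u\<bar> *\<^sub>R h (a * exp u) = (complex_of_real (a * exp u) * of_real (a * exp u) powr (z - 1)) * of_real (exp (- (a * exp u)))"
      using pos by (simp add: h_def scaleR_conv_of_real exp_minus divide_inverse mult.assoc)
    then show ?thesis unfolding e f_def by (simp add: mult_ac)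
  qed
  ultimately have 1: "(\<lambda>u. of_real a powr z * f u) absolutely_integrable_on UNIV" "integral UNIV (\<lambda>u. of_real a powr z * f u) = Gamma z"
    by simp_all
  have a0: "complex_of_real a powr z \<noteq> 0" using a by simp
  have fm: "f \<in> borel_measurable borel" unfolding f_def by (intro borel_measurable_continuous_onI continuous_intros)
  have "integrable lebesgue (\<lambda>u. of_real a powr z * f u)" using 1(1) by (simp add: set_integrable_def)
  then have "integrable lborel (\<lambda>u. of_real a powr z * f u)" using fm by (subst (asm) integrable_completion) auto
  then have "integrable lborel (\<lambda>u. inverse (of_real a powr z) * (of_real a powr z * f u))" by (rule integrable_mult_right)
  moreover have "inverse (of_real a powr z) * (of_real a powr z * f u) = f u" for u
    using a0 by (simp add: mult.assoc[symmetric])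
  ultimately show int: "integrable lborel f" by simp
  have "integral UNIV (\<lambda>u. of_real a powr z * f u) = of_real a powr z * integral\<^sup>L lborel f"
    using integral_unique[OF has_integral_mult_right[OF has_integral_integral_lborel[OF int], of "of_real a powr z"]] .
  then show "integral\<^sup>L lborel f = Gamma z * of_real a powr (- z)"
    using 1(2) a0 by (simp add: powr_minus field_simps)
qed

context theta_char
begin

text \<open>Substituting $t = e^u$ and shifting by $s = 1/2$ makes the Mellin kernel an even function
  of $u$, so the functional equation of the completed function is the reflection $u \mapsto -u$.\<close>

definition kernel :: "real \<Rightarrow> complex" where
  "kernel u = of_real (exp (u * (1 / 4 + real i / 2))) * theta (exp u)"

text \<open>The exponent 1/4 + i/2 is half of the weight i + 1/2 in
  \<open>theta_functional_equation\<close>, so the inversion becomes evenness with no factor left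
  over.\<close>

lemma kernel_even: "kernel (- u) = kernel u"
proof -
  have 1: "theta (exp (- u)) = of_real (exp u ^ i * sqrt (exp u)) * theta (exp u)"
    using theta_functional_equation[of "exp u"] by (simp add: exp_minus inverse_eq_divide)
  have "sqrt (exp u) = exp (u / 2)"
    by (rule real_sqrt_unique) (simp_all add: power2_eq_square exp_add[symmetric])
  then have 2: "exp u ^ i * sqrt (exp u) = exp (real i * u + u / 2)"
    by (simp add: exp_add exp_of_nat_mult)
  have "exp (- u * (1 / 4 + real i / 2)) * (exp u ^ i * sqrt (exp u)) = exp (u * (1 / 4 + real i / 2))"
    unfolding 2 exp_add[symmetric] by (rule arg_cong[of _ _ exp]) (simp add: field_simps)
  then have "complex_of_real (exp (- u * (1 / 4 + real i / 2))) * of_real (exp u ^ i * sqrt (exp u)) = of_real (exp (u * (1 / 4 + real i / 2)))"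
    unfolding of_real_mult[symmetric] by (rule arg_cong)
  then show ?thesis unfolding kernel_def 1 mult.assoc[symmetric] by (rule arg_cong2[where f = "(*)"]) simp
qed

lemma continuous_on_kernel: "continuous_on UNIV kernel"
  unfolding kernel_def by (intro continuous_intros continuous_on_compose2[OF continuous_on_theta]) auto

text \<open>At t = e^u the exponential decay of theta is doubly exponential in u and beats exp(R u +
  pi u^2). Negative u follow from evenness.\<close>

lemma kernel_bound: "\<exists>C. \<forall>u. norm (kernel u) * exp (R * \<bar>u\<bar>) \<le> C * exp (- pi * u^2)"
proof -
  obtain C where C: "C > 0" "\<And>t. t \<ge> 1 \<Longrightarrow> norm (theta t) \<le> C * exp (- (pi / (2 * of_int N)) * t)"
    using norm_theta_le by blast
  define b where "b = pi / (2 * of_int N)"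
  have b: "b > 0" using N by (simp add: b_def)
  define k where "k = 1 / 4 + real i / 2 + R"
  define g where "g = (\<lambda>x::real. exp (k * x + pi * x^2 - b * exp x))"
  have "(g \<longlongrightarrow> 0) at_top" unfolding g_def using b by real_asymp
  then obtain B where B: "\<And>x. x \<ge> 0 \<Longrightarrow> g x \<le> B"
    by (rule bounded_above_half_line[rotated]) (auto simp: g_def intro!: continuous_intros)
  have main: "norm (kernel u) * exp (R * u) \<le> C * B * exp (- pi * u^2)" if u: "u \<ge> 0" for u
  proof -
    have "norm (kernel u) * exp (R * u) = norm (theta (exp u)) * exp (k * u)"
      by (simp add: kernel_def norm_mult k_def exp_add[symmetric] algebra_simps)
    also have "\<dots> \<le> (C * exp (- b * exp u)) * exp (k * u)"
      by (rule mult_right_mono) (use C(2)[of "exp u"] u in \<open>auto simp: b_def\<close>)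
    also have "\<dots> = C * (g u * exp (- pi * u^2))"
      by (simp add: g_def exp_add[symmetric] algebra_simps)
    also have "\<dots> \<le> C * (B * exp (- pi * u^2))"
      by (intro mult_left_mono mult_right_mono B u) (use C in auto)
    finally show ?thesis by (simp add: mult.assoc)
  qed
  have "norm (kernel u) * exp (R * \<bar>u\<bar>) \<le> C * B * exp (- pi * u^2)" for u
    using main[of "\<bar>u\<bar>"] kernel_even[of u] by (cases "u \<ge> 0") auto
  then show ?thesis by blast
qed

text \<open>The Mellin transform of theta at (s+i)/2, that is, (N/pi)^((s+i)/2) Gamma((s+i)/2) L(s)
  where the series converges: the exponents 1/4 + i/2 of the kernel and (s - 1/2)/2 add up to
  (s+i)/2.\<close>

definition completed_L :: "complex \<Rightarrow> complex" where
  "completed_L s = integral UNIV (\<lambda>u. kernel u * exp (of_real u * ((s - 1 / 2) / 2)))"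

lemma completed_L_functional_equation: "completed_L (1 - s) = completed_L s"
proof -
  let ?w = "(s - 1 / 2) / 2"
  have int: "(\<lambda>u. kernel u * exp (of_real u * w)) integrable_on UNIV" for w
    by (rule exp_integrand_integrable[OF continuous_on_kernel kernel_bound])
  have w: "(1 - s - 1 / 2) / 2 = - ?w" by (simp add: field_simps)
  have "integral {- real n..real n} (\<lambda>u. kernel u * exp (of_real u * - ?w)) = integral {- real n..real n} (\<lambda>u. kernel u * exp (of_real u * ?w))" for n
    using Henstock_Kurzweil_Integration.integral_reflect_real[of "real n" "- real n" "\<lambda>u. kernel u * exp (of_real u * ?w)"]
    by (simp add: kernel_even)
  then have "(\<lambda>n. integral {- real n..real n} (\<lambda>u. kernel u * exp (of_real u * ?w))) \<longlonglongrightarrow> completed_L (1 - s)"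
    using has_integral_UNIV_imp_symmetric_limit[OF integrable_integral[OF int[of "- ?w"]]]
    unfolding completed_L_def w by simp
  moreover have "(\<lambda>n. integral {- real n..real n} (\<lambda>u. kernel u * exp (of_real u * ?w))) \<longlonglongrightarrow> completed_L s"
    unfolding completed_L_def by (rule has_integral_UNIV_imp_symmetric_limit[OF integrable_integral[OF int]])
  ultimately show ?thesis by (rule LIMSEQ_unique)
qed

lemma holomorphic_completed_L: "completed_L holomorphic_on UNIV"
proof -
  have "(\<lambda>w. integral UNIV (\<lambda>u. kernel u * exp (of_real u * w))) \<circ> (\<lambda>s. (s - 1 / 2) / 2) holomorphic_on UNIV"
    by (rule holomorphic_on_compose_gen[OF _ holomorphic_exp_integral[OF continuous_on_kernel kernel_bound]])
       (auto intro!: holomorphic_intros)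
  then show ?thesis by (simp add: o_def completed_L_def[abs_def])
qed

text \<open>Dividing by Gamma is written with the entire function \<open>rGamma\<close>, so no poles
  have to be discussed and the product is visibly entire.\<close>

definition L_fun :: "complex \<Rightarrow> complex" where
  "L_fun s = completed_L s * of_real (pi / of_int N) powr ((s + of_nat i) / 2) * rGamma ((s + of_nat i) / 2)"

lemma holomorphic_L_fun: "L_fun holomorphic_on UNIV"
  unfolding L_fun_def[abs_def]
  by (intro holomorphic_intros holomorphic_completed_L holomorphic_rGamma[THEN holomorphic_on_compose_gen[unfolded o_def], of _ UNIV])
     (use N in \<open>auto intro!: holomorphic_intros\<close>)

text \<open>The theta series is integrated term by term. With z = (s+i)/2 the n-th Gamma integral
  carries n^(-2z), and the weight n^i turns this into n^(-s). The integrals of the norms are bounded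
  by a multiple of n^(-Re s), which is summable for Re s > 1.\<close>

lemma L_fun_sums:
  assumes s: "Re s > 1"
  shows "(\<lambda>n. c (int (Suc n)) * of_nat (Suc n) powr (- s)) sums L_fun s"
proof -
  define z where "z = (s + of_nat i) / 2"
  have z: "Re z > 0" "2 * Re z = Re s + real i" using s by (auto simp: z_def)
  define a where "a = (\<lambda>n. pi * (real (Suc n))^2 / of_int N)"
  have a: "a n > 0" for n using N by (simp add: a_def)
  define E where "E = (\<lambda>n u. complex_of_real (exp (- a n * exp u)) * exp (of_real u * z))"
  define k where "k = (\<lambda>n. c (int (Suc n)) * of_nat (Suc n) ^ i)"
  define f where "f = (\<lambda>n u. k n * E n u)"
  have fth: "theta_term (exp u) (int (Suc n)) * exp (of_real u * z) = f n u" for n u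
    by (simp add: theta_term_def f_def k_def E_def a_def mult_ac del: of_nat_Suc)
  have G: "integrable lborel (E n)" "integral\<^sup>L lborel (E n) = Gamma z * of_real (a n) powr (- z)" for n
    using Gamma_integral_exp[OF a[of n] z(1)] by (simp_all add: E_def)
  have powr_a: "of_nat (Suc n) ^ i * of_real (a n) powr (- z) = of_real (pi / of_int N) powr (- z) * of_nat (Suc n) powr (- s)" for n
  proof -
    let ?m = "real (Suc n)"
    have ln: "ln (a n) = ln (pi / of_int N) + 2 * ln ?m"
      using N by (simp add: a_def ln_mult ln_div ln_realpow del: of_nat_Suc)
    have mi: "complex_of_nat (Suc n) ^ i = exp (of_nat i * of_real (ln ?m))"
    proof -
      have "complex_of_nat (Suc n) = exp (of_real (ln ?m))" by (simp only: exp_of_real exp_ln of_nat_0_less_iff zero_less_Suc of_real_of_nat_eq)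
      then show ?thesis by (simp only: exp_of_nat_mult)
    qed
    have ms: "complex_of_nat (Suc n) powr (- s) = exp (- s * of_real (ln ?m))"
      using powr_of_real_eq_exp[of ?m "- s"] by (simp del: of_nat_Suc)
    have pN: "pi / of_int N > 0" using N by simp
    show ?thesis unfolding mi ms powr_of_real_eq_exp[OF a] powr_of_real_eq_exp[OF pN] exp_add[symmetric] ln
      by (rule arg_cong[of _ _ exp]) (simp add: z_def algebra_simps add_divide_distrib del: of_nat_Suc)
  qed
  have intf: "integrable lborel (f n)" for n unfolding f_def by (intro integrable_mult_right G)
  \<comment> \<open>The constant of the Gamma integral at the real point Re z, because the modulus
    of the integrand is bounded by the same integrand at Re z.\<close>
  let ?K = "norm (Gamma (complex_of_real (Re z)) * of_real (pi / of_int N) powr (- of_real (Re z)))"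
  have intn: "(\<integral>u. norm (f n u) \<partial>lborel) \<le> ?K * real (Suc n) powr (- Re s)" for n
  proof -
    have Rz: "Re (complex_of_real (Re z)) > 0" using z by simp
    note GR = Gamma_integral_exp[OF a[of n] Rz]
    let ?h = "\<lambda>u. exp (- a n * exp u) * exp (u * Re z)"
    have cv: "complex_of_real (exp (- a n * exp u)) * exp (of_real u * of_real (Re z)) = of_real (?h u)" for u
      by (simp only: of_real_mult exp_of_real[symmetric])
    have inth: "integrable lborel ?h" using GR(1) unfolding cv complex_of_real_integrable_eq .
    have "(\<integral>u. norm (f n u) \<partial>lborel) \<le> (\<integral>u. real (Suc n) ^ i * ?h u \<partial>lborel)"
    proof (rule integral_mono)
      show "integrable lborel (\<lambda>u. norm (f n u))" using intf by simp
      show "integrable lborel (\<lambda>u. real (Suc n) ^ i * ?h u)" using inth by simp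
      fix u
      have "norm (f n u) = norm (c (int (Suc n))) * (real (Suc n) ^ i * ?h u)"
        by (simp add: f_def k_def E_def norm_mult norm_power norm_exp_eq_Re mult_ac del: of_nat_Suc)
      also have "\<dots> \<le> 1 * (real (Suc n) ^ i * ?h u)" by (rule mult_right_mono[OF norm_le]) auto
      finally show "norm (f n u) \<le> real (Suc n) ^ i * ?h u" by simp
    qed
    also have "\<dots> = real (Suc n) ^ i * (\<integral>u. ?h u \<partial>lborel)" using inth by simp
    also have "\<dots> = norm (complex_of_nat (Suc n) ^ i * of_real (\<integral>u. ?h u \<partial>lborel))"
      by (simp add: norm_mult norm_power integral_nonneg_AE del: of_nat_Suc)
    also have "complex_of_real (\<integral>u. ?h u \<partial>lborel) = Gamma (of_real (Re z)) * of_real (a n) powr (- of_real (Re z))"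
      using GR(2) unfolding cv integral_complex_of_real .
    also have "norm (complex_of_nat (Suc n) ^ i * \<dots>) = ?K * real (Suc n) powr (- Re s)"
    proof -
      let ?m = "real (Suc n)"
      have pN: "pi / of_int N > 0" using N by simp
      have "ln (a n) = ln (pi / of_int N) + 2 * ln ?m"
        using N by (simp add: a_def ln_mult ln_div ln_realpow del: of_nat_Suc)
      moreover have "?m ^ i = exp (real i * ln ?m)" by (simp add: exp_of_nat_mult del: of_nat_Suc)
      ultimately have "?m ^ i * exp (- Re z * ln (a n)) = exp (- Re z * ln (pi / of_int N)) * ?m powr (- Re s)"
        using z(2) by (simp add: powr_def exp_add[symmetric] algebra_simps del: of_nat_Suc) (metis distrib_right mult.assoc mult.commute)
      then show ?thesis
        unfolding powr_of_real_eq_exp[OF a] powr_of_real_eq_exp[OF pN] norm_mult norm_power norm_exp_eq_Re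
        by (simp add: mult_ac del: of_nat_Suc)
    qed
    finally show ?thesis .
  qed
  have sn: "summable (\<lambda>n. \<integral>u. norm (f n u) \<partial>lborel)"
  proof (rule summable_comparison_test')
    have "summable (\<lambda>n. real (Suc n) powr (- Re s))"
      using s by (subst summable_Suc_iff) (simp add: summable_real_powr_iff)
    then show "summable (\<lambda>n. ?K * real (Suc n) powr (- Re s))"
      by (rule summable_mult)
    show "norm (\<integral>u. norm (f n u) \<partial>lborel) \<le> ?K * real (Suc n) powr (- Re s)" for n
      using intn[of n] by (simp add: integral_nonneg_AE)
  qed
  have ptw: "summable (\<lambda>n. norm (f n u))" for u
  proof -
    have "summable (\<lambda>n. norm (theta_term (exp u) (int (Suc n))) * norm (exp (of_real u * z)))"
      by (intro summable_mult2 summable_comparison_test'[OF summable_theta_bound[of "exp u"]]) (use norm_theta_term_Suc_le in auto)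
    then show ?thesis by (simp only: fth[symmetric] norm_mult)
  qed
  have sumf: "(\<Sum>n. f n u) = kernel u * exp (of_real u * ((s - 1 / 2) / 2))" for u
  proof -
    obtain S where "(theta_term (exp u) has_sum S) UNIV" using theta_term_poisson[of "exp u"] by auto
    from has_sum_theta_term(2)[OF this]
    have "(\<Sum>n. f n u) = theta (exp u) * exp (of_real u * z)"
      unfolding fth[symmetric] theta_def by (rule suminf_mult2[symmetric])
    moreover have "exp (of_real u * z) = of_real (exp (u * (1 / 4 + real i / 2))) * exp (of_real u * ((s - 1 / 2) / 2))"
      unfolding exp_of_real[symmetric] exp_add[symmetric]
      by (rule arg_cong[of _ _ exp]) (simp add: z_def field_simps)
    ultimately show ?thesis by (simp add: kernel_def)
  qed
  have "(\<lambda>n. integral\<^sup>L lborel (f n)) sums (\<integral>u. (\<Sum>n. f n u) \<partial>lborel)"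
    by (rule sums_integral[OF intf _ sn]) (use ptw in simp)
  moreover have "integrable lborel (\<lambda>u. \<Sum>n. f n u)"
    by (rule integrable_suminf[OF intf _ sn]) (use ptw in simp)
  from integral_unique[OF has_integral_integral_lborel[OF this]]
  have "(\<integral>u. (\<Sum>n. f n u) \<partial>lborel) = completed_L s" unfolding sumf completed_L_def ..
  moreover have "integral\<^sup>L lborel (f n) = Gamma z * of_real (pi / of_int N) powr (- z) * (c (int (Suc n)) * of_nat (Suc n) powr (- s))" for n
  proof -
    have "integral\<^sup>L lborel (f n) = k n * (Gamma z * of_real (a n) powr (- z))"
      using G(1,2)[of n] by (simp add: f_def)
    also have "\<dots> = c (int (Suc n)) * Gamma z * (of_nat (Suc n) ^ i * of_real (a n) powr (- z))" by (simp add: k_def mult_ac del: of_nat_Suc)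
    finally show ?thesis unfolding powr_a by (simp only: mult_ac)
  qed
  ultimately have "(\<lambda>n. Gamma z * of_real (pi / of_int N) powr (- z) * (c (int (Suc n)) * of_nat (Suc n) powr (- s))) sums completed_L s"
    by simp
  from sums_mult[OF this, of "of_real (pi / of_int N) powr z * rGamma z"]
  have "(\<lambda>n. of_real (pi / of_int N) powr z * rGamma z * (Gamma z * of_real (pi / of_int N) powr (- z) * (c (int (Suc n)) * of_nat (Suc n) powr (- s)))) sums L_fun s"
    by (simp only: L_fun_def z_def mult_ac)
  moreover have "of_real (pi / of_int N) powr z * rGamma z * (Gamma z * of_real (pi / of_int N) powr (- z) * X) = X" for X
  proof -
    have g: "rGamma z * Gamma z = 1" using Gamma_eq_zero_iff[of z] z(1) by (auto simp: rGamma_inverse_Gamma elim!: nonpos_Ints_cases)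
    have p: "complex_of_real (pi / of_int N) powr z * of_real (pi / of_int N) powr (- z) = 1"
      using N by (simp add: powr_minus)
    have "of_real (pi / of_int N) powr z * rGamma z * (Gamma z * of_real (pi / of_int N) powr (- z) * X) = (rGamma z * Gamma z) * (of_real (pi / of_int N) powr z * of_real (pi / of_int N) powr (- z)) * X"
      by (simp only: mult_ac)
    then show ?thesis unfolding g p by simp
  qed
  ultimately show ?thesis by (simp only:)
qed

end

section \<open>Euler factors and divisor sums\<close>

text \<open>Primes are removed one at a time. If K is what remains so far, its multiples of p are
  exactly pK and contribute T p times the sum over K, so only finitely many Euler factors ever
  appear.\<close>

lemma infsum_coprime_to_primes:
  fixes T :: "nat \<Rightarrow> complex"
  assumes mult: "\<And>a b. T (a * b) = T a * T b" and summable: "T summable_on {0<..}"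
    and "finite A" "\<forall>p\<in>A. prime p"
  shows "(\<Sum>\<^sub>\<infinity>k\<in>{k. 0 < k \<and> (\<forall>p\<in>A. \<not> p dvd k)}. T k) = (\<Prod>p\<in>A. 1 - T p) * (\<Sum>\<^sub>\<infinity>k\<in>{0<..}. T k)"
  using assms(3,4)
proof (induction A rule: finite_induct)
  case empty
  then show ?case by (simp add: greaterThan_def)
next
  case (insert p A)
  define K where "K = {k. 0 < k \<and> (\<forall>p\<in>A. \<not> p dvd k)}"
  have p: "prime p" "p > 0" using insert.prems prime_gt_0_nat by auto
  have K: "T summable_on X" if "X \<subseteq> {0<..}" for X
    by (rule summable_on_subset_banach[OF summable that])
  have img: "(*) p ` K = {k \<in> K. p dvd k}"
  proof safe
    fix k assume k: "k \<in> K"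
    have "\<not> q dvd p * k" if "q \<in> A" for q
    proof -
      have "prime q" "q \<noteq> p" using that insert by auto
      then show ?thesis using k that p(1) by (auto simp: prime_dvd_mult_iff K_def dest: primes_dvd_imp_eq)
    qed
    then show "p * k \<in> K" using k p by (auto simp: K_def)
  next
    fix k assume k: "k \<in> K" "p dvd k"
    then obtain m where m: "k = p * m" by blast
    have "m \<in> K" using k(1) unfolding K_def m by (auto intro: dvd_mult)
    then show "k \<in> (*) p ` K" using m by blast
  qed simp
  have "{k. 0 < k \<and> (\<forall>q\<in>insert p A. \<not> q dvd k)} = K - {k \<in> K. p dvd k}" by (auto simp: K_def)
  then have "(\<Sum>\<^sub>\<infinity>k\<in>{k. 0 < k \<and> (\<forall>q\<in>insert p A. \<not> q dvd k)}. T k) = infsum T K - infsum T {k \<in> K. p dvd k}"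
    using infsum_Diff[OF K K, of K "{k \<in> K. p dvd k}"] by (auto simp: K_def)
  also have "infsum T {k \<in> K. p dvd k} = infsum (T \<circ> (*) p) K"
    unfolding img[symmetric] using p by (intro infsum_reindex) (auto simp: inj_on_def)
  also have "\<dots> = T p * infsum T K"
    unfolding o_def mult by (rule infsum_cmult_right) (use K[of K] in \<open>auto simp: K_def\<close>)
  also have "infsum T K - T p * infsum T K = (1 - T p) * infsum T K" by (simp add: algebra_simps)
  also have "infsum T K = (\<Prod>p\<in>A. 1 - T p) * (\<Sum>\<^sub>\<infinity>k\<in>{0<..}. T k)"
    unfolding K_def using insert by auto
  finally show ?case using insert.hyps by (simp add: mult.assoc)
qed

lemma powr_nat_mult:
  "of_nat (a * b) powr (w::complex) = of_nat a powr w * of_nat b powr w"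
proof (cases "a = 0 \<or> b = 0")
  case False
  then have "ln (real (a * b)) = ln (real a) + ln (real b)" by (simp add: ln_mult)
  then have "Ln (of_nat (a * b)) = Ln (of_nat a) + Ln (of_nat b)" using False by (simp add: Ln_of_nat del: of_nat_mult)
  then have "exp (w * Ln (of_nat (a * b))) = exp (w * Ln (of_nat a)) * exp (w * Ln (of_nat b))"
    by (simp only: exp_add[symmetric] ring_distribs)
  then show ?thesis using False by (simp add: powr_def)
qed auto

lemma powr_nat_prod:
  "finite A \<Longrightarrow> of_nat (\<Prod>A) powr (w::complex) = (\<Prod>a\<in>A. of_nat a powr w)"
proof (induction A rule: finite_induct)
  case (insert a A)
  then show ?case using powr_nat_mult[of a "\<Prod>A" w] by simp
qed simp

lemma prod_primes_dvd:
  fixes m :: nat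
  assumes "finite T" "\<forall>p\<in>T. prime p" "\<forall>p\<in>T. p dvd m"
  shows "\<Prod>T dvd m"
  using assms
proof (induction T rule: finite_induct)
  case (insert p T)
  have "coprime p (\<Prod>T)"
    by (rule prod_coprime_right) (use insert in \<open>auto intro!: primes_coprime\<close>)
  then show ?case using insert by (auto intro: divides_mult)
qed simp

definition divisor_sum :: "nat \<Rightarrow> (nat \<Rightarrow> complex) \<Rightarrow> complex \<Rightarrow> complex" where
  "divisor_sum F c s = (\<Sum>f | f dvd F. of_nat f powr (1 - 2 * s) * (\<Prod>p\<in>prime_factors (F div f). 1 - c p * of_nat p powr (- s)))"

text \<open>Multiplying out the Euler factors turns the divisor sum into a sum over factorisations
  $F = f d f'$ with $d$ squarefree; exchanging $f$ and $f'$ gives the functional equation.\<close>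

lemma divisor_sum_functional_equation:
  assumes F: "F > 0"
  shows "divisor_sum F c s = of_nat F powr (1 - 2 * s) * divisor_sum F c (1 - s)"
proof -
  define X where "X = (SIGMA f:{f. f dvd F}. Pow (prime_factors (F div f)))"
  define t where "t = (\<lambda>s (f, T). of_nat f powr (1 - 2 * s) * ((\<Prod>p\<in>T. - c p) * of_nat (\<Prod>T) powr (- s)))"
  have expand: "divisor_sum F c s = (\<Sum>x\<in>X. t s x)" for s
  proof -
    have "of_nat f powr (1 - 2 * s) * (\<Prod>p\<in>prime_factors (F div f). 1 - c p * of_nat p powr (- s))
        = (\<Sum>T\<in>Pow (prime_factors (F div f)). t s (f, T))" for f
    proof -
      have "(\<Prod>p\<in>prime_factors (F div f). 1 - c p * of_nat p powr (- s))
          = (\<Prod>p\<in>prime_factors (F div f). (- c p * of_nat p powr (- s)) + 1)" by simp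
      also have "\<dots> = (\<Sum>T\<in>Pow (prime_factors (F div f)). \<Prod>p\<in>T. - c p * of_nat p powr (- s))"
        by (subst prod_add) auto
      also have "\<dots> = (\<Sum>T\<in>Pow (prime_factors (F div f)). (\<Prod>p\<in>T. - c p) * of_nat (\<Prod>T) powr (- s))"
      proof (rule sum.cong)
        fix T assume "T \<in> Pow (prime_factors (F div f))"
        then have "finite T" using finite_subset by blast
        from powr_nat_prod[OF this, of "- s"]
        show "(\<Prod>p\<in>T. - c p * of_nat p powr (- s)) = (\<Prod>p\<in>T. - c p) * of_nat (\<Prod>T) powr (- s)"
          by (simp only: prod.distrib)
      qed simp
      finally show ?thesis by (simp add: t_def sum_distrib_left)
    qed
    moreover have "(\<Sum>x\<in>X. t s x) = (\<Sum>f | f dvd F. \<Sum>T\<in>Pow (prime_factors (F div f)). t s (f, T))"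
      unfolding X_def using F by (subst sum.Sigma) auto
    ultimately show ?thesis by (simp only: divisor_sum_def)
  qed
  have X: "\<Prod>T dvd F div f" "f > 0" "F = f * (\<Prod>T * (F div (f * \<Prod>T)))" "F div (f * \<Prod>T) > 0" "\<Prod>T > 0"
    "(F div (f * \<Prod>T), T) \<in> X" "F div (F div (f * \<Prod>T) * \<Prod>T) = f"
    if x: "(f, T) \<in> X" for f T
  proof -
    have fF: "f dvd F" and T: "T \<subseteq> prime_factors (F div f)" using x by (auto simp: X_def)
    have fin: "finite T" using T finite_subset by blast
    have pr: "\<forall>p\<in>T. prime p" "\<forall>p\<in>T. p dvd F div f" using T by auto
    show d: "\<Prod>T dvd F div f" by (rule prod_primes_dvd[OF fin pr])
    show f0: "f > 0" using fF F by (auto intro: Nat.gr0I)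
    obtain e where e: "F div f = \<Prod>T * e" using d by blast
    have Fe: "F = f * (\<Prod>T * e)" using fF e by (metis dvd_mult_div_cancel)
    have pos: "\<Prod>T > 0" "e > 0" using Fe F by (auto intro: Nat.gr0I)
    have e2: "F div (f * \<Prod>T) = e" using Fe f0 pos by simp
    show "F = f * (\<Prod>T * (F div (f * \<Prod>T)))" "F div (f * \<Prod>T) > 0" "\<Prod>T > 0" using Fe e2 pos by auto
    have "F div e = f * \<Prod>T" using Fe pos by (metis mult.assoc nonzero_mult_div_cancel_right less_not_refl)
    moreover have "p dvd \<Prod>T" if "p \<in> T" for p using fin that by (auto intro: dvd_prodI[of T p id, simplified])
    ultimately have "T \<subseteq> prime_factors (F div e)" using pr f0 pos by (auto simp: prime_factors_dvd)
    moreover have "e dvd F" using Fe by simp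
    ultimately show "(F div (f * \<Prod>T), T) \<in> X" unfolding e2 X_def by auto
    show "F div (F div (f * \<Prod>T) * \<Prod>T) = f" unfolding e2 using Fe pos
      by (metis mult.assoc mult.commute nonzero_mult_div_cancel_right less_not_refl mult_is_0)
  qed
  have summand: "t s (f, T) = of_nat F powr (1 - 2 * s) * t (1 - s) (F div (f * \<Prod>T), T)" if x: "(f, T) \<in> X" for f T
  proof -
    define d e where "d = \<Prod>T" and "e = F div (f * \<Prod>T)"
    have Fe: "F = f * (d * e)" and pos: "d > 0" "e > 0" using X[OF x] by (simp_all add: d_def e_def)
    \<comment> \<open>In F = f d e the powers of e cancel, the power of d is turned into itself by s
      -> 1 - s, and the power of f is the one required.\<close>
    have "of_nat e powr (1 - 2 * s) * of_nat e powr (1 - 2 * (1 - s)) = (1::complex)"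
      using pos by (simp flip: powr_add)
    moreover have "of_nat d powr (1 - 2 * s) * of_nat d powr (- (1 - s)) = (of_nat d powr (- s) :: complex)"
      by (simp flip: powr_add)
    moreover have "of_nat F powr (1 - 2 * s) * t (1 - s) (e, T)
      = of_nat f powr (1 - 2 * s) * ((\<Prod>p\<in>T. - c p) * (of_nat d powr (1 - 2 * s) * of_nat d powr (- (1 - s))))
        * (of_nat e powr (1 - 2 * s) * of_nat e powr (1 - 2 * (1 - s)))"
      unfolding Fe powr_nat_mult t_def d_def[symmetric] prod.case by (simp only: mult_ac)
    ultimately have "of_nat F powr (1 - 2 * s) * t (1 - s) (e, T) = of_nat f powr (1 - 2 * s) * ((\<Prod>p\<in>T. - c p) * of_nat d powr (- s)) * 1"
      by (simp only:)
    then show ?thesis unfolding e_def[symmetric] by (simp only: t_def d_def prod.case mult_1_right)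
  qed
  have "(\<Sum>x\<in>X. t s x) = (\<Sum>x\<in>X. of_nat F powr (1 - 2 * s) * t (1 - s) x)"
    by (rule sum.reindex_bij_witness[of _ "\<lambda>(f, T). (F div (f * \<Prod>T), T)" "\<lambda>(f, T). (F div (f * \<Prod>T), T)"])
       (use X(6,7) summand in auto)
  then show ?thesis unfolding expand by (simp add: sum_distrib_left)
qed

section \<open>The functional equation\<close>

text \<open>Conjugating the Gauss sum evaluates it at n = -1, while the principal root of D is real
  for D > 0 and imaginary for D < 0. The parity is thus read off from the Gauss sum.\<close>

lemma disc_char_minus_one:
  assumes \<psi>: "disc_char D \<psi>"
  shows "\<psi> (-1) = sgn D"
proof -
  have D0: "D \<noteq> 0" using disc_charD(1)[OF \<psi>] .
  have g: "(\<Sum>a\<in>{0..<\<bar>D\<bar>}. of_int (\<psi> a) * add_char \<bar>D\<bar> a) = csqrt (of_int D)"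
    using disc_charD(5)[OF \<psi>, of 1] disc_charD(2)[OF \<psi>] by simp
  have g': "(\<Sum>a\<in>{0..<\<bar>D\<bar>}. of_int (\<psi> a) * add_char \<bar>D\<bar> (- a)) = of_int (\<psi> (-1)) * csqrt (of_int D)"
    using disc_charD(5)[OF \<psi>, of "-1"] by simp
  have "cnj (csqrt (of_int D)) = of_int (\<psi> (-1)) * csqrt (of_int D)"
    unfolding g[symmetric] g'[unfolded g[symmetric], symmetric] by (simp add: add_char_minus cnj_sum)
  moreover have "cnj (csqrt (of_int D)) = of_int (sgn D) * csqrt (of_int D)"
  proof (cases "D > 0")
    case True
    then have "csqrt (of_int D) = of_real (sqrt (of_int D))" using csqrt_of_real_nonneg[of "of_int D"] by simp
    then show ?thesis using True by simp
  next
    case False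
    then have "csqrt (of_int D) = \<i> * of_real (sqrt \<bar>of_int D\<bar>)" using csqrt_of_real_nonpos[of "of_int D"] by simp
    then show ?thesis using False D0 by simp
  qed
  ultimately have "of_int (\<psi> (-1)) * csqrt (of_int D) = of_int (sgn D) * csqrt (of_int D)" by (rule trans[OF sym])
  moreover have "csqrt (of_int D) \<noteq> 0" using D0 by simp
  ultimately have "complex_of_int (\<psi> (-1)) = of_int (sgn D)" by (simp only: mult_right_cancel not_False_eq_True)
  then show ?thesis by (simp only: of_int_eq_iff)
qed

lemma disc_char_power:
  assumes \<psi>: "disc_char D \<psi>"
  shows "\<psi> (n ^ k) = \<psi> n ^ k"
  by (induction k) (simp_all add: disc_charD(2,3)[OF \<psi>])

text \<open>A bounded completely multiplicative function takes values of modulus at most $1$.\<close>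

lemma disc_char_abs_le:
  assumes \<psi>: "disc_char D \<psi>"
  shows "\<bar>\<psi> n\<bar> \<le> 1"
proof (rule ccontr)
  assume n: "\<not> \<bar>\<psi> n\<bar> \<le> 1"
  define B where "B = Max ((\<lambda>a. \<bar>\<psi> a\<bar>) ` {0..<\<bar>D\<bar>})"
  have B: "\<bar>\<psi> m\<bar> \<le> B" for m
  proof -
    have "\<psi> m = \<psi> (m mod \<bar>D\<bar>)" by (rule disc_char_cong[OF \<psi>]) (simp add: cong_def)
    moreover have "m mod \<bar>D\<bar> \<in> {0..<\<bar>D\<bar>}" using disc_charD(1)[OF \<psi>] by simp
    ultimately show ?thesis unfolding B_def by (intro Max_ge) auto
  qed
  have "0 \<le> B" using order_trans[OF abs_ge_zero B[of 0]] .
  have "B < 2 ^ nat B" using \<open>0 \<le> B\<close> of_nat_less_two_power[of "nat B", where 'a = int] by simp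
  also have "(2::int) ^ nat B \<le> \<bar>\<psi> n\<bar> ^ nat B" by (rule power_mono) (use n in auto)
  also have "\<dots> = \<bar>\<psi> (n ^ nat B)\<bar>" by (simp add: disc_char_power[OF \<psi>] power_abs)
  also have "\<dots> \<le> B" by (rule B)
  finally show False by simp
qed

text \<open>Some prime p divides D, so the character is 0 at p and hence at every multiple, in
  particular at 0. For D = 1 this fails: the theta series would have a constant term and the
  L-function a pole.\<close>

lemma disc_char_zero:
  assumes \<psi>: "disc_char D \<psi>" and D: "fund_disc D"
  shows "\<psi> 0 = 0"
proof -
  have "\<bar>D\<bar> \<noteq> 1"
  proof
    assume "\<bar>D\<bar> = 1"
    then have "D = 1 \<or> D = -1" by linarith
    then show False using D by (auto simp: fund_disc_def)
  qed
  then obtain p :: nat where p: "prime p" "int p dvd D"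
    using abs_eq_1_if_no_prime_divisor[of D] fund_disc_nonzero[OF D] by blast
  have "\<psi> (int p) = 0" using disc_charD(6)[OF \<psi> p(1)] p by (auto simp: kronecker_def Legendre_eq_0_iff)
  then show ?thesis using disc_charD(3)[OF \<psi>, of 0 "int p"] by simp
qed

lemma theta_char_disc_char:
  assumes \<psi>: "disc_char D \<psi>" and D: "fund_disc D"
  shows "theta_char (\<lambda>n. of_int (\<psi> n)) \<bar>D\<bar> (if D > 0 then 0 else 1)"
proof
  have D0: "D \<noteq> 0" using fund_disc_nonzero[OF D] .
  then show "0 < \<bar>D\<bar>" by simp
  show "(if D > 0 then 0 else 1) \<le> Suc 0" by simp
  show "norm (complex_of_int (\<psi> n)) \<le> 1" for n
    using disc_char_abs_le[OF \<psi>, of n] by (simp only: norm_of_int of_int_abs[symmetric] of_int_le_1_iff)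
  show "complex_of_int (\<psi> 0) = 0" using disc_char_zero[OF \<psi> D] by simp
  show "complex_of_int (\<psi> (- n)) = (-1) ^ (if D > 0 then 0 else 1) * of_int (\<psi> n)" for n
    using disc_charD(3)[OF \<psi>, of "-1" n] disc_char_minus_one[OF \<psi>] D0 by (simp add: sgn_if)
  show "complex_of_int (\<psi> (m * \<bar>D\<bar> + a)) = of_int (\<psi> a)" for a m
    using disc_char_cong[OF \<psi>, of "m * \<bar>D\<bar> + a" a] by (simp add: cong_def)
  show "(\<Sum>a\<in>{0..<\<bar>D\<bar>}. complex_of_int (\<psi> a) * cis (2 * pi * of_int (a * n) / of_int \<bar>D\<bar>))
      = of_int (\<psi> n) * (\<i> ^ (if D > 0 then 0 else 1) * of_real (sqrt (of_int \<bar>D\<bar>)))" for n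
  proof -
    have "csqrt (of_int D) = \<i> ^ (if D > 0 then 0 else 1) * of_real (sqrt (of_int \<bar>D\<bar>))"
      using csqrt_of_real_nonneg[of "of_int D"] csqrt_of_real_nonpos[of "of_int D"] D0 by simp
    then show ?thesis using disc_charD(5)[OF \<psi>, of n] by (simp only: add_char_def)
  qed
qed

lemma disc_char_prime_factors:
  assumes \<psi>: "disc_char D \<psi>" and k: "k > 0"
  shows "\<psi> (int k) = (\<Prod>p\<in>prime_factors k. \<psi> (int p) ^ multiplicity p k)"
proof -
  have prod: "\<psi> (int (\<Prod>p\<in>A. f p)) = (\<Prod>p\<in>A. \<psi> (int (f p)))" if "finite A" for A and f :: "nat \<Rightarrow> nat"
    using that by (induction A rule: finite_induct) (simp_all add: disc_charD(2,3)[OF \<psi>])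
  have "\<psi> (int k) = \<psi> (int (\<Prod>p\<in>prime_factors k. p ^ multiplicity p k))"
    using prime_factorization_nat[OF k] by simp
  also have "\<dots> = (\<Prod>p\<in>prime_factors k. \<psi> (int p) ^ multiplicity p k)"
    by (subst prod) (simp_all add: disc_char_power[OF \<psi>])
  finally show ?thesis .
qed

lemma coprime_iff_prime_factors:
  assumes "g > 0"
  shows "coprime k g \<longleftrightarrow> (\<forall>p\<in>prime_factors g. \<not> p dvd (k::nat))"
proof
  assume c: "coprime k g"
  show "\<forall>p\<in>prime_factors g. \<not> p dvd k"
  proof
    fix p assume "p \<in> prime_factors g"
    then have "prime p" "p dvd g" by auto
    then show "\<not> p dvd k" using c by (metis coprime_common_divisor not_prime_unit)
  qed
next
  assume a: "\<forall>p\<in>prime_factors g. \<not> p dvd k"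
  show "coprime k g"
  proof (rule ccontr)
    assume "\<not> coprime k g"
    then have "gcd k g \<noteq> 1" by (simp only: coprime_iff_gcd_eq_1 not_False_eq_True)
    then obtain p where p: "prime p" "p dvd gcd k g" using prime_factor_nat[of "gcd k g"] by auto
    then have "p dvd k" "p dvd g" by simp_all
    then have "p \<in> prime_factors g" using p(1) assms by (simp add: prime_factors_dvd)
    with a have "\<not> p dvd k" by (rule bspec)
    with \<open>p dvd k\<close> show False by contradiction
  qed
qed

section \<open>The series of L^S as a modified Dirichlet L-series\<close>

context S_decomposition
begin

text \<open>Away from g = F/f the symbol is the character at each prime, and a prime dividing both k
  and g makes a factor vanish. Passing from f to its inner sum thus only restricts k to be prime to
  g.\<close>

lemma symb_eq:
  assumes \<psi>: "disc_char D \<psi>" and g: "F = f * g" and k: "k \<in> ZS_pos Q"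
  shows "symb (\<delta> / (of_nat f)^2) k = (if coprime k g then \<psi> (int k) else 0)"
proof -
  have g0: "g > 0" using g pos by (auto intro: Nat.gr0I)
  have k0: "k > 0" and kQ: "\<And>p. p \<in> prime_factors k \<Longrightarrow> p \<notin> Q" using k by (auto simp: ZS_pos_iff)
  have sp: "symb_p (\<delta> / (of_nat f)^2) p = (if p dvd g then 0 else \<psi> (int p))" if "p \<in> prime_factors k" for p
  proof -
    have p: "prime p" "p \<notin> Q" using that kQ by auto
    have "kronecker D p = Legendre D (int p)" using odd_outside(2)[OF p] by (simp add: kronecker_def)
    then show ?thesis using symb_p_eq[OF g p] disc_charD(6)[OF \<psi> p(1)] by simp
  qed
  show ?thesis
  proof (cases "coprime k g")
    case True
    have "\<not> p dvd g" if "p \<in> prime_factors k" for p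
      using True that by (metis coprime_common_divisor in_prime_factors_iff not_prime_unit)
    then have "symb (\<delta> / (of_nat f)^2) k = (\<Prod>p\<in>prime_factors k. \<psi> (int p) ^ multiplicity p k)"
      unfolding symb_def using sp by (intro prod.cong) auto
    then show ?thesis using True disc_char_prime_factors[OF \<psi> k0] by simp
  next
    case False
    then obtain p where p: "p \<in> prime_factors g" "p dvd k" using coprime_iff_prime_factors[OF g0] by blast
    then have pk: "p \<in> prime_factors k" using k0 by (auto simp: prime_factors_dvd)
    have "prime_elem p" using pk by auto
    then have "multiplicity p k > 0" using prime_multiplicity_gt_zero_iff[of p k] p(2) k0 by simp
    then have "symb_p (\<delta> / (of_nat f)^2) p ^ multiplicity p k = 0" using sp[OF pk] p by auto
    then have "symb (\<delta> / (of_nat f)^2) k = 0" unfolding symb_def using pk by (intro prod_zero) auto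
    then show ?thesis using False by simp
  qed
qed

lemma LS_series_eq:
  assumes \<psi>: "disc_char D \<psi>" and s: "Re s > 1"
    and L: "(\<lambda>n. of_int (\<psi> (int (Suc n))) * of_nat (Suc n) powr (- s)) sums L"
  shows "LS_series Q \<delta> s = L * (\<Prod>q\<in>Q. 1 - of_int (\<psi> (int q)) * of_nat q powr (- s)) * divisor_sum F (\<lambda>p. of_int (\<psi> (int p))) s"
proof -
  define T where "T = (\<lambda>k. complex_of_int (\<psi> (int k)) * of_nat k powr (- s))"
  have mult: "T (a * b) = T a * T b" for a b
    unfolding T_def powr_nat_mult using disc_charD(3)[OF \<psi>, of "int a" "int b"] by simp
  have "summable (\<lambda>n. norm (T (Suc n)))"
  proof (rule summable_comparison_test')
    show "summable (\<lambda>n. real (Suc n) powr (- Re s))"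
      using s by (subst summable_Suc_iff) (simp add: summable_real_powr_iff)
    fix n
    have "norm (complex_of_int (\<psi> (int (Suc n)))) \<le> 1"
      using disc_char_abs_le[OF \<psi>, of "int (Suc n)"] by (simp only: norm_of_int of_int_abs[symmetric] of_int_le_1_iff)
    moreover have "norm (complex_of_nat (Suc n) powr (- s)) = real (Suc n) powr (- Re s)"
      using norm_powr_real_powr[of "of_nat (Suc n)" "- s"] by (simp del: of_nat_Suc)
    ultimately show "norm (norm (T (Suc n))) \<le> real (Suc n) powr (- Re s)"
      unfolding T_def norm_mult using mult_right_mono[of "norm (complex_of_int (\<psi> (int (Suc n))))" 1 "real (Suc n) powr (- Re s)"] by simp
  qed
  moreover have "(\<lambda>n. T (Suc n)) sums L" using L by (simp only: T_def)
  ultimately have "((\<lambda>n. T (Suc n)) has_sum L) UNIV" by (rule norm_summable_imp_has_sum)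
  then
  have "(T has_sum L) (range Suc)" by (subst has_sum_reindex) (auto simp: o_def)
  moreover have "range Suc = {0<..}" by (auto simp: image_iff gr0_conv_Suc)
  ultimately have TL: "(T has_sum L) {0<..}" by simp
  have inner: "(\<Sum>\<^sub>\<infinity>k\<in>ZS_pos Q. of_int (symb (\<delta> / (of_nat f)^2) k) * (of_nat k) powr (- s))
      = (\<Prod>q\<in>Q. 1 - T q) * (\<Prod>p\<in>prime_factors (F div f). 1 - T p) * L" if f: "f dvd F" for f
  proof -
    define g where "g = F div f"
    have g: "F = f * g" using f by (simp add: g_def)
    have g0: "g > 0" using g pos by (auto intro: Nat.gr0I)
    \<comment> \<open>The primes of Q and those of F/f are removed together; the two sets are
      disjoint because F is prime to Q, so the Euler factors separate.\<close>
    let ?A = "Q \<union> prime_factors g"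
    have "(\<Sum>\<^sub>\<infinity>k\<in>ZS_pos Q. of_int (symb (\<delta> / (of_nat f)^2) k) * (of_nat k) powr (- s)) = (\<Sum>\<^sub>\<infinity>k\<in>{k. 0 < k \<and> (\<forall>p\<in>?A. \<not> p dvd k)}. T k)"
      by (rule infsum_cong_neutral) (auto simp: ZS_pos_iff symb_eq[OF \<psi> g] T_def coprime_iff_prime_factors[OF g0])
    also have "\<dots> = (\<Prod>p\<in>?A. 1 - T p) * (\<Sum>\<^sub>\<infinity>k\<in>{0<..}. T k)"
      by (rule infsum_coprime_to_primes[OF mult]) (use TL Q in \<open>auto simp: summable_on_def\<close>)
    also have "(\<Sum>\<^sub>\<infinity>k\<in>{0<..}. T k) = L" using TL by (rule infsumI)
    also have "(\<Prod>p\<in>?A. 1 - T p) = (\<Prod>q\<in>Q. 1 - T q) * (\<Prod>p\<in>prime_factors g. 1 - T p)"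
    proof (rule prod.union_disjoint)
      have "p dvd F" if "p \<in> prime_factors g" for p
        unfolding g by (rule dvd_mult) (use that in auto)
      then show "Q \<inter> prime_factors g = {}" using F_coprime by blast
    qed (use Q in auto)
    finally show ?thesis by (simp only: g_def)
  qed
  have "LS_series Q \<delta> s = (\<Sum>f | f dvd F. of_nat f powr (1 - 2 * s) * ((\<Prod>q\<in>Q. 1 - T q) * (\<Prod>p\<in>prime_factors (F div f). 1 - T p) * L))"
    unfolding LS_series_def f_set_eq by (rule sum.cong) (simp_all only: inner mem_Collect_eq)
  also have "\<dots> = L * (\<Prod>q\<in>Q. 1 - T q) * (\<Sum>f | f dvd F. of_nat f powr (1 - 2 * s) * (\<Prod>p\<in>prime_factors (F div f). 1 - T p))"
    unfolding sum_distrib_left by (rule sum.cong) (simp_all only: mult_ac)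
  finally show ?thesis by (simp only: T_def divisor_sum_def)
qed

text \<open>Here \<open>tau\<close> is F^2 D with F prime to Q, and the square contributes 1. At q =
  2 this needs that the square of an odd number is 1 modulo 8.\<close>

lemma eps_eq:
  assumes \<psi>: "disc_char D \<psi>" and q: "q \<in> Q"
  shows "eps Q \<delta> q = \<psi> (int q)"
proof -
  have pq: "prime q" using q Q by blast
  have oF: "odd F" using F_coprime Q(3) by auto
  have "int F mod 4 = 1 \<or> int F mod 4 = 3" "int F mod 8 = 1 \<or> int F mod 8 = 3 \<or> int F mod 8 = 5 \<or> int F mod 8 = 7"
    using oF by presburger+
  then have m: "(int F)^2 mod 4 = 1" "(int F)^2 mod 8 = 1"
    by (auto simp: power_mod[of "int F", symmetric])
  have "kronecker ((int F)^2) q = 1"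
  proof (cases "q = 2")
    case True
    then show ?thesis using m oF by (simp add: kronecker_def)
  next
    case False
    have "\<not> int q dvd int F" using F_coprime q by simp
    then show ?thesis using Legendre_square[of "int q" "int F"] pq False by (simp add: kronecker_def)
  qed
  then show ?thesis unfolding eps_def tau_int
    using kronecker_mult[OF pq, of "(int F)^2" D] m disc_charD(6)[OF \<psi> pq] by simp
qed

lemma iota_eq: "iota \<delta> = (if D > 0 then 0 else 1)"
proof -
  have "(0 < \<delta>) = (0 < \<delta> * of_nat (v^2))" using pos by (simp add: zero_less_mult_iff)
  also have "\<dots> = (0 < D)" unfolding \<delta> using pos by (simp add: zero_less_mult_iff)
  finally show ?thesis by (simp add: iota_def)
qed

end

text \<open>The symmetry of \<open>completed_L\<close> with the Gamma factors and powers of pi/N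
  moved to one side. The assumption keeps the numerator Gamma off its poles, as
  \<open>rGamma z' * Gamma z' = 1\<close> requires.\<close>

lemma (in theta_char) L_fun_functional_equation:
  assumes ng: "(of_nat i + 1 - s) / 2 \<notin> \<int>\<^sub>\<le>\<^sub>0"
  shows "L_fun s = of_real (of_int N / pi) powr (1 / 2 - s) * (Gamma ((of_nat i + 1 - s) / 2) / Gamma ((of_nat i + s) / 2)) * L_fun (1 - s)"
proof -
  define z z' where "z = (s + of_nat i) / 2" and "z' = (1 - s + of_nat i) / 2"
  have zz: "(of_nat i + 1 - s) / 2 = z'" "(of_nat i + s) / 2 = z" by (simp_all add: z_def z'_def algebra_simps)
  have pN: "pi / of_int N > 0" "of_int N / pi > 0" using N by simp_all
  have ln: "ln (pi / of_int N) = - ln (of_int N / pi)" using N by (simp add: ln_div)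
  have p: "complex_of_real (of_int N / pi) powr (1 / 2 - s) * of_real (pi / of_int N) powr z' = of_real (pi / of_int N) powr z"
    unfolding powr_of_real_eq_exp[OF pN(1)] powr_of_real_eq_exp[OF pN(2)] exp_add[symmetric] ln
    by (rule arg_cong[of _ _ exp]) (simp add: z_def z'_def field_simps)
  have g: "rGamma z' * Gamma z' = 1"
    using ng unfolding zz rGamma_inverse_Gamma by (simp add: Gamma_eq_zero_iff)
  have "of_real (of_int N / pi) powr (1 / 2 - s) * (Gamma z' / Gamma z) * L_fun (1 - s)
      = completed_L s * (of_real (of_int N / pi) powr (1 / 2 - s) * of_real (pi / of_int N) powr z') * (rGamma z' * Gamma z') * rGamma z"
    unfolding L_fun_def completed_L_functional_equation z'_def[symmetric] rGamma_inverse_Gamma[of z] divide_inverse[of "Gamma z'"]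
    by (simp only: mult_ac)
  also have "\<dots> = L_fun s" unfolding p g L_fun_def z_def[symmetric] by simp
  finally show ?thesis unfolding zz by simp
qed

lemma holomorphic_divisor_sum: "divisor_sum F c holomorphic_on UNIV"
  unfolding divisor_sum_def[abs_def] by (intro holomorphic_intros)

theorem mainTheorem10:
  fixes Q :: "nat set" and \<delta> :: rat
  assumes "finite Q" and "\<forall>q\<in>Q. prime q" and "2 \<in> Q"
    and "inZS Q \<delta>" and "\<not> (\<exists>x::rat. \<delta> = x^2)"
  shows "\<exists>L::complex \<Rightarrow> complex. L holomorphic_on UNIV \<and>
     (\<forall>s. 1 < Re s \<longrightarrow> L s = LS_series Q \<delta> s) \<and>
     (\<forall>s. (of_nat (iota \<delta>) + 1 - s) / 2 \<notin> \<int>\<^sub>\<le>\<^sub>0 \<and>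
          (of_nat (iota \<delta>) + s) / 2 \<notin> \<int>\<^sub>\<le>\<^sub>0 \<and>
          (\<forall>q\<in>Q. 1 - of_int (eps Q \<delta> q) * (of_nat q) powr (s - 1) \<noteq> 0)
        \<longrightarrow> L s =
          (complex_of_real (real_of_rat \<bar>tau Q \<delta>\<bar> / pi)) powr (1/2 - s) *
          (\<Prod>q\<in>Q. (1 - of_int (eps Q \<delta> q) * (of_nat q) powr (- s)) /
                   (1 - of_int (eps Q \<delta> q) * (of_nat q) powr (s - 1))) *
          (Gamma ((of_nat (iota \<delta>) + 1 - s) / 2) / Gamma ((of_nat (iota \<delta>) + s) / 2)) *
          L (1 - s))"
proof -
  obtain u v F where "S_decomposition Q \<delta> u v F (disc \<delta>)"
    using S_decomposition_exists assms by metis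
  then interpret S_decomposition Q \<delta> u v F "disc \<delta>" .
  define D where "D = disc \<delta>"
  have D: "fund_disc D" using disc_sigma(1)[OF assms(5)] by (simp add: D_def)
  obtain \<psi> where \<psi>: "disc_char D \<psi>" using exists_disc_char D by blast
  define N where "N = \<bar>D\<bar>"
  have N: "N > 0" using fund_disc_nonzero[OF D] by (simp add: N_def)
  have i: "(if D > 0 then 0 else 1) = iota \<delta>" using iota_eq by (simp add: D_def)
  interpret T: theta_char "\<lambda>n. of_int (\<psi> n)" N "iota \<delta>"
    using theta_char_disc_char[OF \<psi> D] unfolding i N_def .
  define c where "c = (\<lambda>q::nat. complex_of_int (\<psi> (int q)))"
  have eps: "of_int (eps Q \<delta> q) = c q" if "q \<in> Q" for q
    using eps_eq[OF \<psi>[unfolded D_def] that] by (simp add: c_def)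
  define E where "E = (\<lambda>s. \<Prod>q\<in>Q. 1 - c q * of_nat q powr (- s))"
  \<comment> \<open>All three factors are entire. The first gives the Gamma quotient and the power
    of |D|/pi, the second the product over Q as E(s)/E(1-s), the third the power of F.\<close>
  define L where "L = (\<lambda>s. T.L_fun s * E s * divisor_sum F c s)"
  have tau_abs: "real_of_rat \<bar>tau Q \<delta>\<bar> = real (F^2) * of_int N"
  proof -
    have "\<bar>tau Q \<delta>\<bar> = of_int (int (F^2) * N)"
      unfolding tau of_int_abs[symmetric] N_def D_def by (simp add: abs_mult)
    then show ?thesis by (simp only: of_rat_of_int_eq) simp
  qed
  show ?thesis
  proof (intro exI[of _ L] conjI allI impI)
    show "L holomorphic_on UNIV"
      unfolding L_def E_def by (intro holomorphic_intros T.holomorphic_L_fun holomorphic_divisor_sum)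
  next
    fix s :: complex assume s: "1 < Re s"
    show "L s = LS_series Q \<delta> s"
      using LS_series_eq[OF \<psi>[unfolded D_def] s T.L_fun_sums[OF s]] by (simp only: L_def E_def c_def)
  next
    fix s :: complex
    assume s: "(of_nat (iota \<delta>) + 1 - s) / 2 \<notin> \<int>\<^sub>\<le>\<^sub>0 \<and> (of_nat (iota \<delta>) + s) / 2 \<notin> \<int>\<^sub>\<le>\<^sub>0 \<and>
      (\<forall>q\<in>Q. 1 - of_int (eps Q \<delta> q) * (of_nat q) powr (s - 1) \<noteq> 0)"
    let ?G = "Gamma ((of_nat (iota \<delta>) + 1 - s) / 2) / Gamma ((of_nat (iota \<delta>) + s) / 2)"
    let ?R = "\<Prod>q\<in>Q. (1 - of_int (eps Q \<delta> q) * (of_nat q) powr (- s)) / (1 - of_int (eps Q \<delta> q) * (of_nat q) powr (s - 1))"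
    have R: "?R * E (1 - s) = E s"
    proof -
      have "?R * E (1 - s) = (\<Prod>q\<in>Q. 1 - c q * of_nat q powr (- s))"
        unfolding E_def prod.distrib[symmetric]
      proof (rule prod.cong)
        fix q assume q: "q \<in> Q"
        have "1 - c q * of_nat q powr (s - 1) \<noteq> 0" using s q eps by metis
        then show "(1 - of_int (eps Q \<delta> q) * of_nat q powr (- s)) / (1 - of_int (eps Q \<delta> q) * of_nat q powr (s - 1)) * (1 - c q * of_nat q powr (- (1 - s)))
            = 1 - c q * of_nat q powr (- s)"
          unfolding eps[OF q] by simp
      qed simp
      then show ?thesis by (simp add: E_def)
    qed
    \<comment> \<open>As |tau| = F^2 |D|, the exponent 1/2 - s turns F^2 into F^(1-2s), the factor
      of \<open>divisor_sum_functional_equation\<close>, and leaves the conductor |D| for the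
      Dirichlet L-function.\<close>
    have P: "complex_of_real (real_of_rat \<bar>tau Q \<delta>\<bar> / pi) powr (1/2 - s) = of_nat F powr (1 - 2 * s) * of_real (of_int N / pi) powr (1/2 - s)"
    proof -
      have F0: "real F > 0" and Np: "of_int N / pi > 0" and t0: "real (F^2) * of_int N / pi > 0" using pos N by simp_all
      have ln: "ln (real (F^2) * of_int N / pi) = 2 * ln (real F) + ln (of_int N / pi)"
        using F0 N by (simp add: ln_mult ln_div ln_realpow)
      have "of_nat F powr (1 - 2 * s) = exp ((1 - 2 * s) * of_real (ln (real F)))"
        using powr_of_real_eq_exp[OF F0, of "1 - 2 * s"] by simp
      then show ?thesis
        unfolding tau_abs powr_of_real_eq_exp[OF t0] powr_of_real_eq_exp[OF Np] ln
        by (simp add: exp_add[symmetric]) (simp add: algebra_simps)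
    qed
    have "L s = (of_real (of_int N / pi) powr (1/2 - s) * ?G * T.L_fun (1 - s)) * (?R * E (1 - s)) * (of_nat F powr (1 - 2 * s) * divisor_sum F c (1 - s))"
      unfolding R using T.L_fun_functional_equation[of s] s divisor_sum_functional_equation[OF pos(3), of c s]
      by (simp add: L_def)
    also have "\<dots> = complex_of_real (real_of_rat \<bar>tau Q \<delta>\<bar> / pi) powr (1/2 - s) * ?R * ?G * L (1 - s)"
      unfolding P L_def by (simp only: mult_ac)
    finally show "L s = complex_of_real (real_of_rat \<bar>tau Q \<delta>\<bar> / pi) powr (1/2 - s) * ?R * ?G * L (1 - s)" .
  qed
qed

end
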